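(* Let $X$ be the random field on the torus described in the context, and suppose it satisfies Assumptions A1 and B (both stated in the context). For $N=2^{j+2}$ let $S_N,U_N$ be the skewness and kurtosis statistics of the wavelet coefficients and let $\sigma_{S_N}^2$, $\sigma_{U_N}^2=\sigma_{1U_N}^2+\sigma_{2U_N}^2$ be the normalizing constants defined in the context. Then for all non-negative integers $p_1,p_2$, as $N=2^{j+2}\to\infty$, $$\lim_{N\to\infty}E\Big[\Big(\frac{S_N}{\sigma_{S_N}}\Big)^{p_1}\Big(\frac{U_N}{\sigma_{U_N}}\Big)^{p_2}\Big]=\begin{cases}(p_1-1)!!\,(p_2-1)!! & \text{if } p_1,p_2 \text{ are both even},\\ 0&\text{otherwise,}\end{cases}$$ (with $(-1)!!=1$). Hence $$\Big(\frac{S_N}{\sigma_{S_N}},\ \frac{U_N}{\sigma_{U_N}}\Big)\ \longrightarrow\ N(0,I_2)\quad\text{in distribution as } N\to\infty,$$ where $I_2$ is the $2\times2$ identity matrix.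
   Context: **Field.** $X$ is a real-valued, zero-mean, stationary (isotropic) random field on the torus $[0,2\pi]$, $X(\vartheta)=\sum_{l\in\mathbb Z}w_l e^{il\vartheta}$, where the $w_l$ are complex random variables with $w_0=0$, $w_{-l}=\overline{w_l}$, $E w_l=0$, $E[w_l\overline{w_{l'}}]=0$ for $l\ne l'$, $E|w_l|^2=C_l$ (so $C_{-l}=C_l$), and $\sum_l C_l<\infty$. **Assumption A1.** There are constants $0<c_1\le c_2<\infty$, a real $\alpha>1$ and a function $g:\mathbb N\to[c_1,c_2]$, the restriction to $\mathbb N$ of a function in $W_1^R$ for some integer $R\ge0$ ($W_1^R$: functions with integrable weak derivative of order $R$), such that $C_l=g(l)l^{-\alpha}$ for all $l\in\mathbb N$, $l\ge1$. **Assumption B.** The field $X$ is Gaussian (the $w_l$ are jointly Gaussian). **Wavelets.** Let $\phi:\mathbb R\to[0,1]$ be an even $C^\infty$ function supported in $\{|\xi|\le1\}$ with $\phi(\xi)=1$ for $|\xi|\le\frac12$. Let $a\ge0$ be defined by $a^2(\xi)=\phi(\xi/2)-\phi(\xi)\ge 0$; $\phi$ is chosen so that $a$ is $C^\infty$. Thus $a$ is even and vanishes unless $\frac12\le|\xi|\le2$. For $N=2^{j+2}$, $j\in\mathbb N$, put $\tau=2\pi/N$ and $$\psi_N(t)=\frac1{\sqrt N}\sum_{l\in\mathbb Z}a(\tfrac{4l}N)e^{ilt},\qquad \psi_{Nk}(t)=\psi_N(t-k\tau),\qquad \beta_{Nk}=\frac1{2\pi}\int_{-\pi}^{\pi}X(\vartheta)\psi_{Nk}(\vartheta)\,d\vartheta,\quad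 k\in\mathbb Z .$$ Let $$\sigma_N^2=E[\beta_{Nk}^2]=\frac1N\sum_{N/8\le|l|\le N/2}C_l\,a^2(\tfrac{4l}N),\qquad \widehat\beta_{Nk}=\beta_{Nk}/\sigma_N .$$ **Statistics.** $$S_N=\frac1{\sqrt N}\sum_{k=1}^N\widehat\beta_{Nk}^3,\qquad U_N=\frac1{\sqrt N}\sum_{k=1}^N(\widehat\beta_{Nk}^4-3).$$ **Normalizing constants.** With Fejér's kernel $K_N(t)=\frac1{2\pi N}\big|\sum_{k=1}^Ne^{itk}\big|^2$ and all sums over integers, $$\sigma_{S_N}^2=\frac{12\pi}{\sigma_N^6N^3}\sum_{l_1,l_2,l_3}\Big(\prod_{i=1}^3C_{l_i}a^2(\tfrac{4l_i}N)\Big)K_N((l_1+l_2+l_3)\tau),$$ $$\sigma_{1U_N}^2=\frac{72}{\sigma_N^4}\frac{2\pi}{N^2}\sum_{l_1,l_2}\Big(\prod_{i=1}^2C_{l_i}a^2(\tfrac{4l_i}N)\Big)K_N((l_1+l_2)\tau),$$ $$\sigma_{2U_N}^2=\frac{24}{\sigma_N^8}\frac{2\pi}{N^4}\sum_{l_1,l_2,l_3,l_4}\Big(\prod_{i=1}^4C_{l_i}a^2(\tfrac{4l_i}N)\Big)K_N((l_1+l_2+l_3+l_4)\tau),$$ and $\sigma_{U_N}^2=\sigma_{1U_N}^2+\sigma_{2U_N}^2$. *)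

theory Defs
  imports "HOL-Probability.Probability"
begin

section \<open>The random field\<close>

text \<open>
  Functions on the torus are functions of a real angle. Strict stationarity of a field \<open>X\<close>:
  all finite-dimensional laws are invariant under rotations.
\<close>

definition stationary_field :: "'a measure \<Rightarrow> (real \<Rightarrow> 'a \<Rightarrow> real) \<Rightarrow> bool" where
  "stationary_field M X \<longleftrightarrow>
     (\<forall>I s. finite I \<longrightarrow>
        distr M (PiM I (\<lambda>_. borel)) (\<lambda>\<omega>. \<lambda>t\<in>I. X (t + s) \<omega>)
      = distr M (PiM I (\<lambda>_. borel)) (\<lambda>\<omega>. \<lambda>t\<in>I. X t \<omega>))"

text \<open>
  The series \<open>X(t) = (\<Sum>l. w\<^sub>l e\<^bsup>ilt\<^esup>)\<close> converges in mean square for every \<open>t\<close>; the joint measurability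
  of \<open>X\<close> gives a meaning to the pathwise integrals defining the wavelet coefficients.
\<close>

definition torus_field ::
  "'a measure \<Rightarrow> (real \<Rightarrow> 'a \<Rightarrow> real) \<Rightarrow> (int \<Rightarrow> 'a \<Rightarrow> complex) \<Rightarrow> (int \<Rightarrow> real) \<Rightarrow> bool" where
  "torus_field M X w C \<longleftrightarrow>
     (\<lambda>(t, \<omega>). X t \<omega>) \<in> borel_measurable (borel \<Otimes>\<^sub>M M) \<and>
     (\<forall>t. integrable M (X t) \<and> (\<integral>\<omega>. X t \<omega> \<partial>M) = 0) \<and>
     stationary_field M X \<and>
     (\<forall>l. w l \<in> borel_measurable M) \<and>
     (AE \<omega> in M. w 0 \<omega> = 0) \<and>
     (\<forall>l. AE \<omega> in M. w (- l) \<omega> = cnj (w l \<omega>)) \<and>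
     (\<forall>l. integrable M (\<lambda>\<omega>. (cmod (w l \<omega>))\<^sup>2) \<and> (\<integral>\<omega>. (cmod (w l \<omega>))\<^sup>2 \<partial>M) = C l) \<and>
     (\<forall>l. (\<integral>\<omega>. w l \<omega> \<partial>M) = 0) \<and>
     (\<forall>l l'. l \<noteq> l' \<longrightarrow> (\<integral>\<omega>. w l \<omega> * cnj (w l' \<omega>) \<partial>M) = 0) \<and>
     C summable_on UNIV \<and>
     (\<forall>t. (\<lambda>n. \<integral>\<^sup>+\<omega>. ennreal ((cmod (complex_of_real (X t \<omega>) -
              (\<Sum>l\<in>{- int n..int n}. w l \<omega> * cis (of_int l * t))))\<^sup>2) \<partial>M) \<longlonglongrightarrow> 0)"


section \<open>Assumption A1\<close>

definition smooth :: "(real \<Rightarrow> real) \<Rightarrow> bool" where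
  "smooth f \<longleftrightarrow> (\<forall>n x. (deriv ^^ n) f differentiable (at x))"

definition test_function :: "(real \<Rightarrow> real) \<Rightarrow> bool" where
  "test_function \<eta> \<longleftrightarrow> smooth \<eta> \<and> (\<exists>K. compact K \<and> (\<forall>x. x \<notin> K \<longrightarrow> \<eta> x = 0))"

definition locally_integrable :: "(real \<Rightarrow> real) \<Rightarrow> bool" where
  "locally_integrable f \<longleftrightarrow> (\<forall>K. compact K \<longrightarrow> set_integrable lebesgue K f)"

definition weak_derivative :: "nat \<Rightarrow> (real \<Rightarrow> real) \<Rightarrow> (real \<Rightarrow> real) \<Rightarrow> bool" where
  "weak_derivative R f D \<longleftrightarrow>
     locally_integrable f \<and> locally_integrable D \<and>
     (\<forall>\<eta>. test_function \<eta> \<longrightarrow>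
        (\<integral>x. f x * (deriv ^^ R) \<eta> x \<partial>lebesgue) = (-1) ^ R * (\<integral>x. D x * \<eta> x \<partial>lebesgue))"

text \<open>
  Functions with integrable weak derivative of order \<open>R\<close> (nothing is required of the integrability
  of lower orders). For \<open>R \<ge> 1\<close> such a function agrees almost everywhere with a unique continuous
  one; continuity selects that representative, so that restricting to the integers makes sense.
\<close>

definition W1 :: "nat \<Rightarrow> (real \<Rightarrow> real) set" where
  "W1 R = {f. (R \<ge> 1 \<longrightarrow> continuous_on UNIV f) \<and>
              (\<exists>D. weak_derivative R f D \<and> integrable lebesgue D)}"

definition assumption_A1 :: "(int \<Rightarrow> real) \<Rightarrow> bool" where
  "assumption_A1 C \<longleftrightarrow>
     (\<exists>c1 c2 \<alpha> (g :: nat \<Rightarrow> real) R G.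
        0 < c1 \<and> c1 \<le> c2 \<and> \<alpha> > 1 \<and>
        range g \<subseteq> {c1..c2} \<and> G \<in> W1 R \<and> (\<forall>l. g l = G (real l)) \<and>
        (\<forall>l\<ge>1. C (int l) = g l * real l powr (- \<alpha>)))"


section \<open>Assumption B\<close>

text \<open>Gaussian laws may be degenerate (for instance that of the vanishing coefficient \<open>w\<^sub>0\<close>).\<close>

definition gaussian_rv :: "'a measure \<Rightarrow> ('a \<Rightarrow> real) \<Rightarrow> bool" where
  "gaussian_rv M Y \<longleftrightarrow> Y \<in> borel_measurable M \<and>
     ((\<exists>\<mu>. AE \<omega> in M. Y \<omega> = \<mu>) \<or>
      (\<exists>\<mu> \<sigma>. \<sigma> > 0 \<and> distributed M lborel Y (normal_density \<mu> \<sigma>)))"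

text \<open>
  Since \<open>c \<bullet> z = Re c * Re z + Im c * Im z\<close>, the sums below are exactly the finite real linear
  combinations of the real and imaginary parts of the family.
\<close>

definition jointly_gaussian :: "'a measure \<Rightarrow> ('i \<Rightarrow> 'a \<Rightarrow> complex) \<Rightarrow> bool" where
  "jointly_gaussian M w \<longleftrightarrow>
     (\<forall>L c. finite L \<longrightarrow> gaussian_rv M (\<lambda>\<omega>. \<Sum>l\<in>L. c l \<bullet> w l \<omega>))"


section \<open>Wavelets and wavelet coefficients\<close>

definition wavelet_profile :: "(real \<Rightarrow> real) \<Rightarrow> (real \<Rightarrow> real) \<Rightarrow> bool" where
  "wavelet_profile \<phi> a \<longleftrightarrow>
     smooth \<phi> \<and> (\<forall>\<xi>. \<phi> \<xi> \<in> {0..1}) \<and> (\<forall>\<xi>. \<phi> (- \<xi>) = \<phi> \<xi>) \<and>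
     (\<forall>\<xi>. \<bar>\<xi>\<bar> > 1 \<longrightarrow> \<phi> \<xi> = 0) \<and> (\<forall>\<xi>. \<bar>\<xi>\<bar> \<le> 1/2 \<longrightarrow> \<phi> \<xi> = 1) \<and>
     smooth a \<and> (\<forall>\<xi>. a \<xi> \<ge> 0) \<and> (\<forall>\<xi>. (a \<xi>)\<^sup>2 = \<phi> (\<xi> / 2) - \<phi> \<xi>)"

definition tau :: "nat \<Rightarrow> real" where
  "tau N = 2 * pi / real N"

text \<open>
  The sum has finitely many non-zero terms, and it is real because \<open>a\<close> is even
  (lemma \<open>psi_complex\<close>); \<open>Re\<close> only adjusts the type.
\<close>

definition psi :: "(real \<Rightarrow> real) \<Rightarrow> nat \<Rightarrow> real \<Rightarrow> real" where
  "psi a N t = Re (1 / complex_of_real (sqrt (real N)) *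
     (\<Sum>\<^sub>\<infinity>l::int. complex_of_real (a (4 * of_int l / real N)) * cis (of_int l * t)))"

lemma wavelet_profile_even:
  assumes "wavelet_profile \<phi> a"
  shows "a (- \<xi>) = a \<xi>"
proof -
  have sq: "\<And>x. (a x)\<^sup>2 = \<phi> (x / 2) - \<phi> x" and even: "\<And>x. \<phi> (- x) = \<phi> x" and nonneg: "\<And>x. a x \<ge> 0"
    using assms unfolding wavelet_profile_def by blast+
  have "(a (- \<xi>))\<^sup>2 = (a \<xi>)\<^sup>2"
    using sq[of "- \<xi>"] sq[of \<xi>] even[of \<xi>] even[of "\<xi> / 2"] by simp
  then show ?thesis using nonneg by (simp add: power2_eq_iff_nonneg)
qed

lemma psi_complex:
  assumes "wavelet_profile \<phi> a"
  shows "complex_of_real (psi a N t) = 1 / complex_of_real (sqrt (real N)) *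
     (\<Sum>\<^sub>\<infinity>l::int. complex_of_real (a (4 * of_int l / real N)) * cis (of_int l * t))"
    (is "_ = ?c * infsum ?f UNIV")
proof -
  have "cnj (infsum ?f UNIV) = infsum (\<lambda>l. cnj (?f l)) UNIV"
    by (rule infsum_cnj[symmetric])
  also have "\<dots> = infsum ?f UNIV"
  proof (rule infsum_reindex_bij_witness[where i = uminus and j = uminus])
    fix l :: int
    show "?f (- l) = cnj (?f l)"
      using wavelet_profile_even[OF assms, of "4 * of_int l / real N"]
      by (simp add: cis_cnj)
  qed auto
  finally have "cnj (?c * infsum ?f UNIV) = ?c * infsum ?f UNIV" by simp
  then have "Im (?c * infsum ?f UNIV) = 0"
    by (simp only: complex_eq_iff complex_cnj) simp
  then show ?thesis unfolding psi_def by (simp only: complex_eq_iff) simp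
qed

definition beta ::
  "(real \<Rightarrow> 'a \<Rightarrow> real) \<Rightarrow> (real \<Rightarrow> real) \<Rightarrow> nat \<Rightarrow> int \<Rightarrow> 'a \<Rightarrow> real" where
  "beta X a N k \<omega> =
     1 / (2 * pi) * (LINT \<theta>:{- pi..pi}|lborel. X \<theta> \<omega> * psi a N (\<theta> - of_int k * tau N))"

text \<open>
  By stationarity the variance of \<open>beta X a N k\<close> does not depend on \<open>k\<close>; the definition uses \<open>k = 0\<close>.
\<close>

definition sigma_beta :: "'a measure \<Rightarrow> (real \<Rightarrow> 'a \<Rightarrow> real) \<Rightarrow> (real \<Rightarrow> real) \<Rightarrow> nat \<Rightarrow> real" where
  "sigma_beta M X a N = sqrt (\<integral>\<omega>. (beta X a N 0 \<omega>)\<^sup>2 \<partial>M)"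

definition beta_hat ::
  "'a measure \<Rightarrow> (real \<Rightarrow> 'a \<Rightarrow> real) \<Rightarrow> (real \<Rightarrow> real) \<Rightarrow> nat \<Rightarrow> int \<Rightarrow> 'a \<Rightarrow> real" where
  "beta_hat M X a N k \<omega> = beta X a N k \<omega> / sigma_beta M X a N"


section \<open>Skewness and kurtosis statistics\<close>

definition S_stat ::
  "'a measure \<Rightarrow> (real \<Rightarrow> 'a \<Rightarrow> real) \<Rightarrow> (real \<Rightarrow> real) \<Rightarrow> nat \<Rightarrow> 'a \<Rightarrow> real" where
  "S_stat M X a N \<omega> = 1 / sqrt (real N) * (\<Sum>k=1..N. (beta_hat M X a N (int k) \<omega>) ^ 3)"

definition U_stat ::
  "'a measure \<Rightarrow> (real \<Rightarrow> 'a \<Rightarrow> real) \<Rightarrow> (real \<Rightarrow> real) \<Rightarrow> nat \<Rightarrow> 'a \<Rightarrow> real" where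
  "U_stat M X a N \<omega> = 1 / sqrt (real N) * (\<Sum>k=1..N. ((beta_hat M X a N (int k) \<omega>) ^ 4 - 3))"

definition fejer :: "nat \<Rightarrow> real \<Rightarrow> real" where
  "fejer N t = 1 / (2 * pi * real N) * (cmod (\<Sum>k=1..N. cis (t * real k)))\<^sup>2"

definition Ca2 :: "(int \<Rightarrow> real) \<Rightarrow> (real \<Rightarrow> real) \<Rightarrow> nat \<Rightarrow> int \<Rightarrow> real" where
  "Ca2 C a N l = C l * (a (4 * of_int l / real N))\<^sup>2"

text \<open>The variances; only finitely many terms of the sums are non-zero.\<close>

definition var_S ::
  "'a measure \<Rightarrow> (real \<Rightarrow> 'a \<Rightarrow> real) \<Rightarrow> (int \<Rightarrow> real) \<Rightarrow> (real \<Rightarrow> real) \<Rightarrow> nat \<Rightarrow> real" where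
  "var_S M X C a N = 12 * pi / ((sigma_beta M X a N) ^ 6 * real N ^ 3) *
     (\<Sum>\<^sub>\<infinity>(l1, l2, l3). Ca2 C a N l1 * Ca2 C a N l2 * Ca2 C a N l3 *
        fejer N (of_int (l1 + l2 + l3) * tau N))"

definition var_1U ::
  "'a measure \<Rightarrow> (real \<Rightarrow> 'a \<Rightarrow> real) \<Rightarrow> (int \<Rightarrow> real) \<Rightarrow> (real \<Rightarrow> real) \<Rightarrow> nat \<Rightarrow> real" where
  "var_1U M X C a N = 72 / (sigma_beta M X a N) ^ 4 * (2 * pi / real N ^ 2) *
     (\<Sum>\<^sub>\<infinity>(l1, l2). Ca2 C a N l1 * Ca2 C a N l2 *
        fejer N (of_int (l1 + l2) * tau N))"

definition var_2U ::
  "'a measure \<Rightarrow> (real \<Rightarrow> 'a \<Rightarrow> real) \<Rightarrow> (int \<Rightarrow> real) \<Rightarrow> (real \<Rightarrow> real) \<Rightarrow> nat \<Rightarrow> real" where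
  "var_2U M X C a N = 24 / (sigma_beta M X a N) ^ 8 * (2 * pi / real N ^ 4) *
     (\<Sum>\<^sub>\<infinity>(l1, l2, l3, l4). Ca2 C a N l1 * Ca2 C a N l2 * Ca2 C a N l3 * Ca2 C a N l4 *
        fejer N (of_int (l1 + l2 + l3 + l4) * tau N))"

definition sigma_S ::
  "'a measure \<Rightarrow> (real \<Rightarrow> 'a \<Rightarrow> real) \<Rightarrow> (int \<Rightarrow> real) \<Rightarrow> (real \<Rightarrow> real) \<Rightarrow> nat \<Rightarrow> real" where
  "sigma_S M X C a N = sqrt (var_S M X C a N)"

definition sigma_U ::
  "'a measure \<Rightarrow> (real \<Rightarrow> 'a \<Rightarrow> real) \<Rightarrow> (int \<Rightarrow> real) \<Rightarrow> (real \<Rightarrow> real) \<Rightarrow> nat \<Rightarrow> real" where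
  "sigma_U M X C a N = sqrt (var_1U M X C a N + var_2U M X C a N)"


section \<open>Limits\<close>

text \<open>
  The double factorial. At \<open>p = 0\<close> truncated subtraction makes \<open>dfact (p - 1)\<close> equal to \<open>0!! = 1\<close>,
  which is the conventional value of \<open>(-1)!!\<close>.
\<close>

fun dfact :: "nat \<Rightarrow> nat" where
  "dfact 0 = 1"
| "dfact (Suc 0) = 1"
| "dfact (Suc (Suc n)) = Suc (Suc n) * dfact n"

definition weak_convergence ::
  "(nat \<Rightarrow> 'b::topological_space measure) \<Rightarrow> 'b measure \<Rightarrow> bool" where
  "weak_convergence \<mu> \<nu> \<longleftrightarrow>
     (\<forall>f :: 'b \<Rightarrow> real. continuous_on UNIV f \<and> bounded (range f) \<longrightarrow>
        (\<lambda>n. \<integral>x. f x \<partial>\<mu> n) \<longlonglongrightarrow> (\<integral>x. f x \<partial>\<nu>))"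

text \<open>\<open>N(0, I\<^sub>2)\<close>; the norm on \<^typ>\<open>real \<times> real\<close> is the Euclidean one.\<close>

definition std_normal_2d :: "(real \<times> real) measure" where
  "std_normal_2d = density lborel (\<lambda>z. ennreal (exp (- (norm z)\<^sup>2 / 2) / (2 * pi)))"

end

theory Submission
  imports Defs
begin

text \<open>
  Almost surely \<open>\<beta>\<^sub>N\<^sub>k\<close> is a finite linear combination of the \<open>w\<^sub>l\<close>, so the normalized coefficients
  \<open>x\<^sub>1, \<dots>, x\<^sub>N\<close> form a stationary Gaussian vector on \<open>\<int>/N\<close> whose spectral density is bounded uniformly
  in \<open>N\<close> and vanishes at frequency zero. Hence every entrywise power of the correlation matrix
  \<open>\<rho>\<close> has bounded operator norm and \<open>\<Sum>\<^sub>m \<rho>\<^sub>k\<^sub>m = 0\<close>. Gaussian integration by parts gives, for a polynomial \<open>h\<close>,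
  \<open>E[S h(S, U)] = E[T\<^sub>S\<^sub>S h\<^sub>S + T\<^sub>S\<^sub>U h\<^sub>U]\<close> with \<open>T\<close> built from the averages
  \<open>Q = N\<^sup>-\<^sup>1 \<Sum>\<^sub>k\<^sub>m \<rho>\<^sub>k\<^sub>m\<^sup>r x\<^sub>k\<^sup>p x\<^sub>m\<^sup>q\<close>, and likewise for \<open>U\<close>. Further integration by parts lowers the
  degree of \<open>Q\<close> up to an error \<open>O(N\<^sup>-\<^sup>1\<^sup>/\<^sup>4)\<close>, so \<open>Q\<close> may be replaced by its expectation.
  This yields the recursion \<open>m(p + 1, q) = p m(p - 1, q) + o(1)\<close> of the standard Gaussian
  moments. The variance of \<open>U\<close> is at least \<open>72\<close> because of the diagonal terms; that of \<open>S\<close> is bounded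
  below because of the resonances \<open>l\<^sub>1 + l\<^sub>2 - (l\<^sub>1 + l\<^sub>2) = 0\<close>. Moments
  determine the characteristic function, and Gaussian smoothing passes from characteristic
  functions to bounded continuous test functions.
\<close>

section \<open>Integration by parts for polynomials of Gaussian vectors\<close>

text \<open>In Hermite terms \<open>x^3 = H_3 + 3 H_1\<close> and
  \<open>x^4 - 3 = H_4 + 6 H_2\<close>. The vanishing row sums of \<rho> remove \<open>H_1\<close>;
  what is left explains the factors \<open>6 = 3!\<close>, \<open>24 = 4!\<close> and
  \<open>72 = 6^2 * 2!\<close> in the variances. The same vanishing makes the Gaussian vector
  degenerate, so integration by parts cannot start from a density: it is derived from the
  one-dimensional moment formula by differentiating in the coefficients of linear combinations.
  Bounded operator norms pass from \<rho> to its entrywise powers by the Schur product theorem,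
  because the diagonal of \<rho> is 1. The exponent 1/4 arises from bounding a single
  \<open>x_k^(2p)\<close> by the square root of the sum of all \<open>x_k^(4p)\<close>: this costs
  \<open>sqrt N\<close>, the remainder vector then has squared length \<open>O(1 / sqrt N)\<close>,
  and pairing it with a gradient of bounded length leaves \<open>O(N^(-1/4))\<close>. The series of
  the field converges at each angle in mean square only; the pathwise integral is reached through an
  error bound that does not depend on the angle.\<close>

definition finite_moments :: "'a measure \<Rightarrow> ('a \<Rightarrow> real) \<Rightarrow> bool" where
  "finite_moments M Y \<longleftrightarrow> Y \<in> borel_measurable M \<and> (\<forall>p. integrable M (\<lambda>\<omega>. \<bar>Y \<omega>\<bar> ^ p))"

lemma finite_moments_measurable [measurable_dest]: "finite_moments M Y \<Longrightarrow> Y \<in> borel_measurable M"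
  by (simp add: finite_moments_def)

lemma finite_moments_integrable_power: "finite_moments M Y \<Longrightarrow> integrable M (\<lambda>\<omega>. Y \<omega> ^ p)"
  by (rule Bochner_Integration.integrable_bound[where f = "\<lambda>\<omega>. \<bar>Y \<omega>\<bar> ^ p"])
     (auto simp: finite_moments_def power_abs)

lemma finite_moments_integrable: "finite_moments M Y \<Longrightarrow> integrable M Y"
  using finite_moments_integrable_power[of M Y 1] by simp

lemma power_add_le_convex: "\<bar>x + y\<bar> ^ p \<le> 2 ^ p * (\<bar>x\<bar> ^ p + \<bar>y\<bar> ^ p)" for x y :: real
proof -
  have "\<bar>x + y\<bar> ^ p \<le> (2 * max \<bar>x\<bar> \<bar>y\<bar>) ^ p" by (intro power_mono) auto
  also have "\<dots> = 2 ^ p * max \<bar>x\<bar> \<bar>y\<bar> ^ p" by (simp add: power_mult_distrib)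
  also have "\<dots> \<le> 2 ^ p * (\<bar>x\<bar> ^ p + \<bar>y\<bar> ^ p)"
    by (intro mult_left_mono) (auto simp: max_def)
  finally show ?thesis .
qed

text \<open>AM-GM for the p-th powers. It trades order \<open>p\<close> of a product for order
  \<open>2 * p\<close> of its factors, which is harmless where all orders are available; with
  \<open>p = 1\<close> it serves as \<open>|x y| <= x^2 + y^2\<close>.\<close>

lemma power_mult_le_sum: "\<bar>x * y\<bar> ^ p \<le> \<bar>x\<bar> ^ (2 * p) + \<bar>y\<bar> ^ (2 * p)" for x y :: real
proof -
  have "0 \<le> (\<bar>x\<bar> ^ p - \<bar>y\<bar> ^ p)\<^sup>2" by simp
  then have "2 * (\<bar>x\<bar> ^ p * \<bar>y\<bar> ^ p) \<le> (\<bar>x\<bar> ^ p)\<^sup>2 + (\<bar>y\<bar> ^ p)\<^sup>2"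
    by (simp add: power2_diff)
  moreover have "0 \<le> \<bar>x\<bar> ^ p * \<bar>y\<bar> ^ p" by simp
  moreover have "\<bar>x * y\<bar> ^ p = \<bar>x\<bar> ^ p * \<bar>y\<bar> ^ p" by (simp add: abs_mult power_mult_distrib)
  ultimately show ?thesis by (simp only: power_mult[symmetric] mult.commute[of p 2])
qed

lemma finite_moments_add:
  assumes "finite_moments M Y" "finite_moments M Z"
  shows "finite_moments M (\<lambda>\<omega>. Y \<omega> + Z \<omega>)"
  unfolding finite_moments_def
proof (intro conjI allI)
  show [measurable]: "(\<lambda>\<omega>. Y \<omega> + Z \<omega>) \<in> borel_measurable M" using assms by measurable
  fix p
  show "integrable M (\<lambda>\<omega>. \<bar>Y \<omega> + Z \<omega>\<bar> ^ p)"
    by (rule Bochner_Integration.integrable_bound[where f = "\<lambda>\<omega>. 2 ^ p * (\<bar>Y \<omega>\<bar> ^ p + \<bar>Z \<omega>\<bar> ^ p)"])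
       (use assms power_add_le_convex[of "Y _" "Z _" p] in \<open>auto simp: finite_moments_def\<close>)
qed

lemma finite_moments_mult:
  assumes "finite_moments M Y" "finite_moments M Z"
  shows "finite_moments M (\<lambda>\<omega>. Y \<omega> * Z \<omega>)"
  unfolding finite_moments_def
proof (intro conjI allI)
  show [measurable]: "(\<lambda>\<omega>. Y \<omega> * Z \<omega>) \<in> borel_measurable M" using assms by measurable
  fix p
  show "integrable M (\<lambda>\<omega>. \<bar>Y \<omega> * Z \<omega>\<bar> ^ p)"
    by (rule Bochner_Integration.integrable_bound[where f = "\<lambda>\<omega>. \<bar>Y \<omega>\<bar> ^ (2 * p) + \<bar>Z \<omega>\<bar> ^ (2 * p)"])
       (use assms power_mult_le_sum[of "Y _" "Z _" p] in \<open>auto simp: finite_moments_def\<close>)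
qed

context prob_space begin

lemma finite_moments_const: "finite_moments M (\<lambda>\<omega>. c)"
  by (simp add: finite_moments_def)

lemma finite_moments_sum: "(\<And>i. i \<in> A \<Longrightarrow> finite_moments M (f i)) \<Longrightarrow> finite_moments M (\<lambda>\<omega>. \<Sum>i\<in>A. f i \<omega>)"
  by (induction A rule: infinite_finite_induct) (auto intro: finite_moments_add finite_moments_const)

lemma finite_moments_power: "finite_moments M Y \<Longrightarrow> finite_moments M (\<lambda>\<omega>. Y \<omega> ^ p)"
  by (induction p) (auto intro: finite_moments_mult finite_moments_const)

lemma finite_moments_cmult: "finite_moments M Y \<Longrightarrow> finite_moments M (\<lambda>\<omega>. c * Y \<omega>)"
  by (intro finite_moments_mult finite_moments_const)

lemma finite_moments_diff: "finite_moments M Y \<Longrightarrow> finite_moments M Z \<Longrightarrow> finite_moments M (\<lambda>\<omega>. Y \<omega> - Z \<omega>)"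
  using finite_moments_add[of M Y "\<lambda>\<omega>. (-1) * Z \<omega>"] finite_moments_cmult[of Z "-1"] by simp

lemmas finite_moments_intros = finite_moments_add finite_moments_diff finite_moments_mult
  finite_moments_const finite_moments_sum finite_moments_power

end

section \<open>Moments of the centred normal law\<close>

fun gauss_moment :: "nat \<Rightarrow> real" where
  "gauss_moment 0 = 1"
| "gauss_moment (Suc 0) = 0"
| "gauss_moment (Suc (Suc n)) = real (Suc n) * gauss_moment n"

lemma gauss_moment_odd: "gauss_moment (2 * k + 1) = 0"
  by (induction k) auto

lemma gauss_moment_even: "gauss_moment (2 * k) = fact (2 * k) / (2 ^ k * fact k)"
proof (induction k)
  case (Suc k)
  have "fact (2 * Suc k) = (2 * real k + 2) * (2 * real k + 1) * fact (2 * k)"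
    by (simp add: algebra_simps)
  moreover have "2 ^ Suc k * fact (Suc k) = (2 * real k + 2) * (2 ^ k * fact k)"
    by (simp add: algebra_simps)
  moreover have "gauss_moment (2 * Suc k) = (2 * real k + 1) * gauss_moment (2 * k)" by simp
  moreover have "2 * real k + 2 \<noteq> 0" by (simp add: add_nonneg_eq_0_iff)
  ultimately show ?case by (simp only: Suc) (simp add: divide_simps)
qed simp

lemma gauss_moment_eq_dfact: "gauss_moment n = (if even n then real (dfact (n - 1)) else 0)"
proof (induction n rule: gauss_moment.induct)
  case (3 n)
  then show ?case by (cases n) (auto simp: algebra_simps)
qed auto

text \<open>Degenerate laws are included: mean zero forces the constant to be 0, and both sides
  equal \<open>0 ^ n\<close>, with value 1 at \<open>n = 0\<close>. Writing the standard deviation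
  as the root of the second moment gives one formula for both kinds of law.\<close>

lemma (in prob_space) gaussian_rv_moments:
  assumes "gaussian_rv M Y" and "expectation Y = 0"
  shows "finite_moments M Y"
    and "expectation (\<lambda>\<omega>. Y \<omega> ^ n) = gauss_moment n * sqrt (expectation (\<lambda>\<omega>. (Y \<omega>)\<^sup>2)) ^ n"
proof -
  have Ym [measurable]: "Y \<in> borel_measurable M" using assms by (simp add: gaussian_rv_def)
  have "finite_moments M Y \<and> (\<forall>n. expectation (\<lambda>\<omega>. Y \<omega> ^ n) = gauss_moment n * sqrt (expectation (\<lambda>\<omega>. (Y \<omega>)\<^sup>2)) ^ n)"
    using assms(1) unfolding gaussian_rv_def
  proof (elim conjE disjE exE)
    fix \<mu> assume ae: "AE \<omega> in M. Y \<omega> = \<mu>"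
    have "expectation Y = expectation (\<lambda>_. \<mu>)" by (rule integral_cong_AE) (use ae in auto)
    then have "\<mu> = 0" using assms prob_space by simp
    with ae have ae: "AE \<omega> in M. Y \<omega> = 0" by simp
    have "\<forall>p. integrable M (\<lambda>\<omega>. \<bar>Y \<omega>\<bar> ^ p)"
    proof
      fix p show "integrable M (\<lambda>\<omega>. \<bar>Y \<omega>\<bar> ^ p)"
      by (rule integrable_cong_AE_imp[where g = "\<lambda>_. \<bar>0\<bar> ^ p"]) (use ae in auto)
    qed
    moreover have E: "expectation (\<lambda>\<omega>. Y \<omega> ^ n) = 0 ^ n" for n
    proof -
      have "expectation (\<lambda>\<omega>. Y \<omega> ^ n) = expectation (\<lambda>_. 0 ^ n)"
        by (rule integral_cong_AE) (use ae in auto)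
      then show ?thesis by (simp add: prob_space)
    qed
    moreover have "expectation (\<lambda>\<omega>. Y \<omega> ^ n) = gauss_moment n * sqrt (expectation (\<lambda>\<omega>. (Y \<omega>)\<^sup>2)) ^ n" for n
      unfolding E by (cases n) auto
    then have "\<forall>n. expectation (\<lambda>\<omega>. Y \<omega> ^ n) = gauss_moment n * sqrt (expectation (\<lambda>\<omega>. (Y \<omega>)\<^sup>2)) ^ n"
      by blast
    ultimately show ?thesis using Ym unfolding finite_moments_def by blast
  next
    fix \<mu> \<sigma> :: real assume \<sigma>: "0 < \<sigma>" and D: "distributed M lborel Y (normal_density \<mu> \<sigma>)"
    have "\<mu> = 0" using normal_distributed_expectation[OF \<sigma> D] assms by simp
    with D have D: "distributed M lborel Y (normal_density 0 \<sigma>)" by simp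
    have "\<forall>p. integrable M (\<lambda>\<omega>. \<bar>Y \<omega>\<bar> ^ p)"
    proof
      fix p show "integrable M (\<lambda>\<omega>. \<bar>Y \<omega>\<bar> ^ p)"
      using distributed_integrable[OF D, of "\<lambda>x. \<bar>x\<bar> ^ p"] integrable_normal_moment_abs[OF \<sigma>, of 0 p] by simp
    qed
    moreover have E: "expectation (\<lambda>\<omega>. Y \<omega> ^ n) = gauss_moment n * \<sigma> ^ n" for n
    proof -
      have *: "expectation (\<lambda>\<omega>. Y \<omega> ^ n) = (\<integral>x. normal_density 0 \<sigma> x * x ^ n \<partial>lborel)"
        using distributed_integral[OF D, of "\<lambda>x. x ^ n"] by simp
      show ?thesis
      proof (cases "even n")
        case True
        then obtain k where k: "n = 2 * k" by (elim evenE)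
        have "(2 / \<sigma>\<^sup>2) ^ k = 2 ^ k / \<sigma> ^ (2 * k)" by (simp add: power_divide power_mult)
        then show ?thesis
          using * integral_normal_moment_even[OF \<sigma>, of 0 k]
          by (simp only: k gauss_moment_even diff_zero) simp
      next
        case False
        then obtain k where k: "n = 2 * k + 1" by (elim oddE)
        then show ?thesis
          using * integral_normal_moment_odd[OF \<sigma>, of 0 k]
          by (simp only: k gauss_moment_odd diff_zero)
      qed
    qed
    moreover have "sqrt (expectation (\<lambda>\<omega>. (Y \<omega>)\<^sup>2)) = \<sigma>"
      using E[of 2] \<sigma> by (simp add: numeral_2_eq_2)
    with E have "\<forall>n. expectation (\<lambda>\<omega>. Y \<omega> ^ n) = gauss_moment n * sqrt (expectation (\<lambda>\<omega>. (Y \<omega>)\<^sup>2)) ^ n"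
      by (simp only:) blast
    ultimately show ?thesis using Ym unfolding finite_moments_def by blast
  qed
  then show "finite_moments M Y"
    and "expectation (\<lambda>\<omega>. Y \<omega> ^ n) = gauss_moment n * sqrt (expectation (\<lambda>\<omega>. (Y \<omega>)\<^sup>2)) ^ n"
    by blast+
qed

text \<open>Expanding the power binomially makes the expectation a polynomial in \<open>s\<close>,
  so differentiation under the integral needs no domination argument. The derivative at 0 is the
  coefficient of \<open>s\<close>.\<close>

lemma (in prob_space) has_derivative_moment:
  assumes A: "finite_moments M A" and Y: "finite_moments M Y" and Z: "finite_moments M Z"
  shows "((\<lambda>s. expectation (\<lambda>\<omega>. A \<omega> * (Y \<omega> + s * Z \<omega>) ^ n)) has_real_derivative
           real n * expectation (\<lambda>\<omega>. A \<omega> * Z \<omega> * Y \<omega> ^ (n - 1))) (at 0)"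
proof -
  define c where "c i = expectation (\<lambda>\<omega>. A \<omega> * Z \<omega> ^ i * Y \<omega> ^ (n - i))" for i
  have int: "integrable M (\<lambda>\<omega>. A \<omega> * Z \<omega> ^ i * Y \<omega> ^ (n - i))" for i
    by (intro finite_moments_integrable finite_moments_intros A Y Z)
  have eq: "expectation (\<lambda>\<omega>. A \<omega> * (Y \<omega> + s * Z \<omega>) ^ n) = (\<Sum>i\<le>n. of_nat (n choose i) * s ^ i * c i)" for s
  proof -
    have "A \<omega> * (Y \<omega> + s * Z \<omega>) ^ n
        = (\<Sum>i\<le>n. of_nat (n choose i) * s ^ i * (A \<omega> * Z \<omega> ^ i * Y \<omega> ^ (n - i)))" for \<omega>
      by (subst add.commute)
         (simp add: binomial_ring sum_distrib_left power_mult_distrib mult_ac)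
    then show ?thesis unfolding c_def using int by (simp)
  qed
  have "((\<lambda>s. \<Sum>i\<le>n. of_nat (n choose i) * s ^ i * c i) has_real_derivative
      (\<Sum>i\<le>n. of_nat (n choose i) * (real i * 0 ^ (i - 1)) * c i)) (at 0)"
    by (auto intro!: derivative_eq_intros sum.cong)
  \<comment> \<open>\<open>0 ^ (i - 1)\<close> is 1 at \<open>i = 1\<close>; by truncation it is 1
    at \<open>i = 0\<close> too, where the factor \<open>real i\<close> removes the term.\<close>
  also have "(\<Sum>i\<le>n. of_nat (n choose i) * (real i * 0 ^ (i - 1)) * c i) =
             (\<Sum>i\<le>n. if i = 1 then of_nat (n choose i) * c i else 0)"
    by (intro sum.cong) auto
  also have "\<dots> = real n * expectation (\<lambda>\<omega>. A \<omega> * Z \<omega> * Y \<omega> ^ (n - 1))"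
    by (cases "n = 0") (auto simp: c_def)
  finally show ?thesis unfolding eq .
qed

text \<open>Gaussianity is required of linear combinations only, so singular covariance matrices are
  allowed. They do occur: the correlation matrices used later annihilate the constant
  vector.\<close>

locale gaussian_family = prob_space M for M :: "'a measure" +
  fixes I :: "'i set" and x :: "'i \<Rightarrow> 'a \<Rightarrow> real"
  assumes finite_I [simp]: "finite I"
    and gaussian: "\<And>c. gaussian_rv M (\<lambda>\<omega>. \<Sum>i\<in>I. c i * x i \<omega>)"
    and centered: "\<And>i. i \<in> I \<Longrightarrow> expectation (x i) = 0"
begin

definition \<rho> :: "'i \<Rightarrow> 'i \<Rightarrow> real" where
  "\<rho> i k = expectation (\<lambda>\<omega>. x i \<omega> * x k \<omega>)"

lemma \<rho>_sym: "\<rho> i k = \<rho> k i"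
  by (simp add: \<rho>_def mult.commute)

lemma x_gaussian: assumes "i \<in> I" shows "gaussian_rv M (x i)"
proof -
  have "(\<lambda>\<omega>. \<Sum>k\<in>I. (if k = i then 1 else 0) * x k \<omega>) = x i"
    using assms by (simp add: if_distrib if_distribR cong: if_cong)
  then show ?thesis using gaussian[of "\<lambda>k. if k = i then 1 else 0"] by simp
qed

lemma x_moments: "i \<in> I \<Longrightarrow> finite_moments M (x i)"
  by (intro gaussian_rv_moments x_gaussian centered)

definition lin :: "('i \<Rightarrow> real) \<Rightarrow> 'a \<Rightarrow> real" where
  "lin c \<omega> = (\<Sum>i\<in>I. c i * x i \<omega>)"

lemma lin_moments: "finite_moments M (lin c)"
  unfolding lin_def by (intro finite_moments_intros x_moments)

lemma lin_centered: "expectation (lin c) = 0"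
  unfolding lin_def using x_moments centered by (simp add: finite_moments_integrable)

lemma lin_power: "expectation (\<lambda>\<omega>. lin c \<omega> ^ n) = gauss_moment n * sqrt (expectation (\<lambda>\<omega>. (lin c \<omega>)\<^sup>2)) ^ n"
  by (rule gaussian_rv_moments) (use gaussian[of c] lin_centered in \<open>simp_all add: lin_def[abs_def]\<close>)

lemma lin_add_var:
  assumes "k \<in> I" shows "lin (\<lambda>i. c i + (if i = k then s else 0)) \<omega> = lin c \<omega> + s * x k \<omega>"
proof -
  have "lin (\<lambda>i. c i + (if i = k then s else 0)) \<omega> = (\<Sum>i\<in>I. c i * x i \<omega> + (if i = k then s * x i \<omega> else 0))"
    unfolding lin_def by (intro sum.cong) (auto simp: distrib_right)
  then show ?thesis using assms by (simp add: sum.distrib lin_def)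
qed

lemma cov_lin_add_var:
  assumes "k \<in> I" "i \<in> I"
  shows "expectation (\<lambda>\<omega>. x i \<omega> * (lin c \<omega> + s * x k \<omega>)) = expectation (\<lambda>\<omega>. x i \<omega> * lin c \<omega>) + s * \<rho> i k"
proof -
  have "integrable M (\<lambda>\<omega>. x i \<omega> * lin c \<omega>)" "integrable M (\<lambda>\<omega>. x i \<omega> * x k \<omega>)"
    by (intro finite_moments_integrable finite_moments_intros x_moments lin_moments assms)+
  then show ?thesis by (simp add: \<rho>_def distrib_left mult.left_commute)
qed

text \<open>Moving the coefficient of \<open>x k\<close> by \<open>s\<close> keeps
  \<open>lin\<close> in the Gaussian family. The moment of order \<open>n + 1\<close> of the moved
  combination is differentiated at \<open>s = 0\<close> in two ways: binomially, which gives
  \<open>(n + 1) E[x_k lin^n]\<close>, and through the moment formula in terms of the variance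
  \<open>V s\<close>.\<close>

lemma lin_parts:
  assumes k: "k \<in> I"
  shows "expectation (\<lambda>\<omega>. x k \<omega> * lin c \<omega> ^ n)
       = real n * expectation (\<lambda>\<omega>. x k \<omega> * lin c \<omega>) * expectation (\<lambda>\<omega>. lin c \<omega> ^ (n - 1))"
proof -
  define V where "V s = expectation (\<lambda>\<omega>. (lin c \<omega> + s * x k \<omega>)\<^sup>2)" for s
  have V0: "V s \<ge> 0" for s unfolding V_def by simp
  have fm: "finite_moments M (lin c)" "finite_moments M (x k)" "finite_moments M (\<lambda>\<omega>. 1)"
    by (intro lin_moments x_moments k finite_moments_intros)+
  note D = has_derivative_moment[OF fm(3,1,2), simplified]
  have P: "expectation (\<lambda>\<omega>. (lin c \<omega> + s * x k \<omega>) ^ m) = gauss_moment m * sqrt (V s) ^ m" for s m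
    unfolding V_def using lin_power[of "\<lambda>i. c i + (if i = k then s else 0)" m] by (simp add: lin_add_var[OF k])
  have P0: "expectation (\<lambda>\<omega>. lin c \<omega> ^ m) = gauss_moment m * sqrt (V 0) ^ m" for m
    using P[of 0 m] by simp
  have DV: "(V has_real_derivative 2 * expectation (\<lambda>\<omega>. x k \<omega> * lin c \<omega>)) (at 0)"
    using D[of 2] unfolding V_def by simp
  show ?thesis
  proof (cases "even n")
    case True
    \<comment> \<open>The moment of odd order \<open>Suc n\<close> vanishes for every
      \<open>s\<close>, hence so does its derivative. The right side is 0 as well: either
      \<open>n = 0\<close>, or \<open>n - 1\<close> is odd.\<close>
    have "odd (Suc n)" using True by simp
    then obtain q where q: "Suc n = 2 * q + 1" by (elim oddE)
    have "((\<lambda>s::real. 0) has_real_derivative real (Suc n) * expectation (\<lambda>\<omega>. x k \<omega> * lin c \<omega> ^ n)) (at 0)"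
      using D[of "Suc n"] P[of _ "Suc n"] gauss_moment_odd[of q] by (simp only: q[symmetric]) (simp del: of_nat_Suc power_Suc)
    from DERIV_unique[OF this DERIV_const] have 1: "expectation (\<lambda>\<omega>. x k \<omega> * lin c \<omega> ^ n) = 0" by simp
    have "n = 0 \<or> gauss_moment (n - 1) = 0"
    proof (cases n)
      case (Suc m) then have "odd m" using True by simp
      then show ?thesis using gauss_moment_odd Suc by (auto elim!: oddE)
    qed simp
    then show ?thesis using 1 P0[of "n - 1"] by auto
  next
    case False
    then obtain q where q: "n = 2 * q + 1" by (elim oddE)
    \<comment> \<open>Only even powers of the standard deviation occur, so the moment is a
      polynomial in \<open>V s\<close> and can be differentiated even where
      \<open>V 0 = 0\<close>.\<close>
    have "sqrt (V s) ^ (2 * m) = V s ^ m" for s m using V0 by (simp add: power_mult)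
    note sq = this
    have eq: "expectation (\<lambda>\<omega>. (lin c \<omega> + s * x k \<omega>) ^ Suc n) = gauss_moment (Suc n) * V s ^ Suc q" for s
      unfolding P using sq[of s "Suc q"] by (simp add: q)
    have "((\<lambda>s. gauss_moment (Suc n) * V s ^ Suc q) has_real_derivative
            gauss_moment (Suc n) * (real (Suc q) * V 0 ^ q * (2 * expectation (\<lambda>\<omega>. x k \<omega> * lin c \<omega>)))) (at 0)"
      using DERIV_cmult[OF DERIV_power[OF DV, of "Suc q"], of "gauss_moment (Suc n)"] by (simp add: mult_ac)
    moreover have "((\<lambda>s. gauss_moment (Suc n) * V s ^ Suc q) has_real_derivative
            real (Suc n) * expectation (\<lambda>\<omega>. x k \<omega> * lin c \<omega> ^ n)) (at 0)"
      using D[of "Suc n"] unfolding eq by simp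
    ultimately have "real (Suc n) * expectation (\<lambda>\<omega>. x k \<omega> * lin c \<omega> ^ n)
        = gauss_moment (Suc n) * (real (Suc q) * V 0 ^ q * (2 * expectation (\<lambda>\<omega>. x k \<omega> * lin c \<omega>)))"
      by (rule DERIV_unique[rotated])
    also have "\<dots> = real (Suc n) * (gauss_moment (Suc n) * (V 0 ^ q * expectation (\<lambda>\<omega>. x k \<omega> * lin c \<omega>)))"
      by (simp add: q algebra_simps)
    finally have "expectation (\<lambda>\<omega>. x k \<omega> * lin c \<omega> ^ n) = gauss_moment (Suc n) * (V 0 ^ q * expectation (\<lambda>\<omega>. x k \<omega> * lin c \<omega>))"
      by (simp only: mult_cancel_left) simp
    also have "gauss_moment (Suc n) = real n * gauss_moment (n - 1)" by (simp add: q)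
    finally show ?thesis unfolding P0 using sq[of 0 q] by (simp add: q)
  qed
qed

text \<open>The pairs of a polynomial in the variables \<open>x i\<close> and its formal partial derivatives.\<close>

inductive polynomial_rv :: "('a \<Rightarrow> real) \<Rightarrow> ('i \<Rightarrow> 'a \<Rightarrow> real) \<Rightarrow> bool" where
  const: "polynomial_rv (\<lambda>\<omega>. c) (\<lambda>i \<omega>. 0)"
| add: "polynomial_rv F F' \<Longrightarrow> polynomial_rv G G' \<Longrightarrow>
    polynomial_rv (\<lambda>\<omega>. F \<omega> + G \<omega>) (\<lambda>i \<omega>. F' i \<omega> + G' i \<omega>)"
| var_mult: "polynomial_rv F F' \<Longrightarrow> k \<in> I \<Longrightarrow>
    polynomial_rv (\<lambda>\<omega>. x k \<omega> * F \<omega>) (\<lambda>i \<omega>. (if i = k then F \<omega> else 0) + x k \<omega> * F' i \<omega>)"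

lemma polynomial_rv_moments:
  assumes "polynomial_rv F F'"
  shows "finite_moments M F" "finite_moments M (F' i)"
proof -
  have "finite_moments M F \<and> (\<forall>i. finite_moments M (F' i))"
    using assms
  proof induction
    case (var_mult F F' k)
    then have "finite_moments M (\<lambda>\<omega>. if i = k then F \<omega> else 0)" for i
      by (cases "i = k") (auto intro: finite_moments_intros)
    then show ?case using var_mult by (auto intro!: finite_moments_intros x_moments)
  qed (auto intro!: finite_moments_intros)
  then show "finite_moments M F" "finite_moments M (F' i)" by auto
qed

text \<open>The extra factor \<open>lin c ^ n\<close> strengthens the induction. A new variable
  \<open>x z\<close> in the polynomial is produced by moving the coefficient of \<open>x z\<close>
  in \<open>lin c ^ (n + 1)\<close> and differentiating the identity known for the shorter
  polynomial; for this the identity must be available for all \<open>c\<close> and all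
  \<open>n\<close>.\<close>

lemma parts_with_lin:
  assumes "polynomial_rv F F'" and k: "k \<in> I"
  shows "expectation (\<lambda>\<omega>. x k \<omega> * F \<omega> * lin c \<omega> ^ n)
       = real n * expectation (\<lambda>\<omega>. x k \<omega> * lin c \<omega>) * expectation (\<lambda>\<omega>. F \<omega> * lin c \<omega> ^ (n - 1))
         + (\<Sum>i\<in>I. \<rho> k i * expectation (\<lambda>\<omega>. F' i \<omega> * lin c \<omega> ^ n))"
  using assms(1)
proof (induction arbitrary: c n)
  case (const d)
  have "expectation (\<lambda>\<omega>. x k \<omega> * d * lin c \<omega> ^ n) = d * expectation (\<lambda>\<omega>. x k \<omega> * lin c \<omega> ^ n)"
    by (simp add: mult_ac)
  then show ?case by (simp add: lin_parts[OF k])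
next
  case (add F F' G G')
  note fm = polynomial_rv_moments[OF add.hyps(1)] polynomial_rv_moments[OF add.hyps(2)] x_moments[OF k] lin_moments
  have int: "integrable M (\<lambda>\<omega>. x k \<omega> * F \<omega> * lin c \<omega> ^ n)" "integrable M (\<lambda>\<omega>. x k \<omega> * G \<omega> * lin c \<omega> ^ n)"
     "integrable M (\<lambda>\<omega>. F \<omega> * lin c \<omega> ^ (n - 1))" "integrable M (\<lambda>\<omega>. G \<omega> * lin c \<omega> ^ (n - 1))"
     "\<And>i. integrable M (\<lambda>\<omega>. F' i \<omega> * lin c \<omega> ^ n)" "\<And>i. integrable M (\<lambda>\<omega>. G' i \<omega> * lin c \<omega> ^ n)"
    by (intro finite_moments_integrable finite_moments_intros fm)+
  show ?case
    using add.IH int by (simp add: distrib_left distrib_right sum.distrib algebra_simps)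
next
  case (var_mult F F' z)
  note fm = polynomial_rv_moments[OF var_mult.hyps(1)] x_moments[OF k] x_moments[OF \<open>z \<in> I\<close>] lin_moments
  let ?C = "expectation (\<lambda>\<omega>. x k \<omega> * lin c \<omega>)"
  have fm': "finite_moments M (\<lambda>\<omega>. x k \<omega> * F \<omega>)" by (intro finite_moments_intros fm)
  have IH: "expectation (\<lambda>\<omega>. x k \<omega> * F \<omega> * (lin c \<omega> + s * x z \<omega>) ^ Suc n)
    = real (Suc n) * (?C + s * \<rho> k z) * expectation (\<lambda>\<omega>. F \<omega> * (lin c \<omega> + s * x z \<omega>) ^ n)
     + (\<Sum>i\<in>I. \<rho> k i * expectation (\<lambda>\<omega>. F' i \<omega> * (lin c \<omega> + s * x z \<omega>) ^ Suc n))" for s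
    using var_mult.IH[of "\<lambda>i. c i + (if i = z then s else 0)" "Suc n"]
    by (simp only: lin_add_var[OF \<open>z \<in> I\<close>] cov_lin_add_var[OF \<open>z \<in> I\<close> k] diff_Suc_1)
  note D = has_derivative_moment[OF _ lin_moments fm(4)]
  \<comment> \<open>Product rule at \<open>s = 0\<close>: the moved covariance
    \<open>?C + s * \<rho> k z\<close> yields the term in which the derivative hits the new
    variable; the others are the old terms with one more factor \<open>x z\<close>.\<close>
  have "((\<lambda>s. real (Suc n) * (?C + s * \<rho> k z) * expectation (\<lambda>\<omega>. F \<omega> * (lin c \<omega> + s * x z \<omega>) ^ n)
     + (\<Sum>i\<in>I. \<rho> k i * expectation (\<lambda>\<omega>. F' i \<omega> * (lin c \<omega> + s * x z \<omega>) ^ Suc n))) has_real_derivative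
     (real (Suc n) * \<rho> k z * expectation (\<lambda>\<omega>. F \<omega> * lin c \<omega> ^ n)
      + real (Suc n) * ?C * (real n * expectation (\<lambda>\<omega>. F \<omega> * x z \<omega> * lin c \<omega> ^ (n - 1)))
     + (\<Sum>i\<in>I. \<rho> k i * (real (Suc n) * expectation (\<lambda>\<omega>. F' i \<omega> * x z \<omega> * lin c \<omega> ^ n))))) (at 0)"
    by (auto intro!: derivative_eq_intros D[OF fm(1)] D[OF fm(2)] sum.cong simp del: of_nat_Suc power_Suc)
  moreover have "((\<lambda>s. expectation (\<lambda>\<omega>. x k \<omega> * F \<omega> * (lin c \<omega> + s * x z \<omega>) ^ Suc n)) has_real_derivative
     real (Suc n) * expectation (\<lambda>\<omega>. x k \<omega> * F \<omega> * x z \<omega> * lin c \<omega> ^ n)) (at 0)"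
    using D[OF fm', of c "Suc n"] by simp
  ultimately have "real (Suc n) * expectation (\<lambda>\<omega>. x k \<omega> * F \<omega> * x z \<omega> * lin c \<omega> ^ n) =
     (real (Suc n) * \<rho> k z * expectation (\<lambda>\<omega>. F \<omega> * lin c \<omega> ^ n)
      + real (Suc n) * ?C * (real n * expectation (\<lambda>\<omega>. F \<omega> * x z \<omega> * lin c \<omega> ^ (n - 1)))
     + (\<Sum>i\<in>I. \<rho> k i * (real (Suc n) * expectation (\<lambda>\<omega>. F' i \<omega> * x z \<omega> * lin c \<omega> ^ n))))"
    unfolding IH by (rule DERIV_unique[rotated])
  also have "\<dots> = real (Suc n) * (\<rho> k z * expectation (\<lambda>\<omega>. F \<omega> * lin c \<omega> ^ n)
      + ?C * (real n * expectation (\<lambda>\<omega>. F \<omega> * x z \<omega> * lin c \<omega> ^ (n - 1)))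
     + (\<Sum>i\<in>I. \<rho> k i * expectation (\<lambda>\<omega>. F' i \<omega> * x z \<omega> * lin c \<omega> ^ n)))"
    by (simp add: distrib_left sum_distrib_left mult_ac del: of_nat_Suc)
  finally have "expectation (\<lambda>\<omega>. x k \<omega> * F \<omega> * x z \<omega> * lin c \<omega> ^ n) =
     \<rho> k z * expectation (\<lambda>\<omega>. F \<omega> * lin c \<omega> ^ n)
      + ?C * (real n * expectation (\<lambda>\<omega>. F \<omega> * x z \<omega> * lin c \<omega> ^ (n - 1)))
     + (\<Sum>i\<in>I. \<rho> k i * expectation (\<lambda>\<omega>. F' i \<omega> * x z \<omega> * lin c \<omega> ^ n))"
    by (simp only: mult_cancel_left) simp
  moreover have "expectation (\<lambda>\<omega>. ((if i = z then F \<omega> else 0) + x z \<omega> * F' i \<omega>) * lin c \<omega> ^ n)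
     = (if i = z then expectation (\<lambda>\<omega>. F \<omega> * lin c \<omega> ^ n) else 0) + expectation (\<lambda>\<omega>. F' i \<omega> * x z \<omega> * lin c \<omega> ^ n)" for i
  proof -
    have "integrable M (\<lambda>\<omega>. F \<omega> * lin c \<omega> ^ n)" "integrable M (\<lambda>\<omega>. F' i \<omega> * x z \<omega> * lin c \<omega> ^ n)"
      by (intro finite_moments_integrable finite_moments_intros fm)+
    then show ?thesis by (auto simp: distrib_left distrib_right mult_ac)
  qed
  moreover have "(\<Sum>i\<in>I. \<rho> k i * (if i = z then E else 0)) = \<rho> k z * E" for E
  proof -
    have "(\<Sum>i\<in>I. \<rho> k i * (if i = z then E else 0)) = (\<Sum>i\<in>I. if i = z then \<rho> k i * E else 0)"
      by (intro sum.cong) auto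
    then show ?thesis using \<open>z \<in> I\<close> by simp
  qed
  moreover have "(\<lambda>\<omega>. x k \<omega> * (x z \<omega> * F \<omega>) * lin c \<omega> ^ n) = (\<lambda>\<omega>. x k \<omega> * F \<omega> * x z \<omega> * lin c \<omega> ^ n)"
      "(\<lambda>\<omega>. x z \<omega> * F \<omega> * lin c \<omega> ^ (n - 1)) = (\<lambda>\<omega>. F \<omega> * x z \<omega> * lin c \<omega> ^ (n - 1))"
    by (auto simp: mult_ac)
  ultimately show ?case
    by (simp only: distrib_left sum.distrib mult.assoc[of "real n"] mult.left_commute[of ?C])
qed

text \<open>The case \<open>n = 0\<close> of the strengthened identity, known as Stein's or Wick's
  formula. \<open>F'\<close> is a formal gradient: when the \<open>x i\<close> are linearly
  dependent, one random variable has several, and the formula holds for each.\<close>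

theorem gaussian_parts:
  assumes "polynomial_rv F F'" and "k \<in> I"
  shows "expectation (\<lambda>\<omega>. x k \<omega> * F \<omega>) = (\<Sum>i\<in>I. \<rho> k i * expectation (F' i))"
  using parts_with_lin[OF assms, of _ 0] by simp

lemma polynomial_rv_cong:
  assumes "polynomial_rv F F'" "\<And>\<omega>. F \<omega> = G \<omega>" "\<And>i \<omega>. F' i \<omega> = G' i \<omega>"
  shows "polynomial_rv G G'"
proof -
  have "F = G" "F' = G'" using assms by (auto intro!: ext)
  then show ?thesis using assms by simp
qed

lemma polynomial_rv_cmult:
  "polynomial_rv F F' \<Longrightarrow> polynomial_rv (\<lambda>\<omega>. c * F \<omega>) (\<lambda>i \<omega>. c * F' i \<omega>)"
proof (induction rule: polynomial_rv.induct)
  case (const d)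
  then show ?case using polynomial_rv.const[of "c * d"] by simp
next
  case (add F F' G G')
  from polynomial_rv.add[OF add.IH] show ?case by (simp add: distrib_left)
next
  case (var_mult F F' k)
  from polynomial_rv.var_mult[OF var_mult.IH \<open>k \<in> I\<close>] show ?case
    by (rule polynomial_rv_cong) (auto simp: algebra_simps)
qed

lemma polynomial_rv_mult:
  assumes "polynomial_rv F F'" and G: "polynomial_rv G G'"
  shows "polynomial_rv (\<lambda>\<omega>. F \<omega> * G \<omega>) (\<lambda>i \<omega>. F' i \<omega> * G \<omega> + F \<omega> * G' i \<omega>)"
  using assms(1)
proof induction
  case (const d)
  then show ?case using polynomial_rv_cmult[OF G, of d] by simp
next
  case (add F F' G G')
  from polynomial_rv.add[OF add.IH] show ?case
    by (rule polynomial_rv_cong) (auto simp: algebra_simps)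
next
  case (var_mult F F' k)
  from polynomial_rv.var_mult[OF var_mult.IH \<open>k \<in> I\<close>] show ?case
    by (rule polynomial_rv_cong) (auto simp: algebra_simps)
qed

lemma polynomial_rv_var: "k \<in> I \<Longrightarrow> polynomial_rv (x k) (\<lambda>i \<omega>. if i = k then 1 else 0)"
  by (rule polynomial_rv_cong[OF polynomial_rv.var_mult[OF polynomial_rv.const[of 1]]]) auto

lemma polynomial_rv_power:
  assumes "polynomial_rv F F'"
  shows "polynomial_rv (\<lambda>\<omega>. F \<omega> ^ n) (\<lambda>i \<omega>. real n * F \<omega> ^ (n - 1) * F' i \<omega>)"
proof (induction n)
  case 0
  show ?case using polynomial_rv.const[of 1] by simp
next
  case (Suc n)
  from polynomial_rv_mult[OF assms Suc] show ?case
    by (rule polynomial_rv_cong) (cases n; auto simp: algebra_simps)+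
qed

lemma polynomial_rv_sum:
  assumes "finite A" "\<And>a. a \<in> A \<Longrightarrow> polynomial_rv (F a) (F' a)"
  shows "polynomial_rv (\<lambda>\<omega>. \<Sum>a\<in>A. F a \<omega>) (\<lambda>i \<omega>. \<Sum>a\<in>A. F' a i \<omega>)"
  using assms
proof (induction A rule: finite_induct)
  case empty
  show ?case using polynomial_rv.const[of 0] by simp
next
  case (insert a A)
  from polynomial_rv.add[of "F a" "F' a", OF _ insert.IH] insert show ?case by auto
qed

end

section \<open>Moments of the skewness and kurtosis statistics of a Gaussian array\<close>

definition bounded_moments :: "'a measure \<Rightarrow> ('j \<Rightarrow> 'a \<Rightarrow> real) \<Rightarrow> bool" where
  "bounded_moments M Y \<longleftrightarrow>
     (\<forall>j. finite_moments M (Y j)) \<and> (\<forall>p. \<exists>B. \<forall>j. (\<integral>\<omega>. \<bar>Y j \<omega>\<bar> ^ p \<partial>M) \<le> B)"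

lemma power_mean_le_mean_power:
  fixes f :: "'b \<Rightarrow> real"
  assumes "finite A" "A \<noteq> {}" "\<And>k. k \<in> A \<Longrightarrow> f k \<ge> 0"
  shows "((\<Sum>k\<in>A. f k) / card A) ^ p \<le> (\<Sum>k\<in>A. f k ^ p) / card A"
proof -
  have conv: "convex_on {0::real..} (\<lambda>x. x ^ p)"
  proof (cases "even p")
    case True
    then show ?thesis using convex_power_even convex_on_subset by blast
  next
    case False
    then show ?thesis by (rule convex_power_odd)
  qed
  have "(\<Sum>k\<in>A. (1 / card A) *\<^sub>R f k) ^ p \<le> (\<Sum>k\<in>A. (1 / card A) * f k ^ p)"
    by (rule convex_on_sum[OF assms(1,2) conv]) (use assms in \<open>auto simp: card_gt_0_iff\<close>)
  then show ?thesis by (simp add: sum_divide_distrib)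
qed

context prob_space begin

lemma bounded_moments_finite: "bounded_moments M Y \<Longrightarrow> finite_moments M (Y j)"
  by (simp add: bounded_moments_def)

lemma bounded_momentsE:
  assumes "bounded_moments M Y"
  obtains B where "B \<ge> 0" "\<And>j. expectation (\<lambda>\<omega>. \<bar>Y j \<omega>\<bar> ^ p) \<le> B"
proof -
  from assms obtain B where "\<And>j. expectation (\<lambda>\<omega>. \<bar>Y j \<omega>\<bar> ^ p) \<le> B"
    unfolding bounded_moments_def by blast
  then have "\<And>j. expectation (\<lambda>\<omega>. \<bar>Y j \<omega>\<bar> ^ p) \<le> max 0 B" by (simp add: le_max_iff_disj)
  then show thesis using that[of "max 0 B"] by simp
qed

lemma bounded_moments_expectation:
  assumes "bounded_moments M Y"
  obtains B where "B \<ge> 0" "\<And>j. \<bar>expectation (Y j)\<bar> \<le> B"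
proof -
  obtain B where B: "B \<ge> 0" "\<And>j. expectation (\<lambda>\<omega>. \<bar>Y j \<omega>\<bar> ^ 1) \<le> B"
    using bounded_momentsE[OF assms, of 1] by blast
  have "\<bar>expectation (Y j)\<bar> \<le> B" for j
    using B(2)[of j] order_trans[OF integral_abs_bound[of M "Y j"]] by simp
  with B(1) show thesis by (rule that)
qed

lemma bounded_moments_const: "bounded_moments M (\<lambda>j \<omega>. c)"
  by (auto simp: bounded_moments_def finite_moments_const prob_space)

lemma bounded_moments_add:
  assumes "bounded_moments M Y" "bounded_moments M Z"
  shows "bounded_moments M (\<lambda>j \<omega>. Y j \<omega> + Z j \<omega>)"
  unfolding bounded_moments_def
proof (intro conjI allI)
  fix j show "finite_moments M (\<lambda>\<omega>. Y j \<omega> + Z j \<omega>)"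
    using assms by (intro finite_moments_add bounded_moments_finite)
next
  fix p
  obtain B where B: "\<And>j. expectation (\<lambda>\<omega>. \<bar>Y j \<omega>\<bar> ^ p) \<le> B" using bounded_momentsE[OF assms(1), of p] by blast
  obtain C where C: "\<And>j. expectation (\<lambda>\<omega>. \<bar>Z j \<omega>\<bar> ^ p) \<le> C" using bounded_momentsE[OF assms(2), of p] by blast
  have "expectation (\<lambda>\<omega>. \<bar>Y j \<omega> + Z j \<omega>\<bar> ^ p) \<le> 2 ^ p * (B + C)" for j
  proof -
    have fm: "finite_moments M (Y j)" "finite_moments M (Z j)" "finite_moments M (\<lambda>\<omega>. Y j \<omega> + Z j \<omega>)"
      using assms by (intro finite_moments_add bounded_moments_finite; simp)+
    then have int: "integrable M (\<lambda>\<omega>. \<bar>Y j \<omega>\<bar> ^ p)" "integrable M (\<lambda>\<omega>. \<bar>Z j \<omega>\<bar> ^ p)"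
      "integrable M (\<lambda>\<omega>. \<bar>Y j \<omega> + Z j \<omega>\<bar> ^ p)" by (simp_all add: finite_moments_def)
    have "expectation (\<lambda>\<omega>. \<bar>Y j \<omega> + Z j \<omega>\<bar> ^ p) \<le> expectation (\<lambda>\<omega>. 2 ^ p * (\<bar>Y j \<omega>\<bar> ^ p + \<bar>Z j \<omega>\<bar> ^ p))"
      by (rule integral_mono) (use int power_add_le_convex in auto)
    also have "\<dots> \<le> 2 ^ p * (B + C)" using int B[of j] C[of j] by simp
    finally show ?thesis .
  qed
  then show "\<exists>B. \<forall>j. expectation (\<lambda>\<omega>. \<bar>Y j \<omega> + Z j \<omega>\<bar> ^ p) \<le> B" by blast
qed

lemma bounded_moments_mult:
  assumes "bounded_moments M Y" "bounded_moments M Z"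
  shows "bounded_moments M (\<lambda>j \<omega>. Y j \<omega> * Z j \<omega>)"
  unfolding bounded_moments_def
proof (intro conjI allI)
  fix j show "finite_moments M (\<lambda>\<omega>. Y j \<omega> * Z j \<omega>)"
    using assms by (intro finite_moments_mult bounded_moments_finite)
next
  fix p
  obtain B where B: "\<And>j. expectation (\<lambda>\<omega>. \<bar>Y j \<omega>\<bar> ^ (2 * p)) \<le> B" using bounded_momentsE[OF assms(1), of "2 * p"] by blast
  obtain C where C: "\<And>j. expectation (\<lambda>\<omega>. \<bar>Z j \<omega>\<bar> ^ (2 * p)) \<le> C" using bounded_momentsE[OF assms(2), of "2 * p"] by blast
  have "expectation (\<lambda>\<omega>. \<bar>Y j \<omega> * Z j \<omega>\<bar> ^ p) \<le> B + C" for j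
  proof -
    have fm: "finite_moments M (Y j)" "finite_moments M (Z j)" "finite_moments M (\<lambda>\<omega>. Y j \<omega> * Z j \<omega>)"
      using assms by (intro finite_moments_mult bounded_moments_finite; simp)+
    then have int: "integrable M (\<lambda>\<omega>. \<bar>Y j \<omega>\<bar> ^ (2 * p))" "integrable M (\<lambda>\<omega>. \<bar>Z j \<omega>\<bar> ^ (2 * p))"
      "integrable M (\<lambda>\<omega>. \<bar>Y j \<omega> * Z j \<omega>\<bar> ^ p)" unfolding finite_moments_def by blast+
    have "expectation (\<lambda>\<omega>. \<bar>Y j \<omega> * Z j \<omega>\<bar> ^ p) \<le> expectation (\<lambda>\<omega>. \<bar>Y j \<omega>\<bar> ^ (2 * p) + \<bar>Z j \<omega>\<bar> ^ (2 * p))"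
      by (rule integral_mono) (use int power_mult_le_sum in auto)
    also have "\<dots> \<le> B + C" using int B[of j] C[of j] by simp
    finally show ?thesis .
  qed
  then show "\<exists>B. \<forall>j. expectation (\<lambda>\<omega>. \<bar>Y j \<omega> * Z j \<omega>\<bar> ^ p) \<le> B" by blast
qed

lemma bounded_moments_power: "bounded_moments M Y \<Longrightarrow> bounded_moments M (\<lambda>j \<omega>. Y j \<omega> ^ p)"
  by (induction p) (auto intro: bounded_moments_mult bounded_moments_const)

lemma bounded_moments_dominated:
  assumes Z: "bounded_moments M Z" and fm: "\<And>j. finite_moments M (Y j)"
    and le: "\<And>j \<omega>. \<bar>Y j \<omega>\<bar> \<le> Z j \<omega>"
  shows "bounded_moments M Y"
  unfolding bounded_moments_def
proof (intro conjI allI fm)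
  fix p
  obtain C where C: "\<And>j. expectation (\<lambda>\<omega>. \<bar>Z j \<omega>\<bar> ^ p) \<le> C" using bounded_momentsE[OF Z, of p] by blast
  have "expectation (\<lambda>\<omega>. \<bar>Y j \<omega>\<bar> ^ p) \<le> C" for j
  proof -
    have "integrable M (\<lambda>\<omega>. \<bar>Y j \<omega>\<bar> ^ p)" "integrable M (\<lambda>\<omega>. \<bar>Z j \<omega>\<bar> ^ p)"
      using fm[of j] bounded_moments_finite[OF Z, of j] unfolding finite_moments_def by blast+
    then have "expectation (\<lambda>\<omega>. \<bar>Y j \<omega>\<bar> ^ p) \<le> expectation (\<lambda>\<omega>. \<bar>Z j \<omega>\<bar> ^ p)"
    proof (rule integral_mono)
      fix \<omega>
      have "\<bar>Y j \<omega>\<bar> \<le> \<bar>Z j \<omega>\<bar>" using le[of j \<omega>] by linarith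
      then show "\<bar>Y j \<omega>\<bar> ^ p \<le> \<bar>Z j \<omega>\<bar> ^ p" by (intro power_mono) auto
    qed
    with C[of j] show ?thesis by simp
  qed
  then show "\<exists>B. \<forall>j. expectation (\<lambda>\<omega>. \<bar>Y j \<omega>\<bar> ^ p) \<le> B" by blast
qed

text \<open>Even orders suffice by \<open>|y|^p <= 1 + y^(2p)\<close>. This removes absolute values,
  so that moment identities apply directly.\<close>

lemma bounded_moments_even:
  assumes fm: "\<And>j. finite_moments M (Y j)" and B: "\<And>p. \<exists>B. \<forall>j. expectation (\<lambda>\<omega>. Y j \<omega> ^ (2 * p)) \<le> B"
  shows "bounded_moments M Y"
  unfolding bounded_moments_def
proof (intro conjI allI fm)
  fix p
  obtain C where C: "\<And>j. expectation (\<lambda>\<omega>. Y j \<omega> ^ (2 * p)) \<le> C" using B[of p] by blast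
  have "expectation (\<lambda>\<omega>. \<bar>Y j \<omega>\<bar> ^ p) \<le> 1 + C" for j
  proof -
    have int: "integrable M (\<lambda>\<omega>. \<bar>Y j \<omega>\<bar> ^ p)" "integrable M (\<lambda>\<omega>. Y j \<omega> ^ (2 * p))"
      using fm[of j] finite_moments_integrable_power[OF fm, of j "2 * p"] unfolding finite_moments_def by blast+
    have "\<bar>Y j \<omega>\<bar> ^ p \<le> 1 + Y j \<omega> ^ (2 * p)" for \<omega>
    proof -
      have "(0::real) \<le> (\<bar>Y j \<omega>\<bar> ^ p - 1)\<^sup>2" "0 \<le> \<bar>Y j \<omega>\<bar> ^ p" by simp_all
      moreover have "(\<bar>Y j \<omega>\<bar> ^ p)\<^sup>2 = Y j \<omega> ^ (2 * p)"
        by (simp add: power_mult[symmetric] mult.commute power_even_abs)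
      ultimately show ?thesis unfolding power2_diff by (smt (verit) power_one)
    qed
    then have "expectation (\<lambda>\<omega>. \<bar>Y j \<omega>\<bar> ^ p) \<le> expectation (\<lambda>\<omega>. 1 + Y j \<omega> ^ (2 * p))"
      by (intro integral_mono) (use int in auto)
    with C[of j] int show ?thesis by (simp add: prob_space)
  qed
  then show "\<exists>B. \<forall>j. expectation (\<lambda>\<omega>. \<bar>Y j \<omega>\<bar> ^ p) \<le> B" by blast
qed

lemmas bounded_moments_intros = bounded_moments_const bounded_moments_add bounded_moments_mult bounded_moments_power

end

text \<open>The facts about the normalized coefficients that enter the calculus below.
  \<open>K\<close> bounds the squared operator norm of every entrywise power of the correlation
  matrix, uniformly in the row \<open>j\<close> and the exponent \<open>r\<close>;
  \<open>zero_sum\<close> expresses the absence of frequency zero.\<close>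

locale gaussian_array = prob_space M for M :: "'a measure" +
  fixes n :: "nat \<Rightarrow> nat" and x :: "nat \<Rightarrow> nat \<Rightarrow> 'a \<Rightarrow> real" and K :: real
  assumes n_pos: "n j > 0"
    and row_gaussian: "gaussian_family M {1..n j} (x j)"
    and unit_variance: "k \<in> {1..n j} \<Longrightarrow> expectation (\<lambda>\<omega>. x j k \<omega> * x j k \<omega>) = 1"
    and operator_bound: "1 \<le> r \<Longrightarrow> (\<Sum>k\<in>{1..n j}. (\<Sum>m\<in>{1..n j}. expectation (\<lambda>\<omega>. x j k \<omega> * x j m \<omega>) ^ r * y m)\<^sup>2)
           \<le> K * (\<Sum>m\<in>{1..n j}. (y m)\<^sup>2)"
    and zero_sum: "k \<in> {1..n j} \<Longrightarrow> (\<Sum>m\<in>{1..n j}. expectation (\<lambda>\<omega>. x j k \<omega> * x j m \<omega>)) = 0"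
begin

abbreviation I :: "nat \<Rightarrow> nat set" where "I j \<equiv> {1..n j}"

sublocale row: gaussian_family M "I j" "x j" for j
  by (rule row_gaussian)

abbreviation \<rho> :: "nat \<Rightarrow> nat \<Rightarrow> nat \<Rightarrow> real" where "\<rho> j \<equiv> row.\<rho> j"

lemma \<rho>_diag: "k \<in> I j \<Longrightarrow> \<rho> j k k = 1"
  using unit_variance by (simp add: row.\<rho>_def)

lemma operator_\<rho>: "1 \<le> r \<Longrightarrow> (\<Sum>k\<in>I j. (\<Sum>m\<in>I j. \<rho> j k m ^ r * y m)\<^sup>2) \<le> K * (\<Sum>m\<in>I j. (y m)\<^sup>2)"
  using operator_bound unfolding row.\<rho>_def .

lemma zero_sum_\<rho>: "k \<in> I j \<Longrightarrow> (\<Sum>m\<in>I j. \<rho> j k m) = 0"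
  using zero_sum unfolding row.\<rho>_def .

lemma zero_sum_\<rho>': "k \<in> I j \<Longrightarrow> (\<Sum>m\<in>I j. \<rho> j m k) = 0"
  using zero_sum_\<rho>[of k j] by (simp add: row.\<rho>_sym[of j _ k])

lemma K_nonneg: "K \<ge> 0"
proof -
  have "0 \<le> (\<Sum>k\<in>I 0. (\<Sum>m\<in>I 0. \<rho> 0 k m ^ 1 * 1)\<^sup>2)" by (intro sum_nonneg) auto
  also have "\<dots> \<le> K * (\<Sum>m\<in>I 0. 1\<^sup>2)" by (rule operator_\<rho>) simp
  finally show ?thesis using n_pos[of 0] by (simp add: zero_le_mult_iff)
qed

lemmas fm_intros = finite_moments_intros row.x_moments

lemma x_power: assumes "k \<in> I j" shows "expectation (\<lambda>\<omega>. x j k \<omega> ^ p) = gauss_moment p"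
  using gaussian_rv_moments(2)[OF row.x_gaussian row.centered, OF assms assms, of p] unit_variance[OF assms]
  by (simp add: power2_eq_square)

text \<open>Jensen's inequality bounds a power of the average by the average of the powers, whose
  expectation is a single normal moment because every \<open>x j k\<close> is standard
  normal.\<close>

lemma bounded_moments_avg_power: "bounded_moments M (\<lambda>j \<omega>. (\<Sum>k\<in>I j. x j k \<omega> ^ p) / n j)"
proof (rule bounded_moments_even)
  show "finite_moments M (\<lambda>\<omega>. (\<Sum>k\<in>I j. x j k \<omega> ^ p) / n j)" for j
    unfolding divide_inverse by (intro fm_intros)
  fix q
  have "expectation (\<lambda>\<omega>. ((\<Sum>k\<in>I j. x j k \<omega> ^ p) / n j) ^ (2 * q)) \<le> gauss_moment (p * (2 * q))" for j
  proof -
    have fm: "finite_moments M (\<lambda>\<omega>. ((\<Sum>k\<in>I j. x j k \<omega> ^ p) / n j) ^ (2 * q))"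
       "finite_moments M (\<lambda>\<omega>. (\<Sum>k\<in>I j. x j k \<omega> ^ (p * (2 * q))) / n j)"
      unfolding divide_inverse by (intro fm_intros; simp)+
    have le: "((\<Sum>k\<in>I j. x j k \<omega> ^ p) / n j) ^ (2 * q) \<le> (\<Sum>k\<in>I j. x j k \<omega> ^ (p * (2 * q))) / n j" for \<omega>
    proof -
      have "((\<Sum>k\<in>I j. x j k \<omega> ^ p) / n j) ^ (2 * q) = \<bar>(\<Sum>k\<in>I j. x j k \<omega> ^ p) / n j\<bar> ^ (2 * q)"
        by (rule power_even_abs[symmetric]) simp
      also have "\<dots> \<le> ((\<Sum>k\<in>I j. \<bar>x j k \<omega> ^ p\<bar>) / card (I j)) ^ (2 * q)"
        by (intro power_mono) (simp_all add: divide_right_mono sum_abs)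
      also have "\<dots> \<le> (\<Sum>k\<in>I j. \<bar>x j k \<omega> ^ p\<bar> ^ (2 * q)) / card (I j)"
        by (rule power_mean_le_mean_power) (use n_pos[of j] in auto)
      also have "\<dots> = (\<Sum>k\<in>I j. x j k \<omega> ^ (p * (2 * q))) / n j"
        by (simp add: power_even_abs power_mult)
      finally show ?thesis .
    qed
    have "expectation (\<lambda>\<omega>. ((\<Sum>k\<in>I j. x j k \<omega> ^ p) / n j) ^ (2 * q))
         \<le> expectation (\<lambda>\<omega>. (\<Sum>k\<in>I j. x j k \<omega> ^ (p * (2 * q))) / n j)"
      by (rule integral_mono) (use fm le finite_moments_integrable in blast)+
    also have "\<dots> = (\<Sum>k\<in>I j. expectation (\<lambda>\<omega>. x j k \<omega> ^ (p * (2 * q)))) / n j"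
      using finite_moments_integrable_power[OF row.x_moments[of _ j]] by simp
    also have "\<dots> = gauss_moment (p * (2 * q))"
      using n_pos[of j] by (simp add: x_power)
    finally show ?thesis .
  qed
  then show "\<exists>B. \<forall>j. expectation (\<lambda>\<omega>. ((\<Sum>k\<in>I j. x j k \<omega> ^ p) / n j) ^ (2 * q)) \<le> B" by blast
qed

section \<open>Quadratic averages of powers and their decorrelation\<close>

abbreviation square_gradient :: "nat \<Rightarrow> (nat \<Rightarrow> 'a \<Rightarrow> real) \<Rightarrow> real" where
  "square_gradient j h' \<equiv> expectation (\<lambda>\<omega>. \<Sum>i\<in>I j. (h' i \<omega>)\<^sup>2)"

definition R :: "nat \<Rightarrow> nat \<Rightarrow> nat \<Rightarrow> nat \<Rightarrow> 'a \<Rightarrow> real" where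
  "R r q j k \<omega> = (\<Sum>m\<in>I j. \<rho> j k m ^ r * x j m \<omega> ^ q)"

definition Q :: "nat \<Rightarrow> nat \<Rightarrow> nat \<Rightarrow> nat \<Rightarrow> 'a \<Rightarrow> real" where
  "Q r p q j \<omega> = (\<Sum>k\<in>I j. \<Sum>m\<in>I j. \<rho> j k m ^ r * x j k \<omega> ^ p * x j m \<omega> ^ q) / n j"

lemma Q_eq_R: "Q r p q j \<omega> = (\<Sum>k\<in>I j. x j k \<omega> ^ p * R r q j k \<omega>) / n j"
  by (simp add: Q_def R_def sum_distrib_left mult_ac)

lemma Q_commute: "Q r p q j \<omega> = Q r q p j \<omega>"
  unfolding Q_def by (subst sum.swap) (simp add: row.\<rho>_sym mult_ac)

lemma R_square_sum: "1 \<le> r \<Longrightarrow> (\<Sum>k\<in>I j. (R r q j k \<omega>)\<^sup>2) \<le> K * (\<Sum>k\<in>I j. x j k \<omega> ^ (2 * q))"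
  unfolding R_def using operator_\<rho>[of r j "\<lambda>m. x j m \<omega> ^ q"] by (simp add: power_mult[symmetric] mult.commute)

lemma R_moments: "finite_moments M (R r q j k)"
  unfolding R_def by (intro fm_intros)

lemma Q_moments: "finite_moments M (Q r p q j)"
  unfolding Q_def divide_inverse by (intro fm_intros)

text \<open>\<open>Q\<close> is an inner product divided by the row length:
  \<open>|u v| <= u^2 + v^2\<close> separates the two vectors, and the operator norm bound removes
  the matrix. The exponent \<open>r = 0\<close> is excluded because the all-ones matrix has norm
  equal to the row length.\<close>

lemma Q_bounded_moments:
  assumes "1 \<le> r" shows "bounded_moments M (Q r p q)"
proof (rule bounded_moments_dominated)
  let ?A = "\<lambda>p j \<omega>. (\<Sum>k\<in>I j. x j k \<omega> ^ p) / n j"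
  show "bounded_moments M (\<lambda>j \<omega>. ?A (2 * p) j \<omega> + K * ?A (2 * q) j \<omega>)"
    by (intro bounded_moments_intros bounded_moments_avg_power)
  show "finite_moments M (Q r p q j)" for j by (rule Q_moments)
  fix j \<omega>
  have "\<bar>Q r p q j \<omega>\<bar> \<le> (\<Sum>k\<in>I j. \<bar>x j k \<omega> ^ p * R r q j k \<omega>\<bar>) / n j"
    unfolding Q_eq_R by (simp add: divide_right_mono sum_abs)
  also have "\<dots> \<le> (\<Sum>k\<in>I j. x j k \<omega> ^ (2 * p) + (R r q j k \<omega>)\<^sup>2) / n j"
  proof (intro divide_right_mono sum_mono)
    fix k
    have "\<bar>x j k \<omega> ^ p * R r q j k \<omega>\<bar> \<le> (x j k \<omega> ^ p)\<^sup>2 + (R r q j k \<omega>)\<^sup>2"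
      using power_mult_le_sum[of "x j k \<omega> ^ p" "R r q j k \<omega>" 1] by simp
    then show "\<bar>x j k \<omega> ^ p * R r q j k \<omega>\<bar> \<le> x j k \<omega> ^ (2 * p) + (R r q j k \<omega>)\<^sup>2"
      by (simp add: power_mult[symmetric] mult.commute)
  qed simp
  also have "\<dots> \<le> ((\<Sum>k\<in>I j. x j k \<omega> ^ (2 * p)) + K * (\<Sum>k\<in>I j. x j k \<omega> ^ (2 * q))) / n j"
    using R_square_sum[OF assms, of q j \<omega>] by (intro divide_right_mono) (simp_all add: sum.distrib)
  finally show "\<bar>Q r p q j \<omega>\<bar> \<le> ?A (2 * p) j \<omega> + K * ?A (2 * q) j \<omega>"
    by (simp add: add_divide_distrib)
qed

text \<open>The gradient of \<open>x_k^p x_m^q h\<close> has three sources; the first carries the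
  factor \<open>\<rho> k k = 1\<close>. The indices may coincide, and wherever an exponent
  \<open>p - 1\<close> or \<open>q - 1\<close> truncates, its prefactor is 0.\<close>

lemma monomial_parts:
  assumes h: "row.polynomial_rv j h h'" and k: "k \<in> I j" and m: "m \<in> I j"
  shows "expectation (\<lambda>\<omega>. x j k \<omega> ^ Suc p * x j m \<omega> ^ q * h \<omega>)
       = real p * expectation (\<lambda>\<omega>. x j k \<omega> ^ (p - 1) * x j m \<omega> ^ q * h \<omega>)
       + real q * \<rho> j k m * expectation (\<lambda>\<omega>. x j k \<omega> ^ p * x j m \<omega> ^ (q - 1) * h \<omega>)
       + (\<Sum>i\<in>I j. \<rho> j k i * expectation (\<lambda>\<omega>. x j k \<omega> ^ p * x j m \<omega> ^ q * h' i \<omega>))"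
proof -
  note hm = row.polynomial_rv_moments[OF h]
  define A where "A = (\<lambda>\<omega>. x j k \<omega> ^ (p - 1) * x j m \<omega> ^ q * h \<omega>)"
  define B where "B = (\<lambda>\<omega>. x j k \<omega> ^ p * x j m \<omega> ^ (q - 1) * h \<omega>)"
  define H where "H = (\<lambda>i \<omega>. x j k \<omega> ^ p * x j m \<omega> ^ q * h' i \<omega>)"
  have int: "integrable M A" "integrable M B" "\<And>i. integrable M (H i)"
    unfolding A_def B_def H_def by (intro finite_moments_integrable fm_intros hm k m)+
  have P: "row.polynomial_rv j (\<lambda>\<omega>. x j k \<omega> ^ p * x j m \<omega> ^ q * h \<omega>)
     (\<lambda>i \<omega>. (if i = k then real p else 0) * A \<omega> + (if i = m then real q else 0) * B \<omega> + H i \<omega>)"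
    by (rule row.polynomial_rv_cong[OF row.polynomial_rv_mult[OF row.polynomial_rv_mult[OF
          row.polynomial_rv_power[OF row.polynomial_rv_var[OF k]] row.polynomial_rv_power[OF row.polynomial_rv_var[OF m]]] h]])
       (auto simp: A_def B_def H_def algebra_simps)
  have delta: "(\<Sum>i\<in>I j. \<rho> j k i * ((if i = l then c else 0) * E)) = c * \<rho> j k l * E" if "l \<in> I j" for l c E
  proof -
    have "(\<Sum>i\<in>I j. \<rho> j k i * ((if i = l then c else 0) * E)) = (\<Sum>i\<in>I j. if i = l then \<rho> j k i * c * E else 0)"
      by (intro sum.cong) auto
    then show ?thesis using that by simp
  qed
  have "expectation (\<lambda>\<omega>. x j k \<omega> ^ Suc p * x j m \<omega> ^ q * h \<omega>) = expectation (\<lambda>\<omega>. x j k \<omega> * (x j k \<omega> ^ p * x j m \<omega> ^ q * h \<omega>))"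
    by (simp add: mult_ac)
  also have "\<dots> = (\<Sum>i\<in>I j. \<rho> j k i * expectation (\<lambda>\<omega>. (if i = k then real p else 0) * A \<omega> + (if i = m then real q else 0) * B \<omega> + H i \<omega>))"
    by (rule row.gaussian_parts[OF P k])
  also have "\<dots> = (\<Sum>i\<in>I j. \<rho> j k i * ((if i = k then real p else 0) * expectation A) + \<rho> j k i * ((if i = m then real q else 0) * expectation B) + \<rho> j k i * expectation (H i))"
    using int by (intro sum.cong refl) (simp add: distrib_left del: mult_eq_0_iff)
  also have "\<dots> = real p * expectation A + real q * \<rho> j k m * expectation B + (\<Sum>i\<in>I j. \<rho> j k i * expectation (H i))"
    unfolding sum.distrib delta[OF k] delta[OF m] by (simp add: \<rho>_diag[OF k])
  finally show ?thesis unfolding A_def B_def H_def .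
qed

text \<open>The first term removes two factors \<open>x_k\<close>; the second removes one factor of
  each variable while a further correlation enters the matrix, hence \<open>Suc r\<close>; in the
  last one the derivative falls on \<open>h\<close>.\<close>

lemma Q_parts:
  assumes h: "row.polynomial_rv j h h'"
  shows "expectation (\<lambda>\<omega>. Q r (Suc p) q j \<omega> * h \<omega>)
       = real p * expectation (\<lambda>\<omega>. Q r (p - 1) q j \<omega> * h \<omega>)
       + real q * expectation (\<lambda>\<omega>. Q (Suc r) p (q - 1) j \<omega> * h \<omega>)
       + expectation (\<lambda>\<omega>. (\<Sum>k\<in>I j. (x j k \<omega> ^ p * R r q j k \<omega> / n j) * (\<Sum>i\<in>I j. \<rho> j k i * h' i \<omega>)))"
proof -
  note hm = row.polynomial_rv_moments[OF h]
  have int: "integrable M (\<lambda>\<omega>. x j k \<omega> ^ p * x j m \<omega> ^ q * h \<omega>)"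
    "integrable M (\<lambda>\<omega>. x j k \<omega> ^ p * x j m \<omega> ^ q * h' i \<omega>)" if "k \<in> I j" "m \<in> I j" for k m p q i
    by (intro finite_moments_integrable fm_intros hm that)+
  have E: "expectation (\<lambda>\<omega>. Q r p q j \<omega> * h \<omega>)
     = (\<Sum>k\<in>I j. \<Sum>m\<in>I j. \<rho> j k m ^ r * expectation (\<lambda>\<omega>. x j k \<omega> ^ p * x j m \<omega> ^ q * h \<omega>)) / n j" for r p q
  proof -
    have "(\<lambda>\<omega>. Q r p q j \<omega> * h \<omega>) = (\<lambda>\<omega>. (\<Sum>k\<in>I j. \<Sum>m\<in>I j. \<rho> j k m ^ r * (x j k \<omega> ^ p * x j m \<omega> ^ q * h \<omega>)) / n j)"
      by (simp add: Q_def sum_distrib_left sum_distrib_right mult_ac)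
    moreover have "expectation (\<lambda>\<omega>. \<Sum>k\<in>I j. \<Sum>m\<in>I j. \<rho> j k m ^ r * (x j k \<omega> ^ p * x j m \<omega> ^ q * h \<omega>))
       = (\<Sum>k\<in>I j. \<Sum>m\<in>I j. \<rho> j k m ^ r * expectation (\<lambda>\<omega>. x j k \<omega> ^ p * x j m \<omega> ^ q * h \<omega>))"
    proof -
      have "expectation (\<lambda>\<omega>. \<Sum>m\<in>I j. \<rho> j k m ^ r * (x j k \<omega> ^ p * x j m \<omega> ^ q * h \<omega>))
       = (\<Sum>m\<in>I j. \<rho> j k m ^ r * expectation (\<lambda>\<omega>. x j k \<omega> ^ p * x j m \<omega> ^ q * h \<omega>))" if "k \<in> I j" for k
        using int(1)[OF that] by (subst Bochner_Integration.integral_sum) (auto simp del: atLeastAtMost_iff)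
      then show ?thesis using int(1)
        by (subst Bochner_Integration.integral_sum) (auto intro!: Bochner_Integration.integrable_sum sum.cong simp del: atLeastAtMost_iff)
    qed
    ultimately show ?thesis by (simp only: integral_divide_zero)
  qed
  have "expectation (\<lambda>\<omega>. (\<Sum>k\<in>I j. (x j k \<omega> ^ p * R r q j k \<omega> / n j) * (\<Sum>i\<in>I j. \<rho> j k i * h' i \<omega>)))
     = expectation (\<lambda>\<omega>. (\<Sum>k\<in>I j. \<Sum>m\<in>I j. \<Sum>i\<in>I j. \<rho> j k m ^ r * (\<rho> j k i * (x j k \<omega> ^ p * x j m \<omega> ^ q * h' i \<omega>))) / n j)"
    by (intro arg_cong[where f = expectation] ext)
       (simp add: R_def sum_distrib_left sum_distrib_right sum_divide_distrib mult_ac)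
  also have "\<dots> = (\<Sum>k\<in>I j. \<Sum>m\<in>I j. \<rho> j k m ^ r * (\<Sum>i\<in>I j. \<rho> j k i * expectation (\<lambda>\<omega>. x j k \<omega> ^ p * x j m \<omega> ^ q * h' i \<omega>))) / n j"
    unfolding integral_divide_zero
    using int(2) by (simp add: sum_distrib_left del: atLeastAtMost_iff atLeastAtMost_iff divide_cancel_right)
  finally have T: "expectation (\<lambda>\<omega>. (\<Sum>k\<in>I j. (x j k \<omega> ^ p * R r q j k \<omega> / n j) * (\<Sum>i\<in>I j. \<rho> j k i * h' i \<omega>))) = \<dots>" .
  have "expectation (\<lambda>\<omega>. Q r (Suc p) q j \<omega> * h \<omega>) = 
     (\<Sum>k\<in>I j. \<Sum>m\<in>I j. real p * (\<rho> j k m ^ r * expectation (\<lambda>\<omega>. x j k \<omega> ^ (p - 1) * x j m \<omega> ^ q * h \<omega>))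
       + real q * (\<rho> j k m ^ Suc r * expectation (\<lambda>\<omega>. x j k \<omega> ^ p * x j m \<omega> ^ (q - 1) * h \<omega>))
       + \<rho> j k m ^ r * (\<Sum>i\<in>I j. \<rho> j k i * expectation (\<lambda>\<omega>. x j k \<omega> ^ p * x j m \<omega> ^ q * h' i \<omega>))) / n j"
    unfolding E by (intro arg_cong[where f = "\<lambda>y. y / _"] sum.cong refl, subst monomial_parts[OF h])
      (auto simp: algebra_simps)
  then show ?thesis unfolding E T
    by (simp add: sum.distrib sum_distrib_left add_divide_distrib)
qed

text \<open>Cauchy-Schwarz in weighted form between the vector \<open>x_k^p R_k / N\<close> and the
  image of the gradient \<open>h'\<close> under the correlation matrix. The operator norm controls
  the second vector by the gradient. In the first, \<open>x_k^p\<close> is estimated in supremum and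
  \<open>R\<close> by the operator norm, against the \<open>N^2\<close> in the denominator.\<close>

lemma remainder_bound:
  assumes "1 \<le> r"
  obtains D where "D \<ge> 0" "\<And>j h h'. row.polynomial_rv j h h' \<Longrightarrow>
     \<bar>expectation (\<lambda>\<omega>. \<Sum>k\<in>I j. (x j k \<omega> ^ p * R r q j k \<omega> / n j) * (\<Sum>i\<in>I j. \<rho> j k i * h' i \<omega>))\<bar>
       \<le> D / sqrt (sqrt (n j)) * (1 + square_gradient j h')"
proof -
  let ?A = "\<lambda>p j \<omega>. (\<Sum>k\<in>I j. x j k \<omega> ^ p) / n j"
  have bm: "bounded_moments M (\<lambda>j \<omega>. K * ((1 + ?A (4 * p) j \<omega>) * ?A (2 * q) j \<omega>))"
    by (intro bounded_moments_intros bounded_moments_avg_power)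
  then obtain D where D: "D \<ge> 0" "\<And>j. \<bar>expectation (\<lambda>\<omega>. K * ((1 + ?A (4 * p) j \<omega>) * ?A (2 * q) j \<omega>))\<bar> \<le> D"
    by (rule bounded_moments_expectation) blast
  show thesis
  proof (rule that[of "D + K"])
    show "D + K \<ge> 0" using D K_nonneg by simp
    fix j h h' assume h: "row.polynomial_rv j h h'"
    note hm = row.polynomial_rv_moments[OF h]
    define t where "t = sqrt (n j)"
    define s where "s = sqrt t"
    have t: "t > 0" "t\<^sup>2 = n j" "t \<ge> 1" and s: "s > 0" "s\<^sup>2 = t" using n_pos[of j] by (auto simp: t_def s_def)
    let ?\<theta> = "\<lambda>k \<omega>. x j k \<omega> ^ p * R r q j k \<omega> / n j"
    let ?g = "\<lambda>k \<omega>. \<Sum>i\<in>I j. \<rho> j k i * h' i \<omega>"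
    have 1: "(\<Sum>k\<in>I j. (?\<theta> k \<omega>)\<^sup>2) \<le> K * ((1 + ?A (4 * p) j \<omega>) * ?A (2 * q) j \<omega>) / t" for \<omega>
    proof -
      \<comment> \<open>A single entry is bounded by the whole sum: with \<open>u = x_k^(2p)\<close>
        and \<open>A\<close> the average of the \<open>x^(4p)\<close> this reads
        \<open>u^2 <= t^2 A\<close>. Then \<open>2 t u <= t^2 + u^2\<close> gives a bound that is
        linear in \<open>A\<close> and free of square roots.\<close>
      have "(x j k \<omega> ^ p)\<^sup>2 \<le> t * (1 + ?A (4 * p) j \<omega>)" if "k \<in> I j" for k
      proof -
        let ?u = "(x j k \<omega> ^ p)\<^sup>2"
        have "?u\<^sup>2 = x j k \<omega> ^ (4 * p)" by (simp add: power_mult[symmetric] mult.commute)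
        also have "\<dots> \<le> (\<Sum>k\<in>I j. x j k \<omega> ^ (4 * p))"
          by (rule member_le_sum[OF that]) (auto intro: zero_le_even_power)
        finally have u: "?u\<^sup>2 \<le> t\<^sup>2 * ?A (4 * p) j \<omega>" using t n_pos[of j] by simp
        have "0 \<le> (t - ?u)\<^sup>2" by simp
        then have "2 * (t * ?u) \<le> t\<^sup>2 + ?u\<^sup>2" by (simp add: power2_diff)
        then have "t * (2 * ?u) \<le> t * (t * (1 + ?A (4 * p) j \<omega>))"
          using u by (simp add: power2_eq_square algebra_simps)
        then have "2 * ?u \<le> t * (1 + ?A (4 * p) j \<omega>)" using t(1) by (simp only: mult_le_cancel_left_pos)
        moreover have "0 \<le> ?u" by simp
        ultimately show ?thesis by linarith
      qed
      then have "(\<Sum>k\<in>I j. (?\<theta> k \<omega>)\<^sup>2) \<le> (\<Sum>k\<in>I j. t * (1 + ?A (4 * p) j \<omega>) * (R r q j k \<omega>)\<^sup>2 / (n j)\<^sup>2)"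
        by (intro sum_mono) (simp add: power_divide power_mult_distrib divide_right_mono mult_right_mono)
      also have "\<dots> = t * (1 + ?A (4 * p) j \<omega>) / (n j)\<^sup>2 * (\<Sum>k\<in>I j. (R r q j k \<omega>)\<^sup>2)"
        by (simp add: sum_distrib_left)
      also have "\<dots> \<le> t * (1 + ?A (4 * p) j \<omega>) / (n j)\<^sup>2 * (K * (\<Sum>k\<in>I j. x j k \<omega> ^ (2 * q)))"
        by (intro mult_left_mono R_square_sum assms divide_nonneg_nonneg mult_nonneg_nonneg add_nonneg_nonneg sum_nonneg)
           (use t in \<open>auto intro: zero_le_even_power\<close>)
      also have "\<dots> = K * ((1 + ?A (4 * p) j \<omega>) * ?A (2 * q) j \<omega>) / t"
      proof -
        have S: "(\<Sum>k\<in>I j. x j k \<omega> ^ (2 * q)) = t\<^sup>2 * ?A (2 * q) j \<omega>" using t n_pos[of j] by simp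
        have nj: "real ((n j)\<^sup>2) = (t\<^sup>2)\<^sup>2" using t by simp
        have "t * a / (t\<^sup>2)\<^sup>2 * (K * (t\<^sup>2 * b)) = K * (a * b) / t" for a b
          using t(1) by (simp add: field_simps power2_eq_square)
        from this[of "1 + ?A (4 * p) j \<omega>" "?A (2 * q) j \<omega>"] show ?thesis
          unfolding nj by (simp only: S[symmetric])
      qed
      finally show ?thesis .
    qed
    have 2: "(\<Sum>k\<in>I j. (?g k \<omega>)\<^sup>2) \<le> K * (\<Sum>i\<in>I j. (h' i \<omega>)\<^sup>2)" for \<omega>
      using operator_\<rho>[of 1 j "\<lambda>i. h' i \<omega>"] by simp
    have fm\<theta>: "finite_moments M (?\<theta> k)" "finite_moments M (?g k)" if "k \<in> I j" for k
      unfolding divide_inverse by (intro fm_intros R_moments hm that)+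
    define W where "W = (\<lambda>\<omega>. s * (K * ((1 + ?A (4 * p) j \<omega>) * ?A (2 * q) j \<omega>) / t) + (K * (\<Sum>i\<in>I j. (h' i \<omega>)\<^sup>2)) / s)"
    have le: "\<bar>\<Sum>k\<in>I j. ?\<theta> k \<omega> * ?g k \<omega>\<bar> \<le> W \<omega>" for \<omega>
    proof -
      have "\<bar>\<Sum>k\<in>I j. ?\<theta> k \<omega> * ?g k \<omega>\<bar> \<le> (\<Sum>k\<in>I j. \<bar>?\<theta> k \<omega> * ?g k \<omega>\<bar>)" by (rule sum_abs)
      also have "\<dots> \<le> (\<Sum>k\<in>I j. s * (?\<theta> k \<omega>)\<^sup>2 + (?g k \<omega>)\<^sup>2 / s)"
      proof (intro sum_mono)
        fix k
        \<comment> \<open>The weight \<open>s = sqrt t\<close> balances the two contributions: the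
          first has size \<open>s / t\<close>, the second \<open>1 / s\<close>, and these
          agree.\<close>
        have "\<bar>a * b\<bar> \<le> s * a\<^sup>2 + b\<^sup>2 / s" for a b :: real
        proof -
          have "\<bar>(s * a) * b\<bar> \<le> (s * a)\<^sup>2 + b\<^sup>2" using power_mult_le_sum[of "s * a" b 1] by simp
          then have "s * \<bar>a * b\<bar> \<le> s * (s * a\<^sup>2 + b\<^sup>2 / s)"
            using s(1) by (simp add: abs_mult power_mult_distrib power2_eq_square distrib_left mult_ac)
          then show ?thesis using s(1) by (simp only: mult_le_cancel_left_pos)
        qed
        then show "\<bar>?\<theta> k \<omega> * ?g k \<omega>\<bar> \<le> s * (?\<theta> k \<omega>)\<^sup>2 + (?g k \<omega>)\<^sup>2 / s" .
      qed
      also have "\<dots> = s * (\<Sum>k\<in>I j. (?\<theta> k \<omega>)\<^sup>2) + (\<Sum>k\<in>I j. (?g k \<omega>)\<^sup>2) / s"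
        by (simp add: sum.distrib sum_distrib_left sum_divide_distrib)
      also have "\<dots> \<le> W \<omega>" unfolding W_def
        by (intro add_mono mult_left_mono divide_right_mono 1 2) (use s in auto)
      finally show ?thesis .
    qed
    have fmW1: "finite_moments M (\<lambda>\<omega>. K * ((1 + ?A (4 * p) j \<omega>) * ?A (2 * q) j \<omega>))"
      using bm by (rule bounded_moments_finite)
    have fmW2: "finite_moments M (\<lambda>\<omega>. \<Sum>i\<in>I j. (h' i \<omega>)\<^sup>2)" by (intro fm_intros hm)
    have fmW: "finite_moments M W" unfolding W_def divide_inverse
      by (intro finite_moments_intros fmW1[unfolded divide_inverse] fmW2)
    have fmT: "finite_moments M (\<lambda>\<omega>. \<Sum>k\<in>I j. ?\<theta> k \<omega> * ?g k \<omega>)" by (intro finite_moments_intros fm\<theta>)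
    have "\<bar>expectation (\<lambda>\<omega>. \<Sum>k\<in>I j. ?\<theta> k \<omega> * ?g k \<omega>)\<bar> \<le> expectation W"
      by (rule order_trans[OF integral_abs_bound integral_mono[OF integrable_abs]])
         (intro finite_moments_integrable fmT fmW le)+
    also have "expectation W = s / t * expectation (\<lambda>\<omega>. K * ((1 + ?A (4 * p) j \<omega>) * ?A (2 * q) j \<omega>))
          + K / s * square_gradient j h'"
    proof -
      have "expectation (\<lambda>\<omega>. s * (X \<omega> / t) + (K * Y \<omega>) / s) = s / t * expectation X + K / s * expectation Y"
        if "integrable M X" "integrable M Y" for X Y :: "'a \<Rightarrow> real"
        using that by simp
      then show ?thesis unfolding W_def times_divide_eq_right[symmetric, of s]
        using finite_moments_integrable[OF fmW1] finite_moments_integrable[OF fmW2] by blast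
    qed
    also have "\<dots> \<le> s / t * D + K / s * square_gradient j h'"
      by (intro add_right_mono mult_left_mono order_trans[OF abs_ge_self D(2)]) (use s(1) t(1) in simp)
    also have "s / t = 1 / s" using s t(1) by (simp add: power2_eq_square[symmetric] field_simps)
    also have "1 / s * D + K / s * square_gradient j h'
        \<le> (D + K) / s * (1 + square_gradient j h')"
    proof -
      have "0 \<le> square_gradient j h'" by (intro Bochner_Integration.integral_nonneg sum_nonneg) auto
      then have "0 \<le> D * square_gradient j h' / s" "0 \<le> K / s"
        using D K_nonneg s by auto
      then show ?thesis by (simp add: distrib_left add_divide_distrib distrib_right)
    qed
    finally show "\<bar>expectation (\<lambda>\<omega>. \<Sum>k\<in>I j. ?\<theta> k \<omega> * ?g k \<omega>)\<bar>
       \<le> (D + K) / sqrt (sqrt (n j)) * (1 + square_gradient j h')"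
      by (simp add: s_def t_def)
  qed
qed

text \<open>
  Integration by parts lowers the total degree of \<open>Q\<close>, at the price of a remainder that is
  small by the operator norm bounds.
\<close>

lemma Q_decorrelation:
  assumes "1 \<le> r"
  shows "\<exists>D\<ge>0. \<forall>j h h'. row.polynomial_rv j h h' \<longrightarrow>
     \<bar>expectation (\<lambda>\<omega>. Q r p q j \<omega> * h \<omega>) - expectation (Q r p q j) * expectation h\<bar>
       \<le> D / sqrt (sqrt (n j)) * (1 + square_gradient j h')"
  using assms
\<comment> \<open>The exponent \<open>r\<close> stays free because one of the two shorter averages
  carries \<open>Suc r\<close>.\<close>
proof (induction "p + q" arbitrary: r p q rule: less_induct)
  case less
  have step: "\<exists>D\<ge>0. \<forall>j h h'. row.polynomial_rv j h h' \<longrightarrow>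
     \<bar>expectation (\<lambda>\<omega>. Q r (Suc a) b j \<omega> * h \<omega>) - expectation (Q r (Suc a) b j) * expectation h\<bar>
       \<le> D / sqrt (sqrt (n j)) * (1 + square_gradient j h')"
    if ab: "Suc a + b = p + q" for a b
  proof -
    obtain D1 where D1: "D1 \<ge> 0" "\<And>j h h'. row.polynomial_rv j h h' \<Longrightarrow>
       \<bar>expectation (\<lambda>\<omega>. Q r (a - 1) b j \<omega> * h \<omega>) - expectation (Q r (a - 1) b j) * expectation h\<bar>
       \<le> D1 / sqrt (sqrt (n j)) * (1 + square_gradient j h')"
    proof -
      have lt: "(a - 1) + b < p + q" using ab by simp
      from less.hyps[OF lt less.prems] show thesis using that by blast
    qed
    obtain D2 where D2: "D2 \<ge> 0" "\<And>j h h'. row.polynomial_rv j h h' \<Longrightarrow>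
       \<bar>expectation (\<lambda>\<omega>. Q (Suc r) a (b - 1) j \<omega> * h \<omega>) - expectation (Q (Suc r) a (b - 1) j) * expectation h\<bar>
       \<le> D2 / sqrt (sqrt (n j)) * (1 + square_gradient j h')"
    proof -
      have lt: "a + (b - 1) < p + q" "1 \<le> Suc r" using ab by simp_all
      from less.hyps[OF lt] show thesis using that by blast
    qed
    obtain D3 where D3: "D3 \<ge> 0" "\<And>j h h'. row.polynomial_rv j h h' \<Longrightarrow>
       \<bar>expectation (\<lambda>\<omega>. \<Sum>k\<in>I j. (x j k \<omega> ^ a * R r b j k \<omega> / n j) * (\<Sum>i\<in>I j. \<rho> j k i * h' i \<omega>))\<bar>
       \<le> D3 / sqrt (sqrt (n j)) * (1 + square_gradient j h')"
      using remainder_bound[OF \<open>1 \<le> r\<close>, of a b] by blast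
    show ?thesis
    proof (intro exI[of _ "real a * D1 + real b * D2 + D3"] conjI allI impI)
      show "0 \<le> real a * D1 + real b * D2 + D3" using D1 D2 D3 by simp
      fix j h h' assume h: "row.polynomial_rv j h h'"
      define E where "E = (1 + square_gradient j h') / sqrt (sqrt (n j))"
      define T where "T = expectation (\<lambda>\<omega>. \<Sum>k\<in>I j. (x j k \<omega> ^ a * R r b j k \<omega> / n j) * (\<Sum>i\<in>I j. \<rho> j k i * h' i \<omega>))"
      define C1 where "C1 = expectation (\<lambda>\<omega>. Q r (a - 1) b j \<omega> * h \<omega>) - expectation (Q r (a - 1) b j) * expectation h"
      define C2 where "C2 = expectation (\<lambda>\<omega>. Q (Suc r) a (b - 1) j \<omega> * h \<omega>) - expectation (Q (Suc r) a (b - 1) j) * expectation h"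
      \<comment> \<open>The same recursion with \<open>h = 1\<close>, whose gradient is zero;
        subtracting it yields a recursion for covariances.\<close>
      have "expectation (Q r (Suc a) b j) = real a * expectation (Q r (a - 1) b j) + real b * expectation (Q (Suc r) a (b - 1) j)"
        using Q_parts[OF row.polynomial_rv.const[of j 1], of r a b] by simp
      then have "expectation (\<lambda>\<omega>. Q r (Suc a) b j \<omega> * h \<omega>) - expectation (Q r (Suc a) b j) * expectation h
          = real a * C1 + real b * C2 + T"
        unfolding C1_def C2_def T_def using Q_parts[OF h, of r a b] by (simp add: algebra_simps)
      moreover have "\<bar>C1\<bar> \<le> D1 * E" "\<bar>C2\<bar> \<le> D2 * E" "\<bar>T\<bar> \<le> D3 * E"
        using D1(2)[OF h] D2(2)[OF h] D3(2)[OF h]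
        by (simp_all only: C1_def C2_def T_def E_def times_divide_eq_left times_divide_eq_right)
      moreover have "\<bar>real a * C1 + real b * C2 + T\<bar> \<le> real a * \<bar>C1\<bar> + real b * \<bar>C2\<bar> + \<bar>T\<bar>"
        using abs_triangle_ineq[of "real a * C1 + real b * C2" T] abs_triangle_ineq[of "real a * C1" "real b * C2"]
        by (simp add: abs_mult)
      moreover have "real a * \<bar>C1\<bar> \<le> real a * (D1 * E)" "real b * \<bar>C2\<bar> \<le> real b * (D2 * E)"
        using calculation by (intro mult_left_mono; simp)+
      ultimately have "\<bar>expectation (\<lambda>\<omega>. Q r (Suc a) b j \<omega> * h \<omega>) - expectation (Q r (Suc a) b j) * expectation h\<bar>
         \<le> real a * (D1 * E) + real b * (D2 * E) + D3 * E" by linarith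
      also have "\<dots> = (real a * D1 + real b * D2 + D3) * E" by (simp add: algebra_simps)
      finally show "\<bar>expectation (\<lambda>\<omega>. Q r (Suc a) b j \<omega> * h \<omega>) - expectation (Q r (Suc a) b j) * expectation h\<bar>
         \<le> (real a * D1 + real b * D2 + D3) / sqrt (sqrt (n j)) * (1 + square_gradient j h')"
        by (simp add: E_def)
    qed
  qed
  show ?case
  proof (cases p)
    case (Suc a)
    then show ?thesis using step[of a q] by simp
  next
    case 0
    show ?thesis
    proof (cases q)
      case (Suc b)
      \<comment> \<open>Integration by parts acts on the first factor, so an empty first factor is
        exchanged with the second. When both are empty, \<open>Q\<close> is deterministic and the
        covariance is 0.\<close>
      have "Q r 0 (Suc b) = Q r (Suc b) 0" by (intro ext) (rule Q_commute)
      then show ?thesis using step[of b 0] 0 Suc by simp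
    next
      case q: 0
      have "Q r 0 0 j = (\<lambda>\<omega>. (\<Sum>k\<in>I j. \<Sum>m\<in>I j. \<rho> j k m ^ r) / n j)" for j by (auto simp: Q_def)
      then have "expectation (\<lambda>\<omega>. Q r p q j \<omega> * h \<omega>) - expectation (Q r p q j) * expectation h = 0" for j h
        using 0 q by (simp add: prob_space)
      then show ?thesis by (intro exI[of _ 0]) simp
    qed
  qed
qed

section \<open>Integration by parts for the two statistics\<close>

definition S :: "nat \<Rightarrow> 'a \<Rightarrow> real" where
  "S j \<omega> = (\<Sum>k\<in>I j. x j k \<omega> ^ 3) / sqrt (n j)"

definition U :: "nat \<Rightarrow> 'a \<Rightarrow> real" where
  "U j \<omega> = (\<Sum>k\<in>I j. x j k \<omega> ^ 4 - 3) / sqrt (n j)"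

lemma S_moments: "finite_moments M (S j)" and U_moments: "finite_moments M (U j)"
  unfolding S_def U_def divide_inverse by (intro fm_intros; simp)+

lemma polynomial_rv_power_sum:
  "row.polynomial_rv j (\<lambda>\<omega>. (\<Sum>k\<in>I j. x j k \<omega> ^ p - c) / sqrt (n j))
     (\<lambda>i \<omega>. if i \<in> I j then real p * x j i \<omega> ^ (p - 1) / sqrt (n j) else 0)"
proof -
  have P: "row.polynomial_rv j (\<lambda>\<omega>. x j k \<omega> ^ p - c) (\<lambda>i \<omega>. if i = k then real p * x j k \<omega> ^ (p - 1) else 0)"
    if "k \<in> I j" for k
    by (rule row.polynomial_rv_cong[OF row.polynomial_rv.add[OF row.polynomial_rv_power[OF row.polynomial_rv_var[OF that]]
          row.polynomial_rv.const[of j "- c"]]]) auto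
  show ?thesis
    by (rule row.polynomial_rv_cong[OF row.polynomial_rv_cmult[OF row.polynomial_rv_sum[OF row.finite_I P], of _ _ "1 / sqrt (n j)"]])
       (auto simp del: atLeastAtMost_iff)
qed

lemma S_polynomial: "row.polynomial_rv j (S j) (\<lambda>i \<omega>. if i \<in> I j then 3 * x j i \<omega> ^ 2 / sqrt (n j) else 0)"
  by (rule row.polynomial_rv_cong[OF polynomial_rv_power_sum[of j 3 0]]) (auto simp: S_def)

lemma U_polynomial: "row.polynomial_rv j (U j) (\<lambda>i \<omega>. if i \<in> I j then 4 * x j i \<omega> ^ 3 / sqrt (n j) else 0)"
  by (rule row.polynomial_rv_cong[OF polynomial_rv_power_sum[of j 4 3]]) (auto simp: U_def)

text \<open>Integration by parts turns \<open>x_k^3\<close> into \<open>2 x_k\<close> and a gradient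
  term. The linear part, integrated once more, carries the sums of the correlations over
  \<open>k\<close> and drops out.\<close>

lemma S_parts:
  assumes h: "row.polynomial_rv j h h'"
  shows "expectation (\<lambda>\<omega>. S j \<omega> * h \<omega>)
       = (\<Sum>k\<in>I j. \<Sum>i\<in>I j. \<rho> j k i * expectation (\<lambda>\<omega>. x j k \<omega> ^ 2 * h' i \<omega>)) / sqrt (n j)"
proof -
  note hm = row.polynomial_rv_moments[OF h]
  have int: "integrable M (\<lambda>\<omega>. x j k \<omega> ^ 3 * h \<omega>)" if "k \<in> I j" for k
    by (intro finite_moments_integrable fm_intros hm that)
  have "expectation (\<lambda>\<omega>. S j \<omega> * h \<omega>) = (\<Sum>k\<in>I j. expectation (\<lambda>\<omega>. x j k \<omega> ^ 3 * h \<omega>)) / sqrt (n j)"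
    unfolding S_def sum_distrib_right times_divide_eq_left integral_divide_zero
    using int by (simp add: sum_distrib_right del: atLeastAtMost_iff)
  also have "(\<Sum>k\<in>I j. expectation (\<lambda>\<omega>. x j k \<omega> ^ 3 * h \<omega>))
     = (\<Sum>k\<in>I j. 2 * (\<Sum>i\<in>I j. \<rho> j k i * expectation (h' i)) + (\<Sum>i\<in>I j. \<rho> j k i * expectation (\<lambda>\<omega>. x j k \<omega> ^ 2 * h' i \<omega>)))"
  proof (intro sum.cong refl)
    fix k assume k: "k \<in> I j"
    show "expectation (\<lambda>\<omega>. x j k \<omega> ^ 3 * h \<omega>) =
       2 * (\<Sum>i\<in>I j. \<rho> j k i * expectation (h' i)) + (\<Sum>i\<in>I j. \<rho> j k i * expectation (\<lambda>\<omega>. x j k \<omega> ^ 2 * h' i \<omega>))"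
      using monomial_parts[OF h k k, of 2 0] row.gaussian_parts[OF h k] by (simp add: numeral_3_eq_3 numeral_2_eq_2)
  qed
  also have "\<dots> = 2 * (\<Sum>k\<in>I j. \<Sum>i\<in>I j. \<rho> j k i * expectation (h' i)) + (\<Sum>k\<in>I j. \<Sum>i\<in>I j. \<rho> j k i * expectation (\<lambda>\<omega>. x j k \<omega> ^ 2 * h' i \<omega>))"
    by (simp add: sum.distrib sum_distrib_left)
  also have "(\<Sum>k\<in>I j. \<Sum>i\<in>I j. \<rho> j k i * expectation (h' i)) = 0"
    by (subst sum.swap, subst sum_distrib_right[symmetric], rule sum.neutral, intro ballI) (simp only: zero_sum_\<rho>' mult_zero_left)
  finally show ?thesis by simp
qed

text \<open>Two integrations by parts reduce \<open>x_k^4\<close> to 3 and gradient terms, and the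
  centering cancels the constant exactly. The weight \<open>x^3 + 3 x\<close> is the derivative of
  \<open>H_4 / 4 + 3 H_2\<close>, which is the inverse of the number operator applied to
  \<open>x^4 - 3 = H_4 + 6 H_2\<close>.\<close>

lemma U_parts:
  assumes h: "row.polynomial_rv j h h'"
  shows "expectation (\<lambda>\<omega>. U j \<omega> * h \<omega>)
       = (\<Sum>k\<in>I j. \<Sum>i\<in>I j. \<rho> j k i * expectation (\<lambda>\<omega>. (x j k \<omega> ^ 3 + 3 * x j k \<omega>) * h' i \<omega>)) / sqrt (n j)"
proof -
  note hm = row.polynomial_rv_moments[OF h]
  have int: "integrable M h" "integrable M (\<lambda>\<omega>. x j k \<omega> ^ p * h \<omega>)" "integrable M (\<lambda>\<omega>. x j k \<omega> ^ p * h' i \<omega>)"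
     if "k \<in> I j" for k p i
    by (intro finite_moments_integrable fm_intros hm that)+
  have int': "integrable M (\<lambda>\<omega>. (x j k \<omega> ^ 4 - 3) * h \<omega>)" if "k \<in> I j" for k
    by (intro finite_moments_integrable fm_intros hm that)
  have "expectation (\<lambda>\<omega>. U j \<omega> * h \<omega>) = (\<Sum>k\<in>I j. expectation (\<lambda>\<omega>. (x j k \<omega> ^ 4 - 3) * h \<omega>)) / sqrt (n j)"
    unfolding U_def sum_distrib_right times_divide_eq_left integral_divide_zero
    using int' by (simp add: sum_distrib_right del: atLeastAtMost_iff)
  also have "(\<Sum>k\<in>I j. expectation (\<lambda>\<omega>. (x j k \<omega> ^ 4 - 3) * h \<omega>))
     = (\<Sum>k\<in>I j. \<Sum>i\<in>I j. \<rho> j k i * expectation (\<lambda>\<omega>. (x j k \<omega> ^ 3 + 3 * x j k \<omega>) * h' i \<omega>))"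
  proof (intro sum.cong refl)
    fix k assume k: "k \<in> I j"
    have "expectation (\<lambda>\<omega>. (x j k \<omega> ^ 4 - 3) * h \<omega>) = expectation (\<lambda>\<omega>. x j k \<omega> ^ 4 * h \<omega>) - 3 * expectation h"
      using int[OF k] by (simp add: left_diff_distrib)
    also have "expectation (\<lambda>\<omega>. x j k \<omega> ^ 4 * h \<omega>) = 3 * expectation (\<lambda>\<omega>. x j k \<omega> ^ 2 * h \<omega>) + (\<Sum>i\<in>I j. \<rho> j k i * expectation (\<lambda>\<omega>. x j k \<omega> ^ 3 * h' i \<omega>))"
      using monomial_parts[OF h k k, of 3 0] by simp
    also have "expectation (\<lambda>\<omega>. x j k \<omega> ^ 2 * h \<omega>) = expectation h + (\<Sum>i\<in>I j. \<rho> j k i * expectation (\<lambda>\<omega>. x j k \<omega> * h' i \<omega>))"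
      using monomial_parts[OF h k k, of 1 0] by (simp add: numeral_2_eq_2)
    finally have "expectation (\<lambda>\<omega>. (x j k \<omega> ^ 4 - 3) * h \<omega>)
       = 3 * (\<Sum>i\<in>I j. \<rho> j k i * expectation (\<lambda>\<omega>. x j k \<omega> * h' i \<omega>)) + (\<Sum>i\<in>I j. \<rho> j k i * expectation (\<lambda>\<omega>. x j k \<omega> ^ 3 * h' i \<omega>))"
      by simp
    also have "\<dots> = (\<Sum>i\<in>I j. \<rho> j k i * (expectation (\<lambda>\<omega>. x j k \<omega> ^ 3 * h' i \<omega>) + 3 * expectation (\<lambda>\<omega>. x j k \<omega> * h' i \<omega>)))"
      by (simp add: sum.distrib sum_distrib_left algebra_simps)
    also have "\<dots> = (\<Sum>i\<in>I j. \<rho> j k i * expectation (\<lambda>\<omega>. (x j k \<omega> ^ 3 + 3 * x j k \<omega>) * h' i \<omega>))"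
      using int(3)[OF k, of 3] int(3)[OF k, of 1] by (simp add: distrib_right mult.assoc)
    finally show "expectation (\<lambda>\<omega>. (x j k \<omega> ^ 4 - 3) * h \<omega>) = \<dots>" .
  qed
  finally show ?thesis .
qed

abbreviation SU :: "nat \<Rightarrow> nat \<Rightarrow> nat \<Rightarrow> 'a \<Rightarrow> real" where
  "SU a b j \<omega> \<equiv> S j \<omega> ^ a * U j \<omega> ^ b"

definition joint_gradient :: "nat \<Rightarrow> nat \<Rightarrow> nat \<Rightarrow> nat \<Rightarrow> 'a \<Rightarrow> real" where
  "joint_gradient a b j i \<omega> = (if i \<in> I j then
     (real a * SU (a - 1) b j \<omega> * (3 * x j i \<omega> ^ 2)
      + real b * SU a (b - 1) j \<omega> * (4 * x j i \<omega> ^ 3)) / sqrt (n j) else 0)"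

lemma joint_polynomial: "row.polynomial_rv j (SU a b j) (joint_gradient a b j)"
  by (rule row.polynomial_rv_cong[OF row.polynomial_rv_mult[OF
        row.polynomial_rv_power[OF S_polynomial] row.polynomial_rv_power[OF U_polynomial]]])
     (auto simp: joint_gradient_def add_divide_distrib mult_ac)

lemma joint_moments: "finite_moments M (SU a b j)"
  by (intro finite_moments_intros S_moments U_moments)

text \<open>The gradients of \<open>S\<close> and \<open>U\<close> are \<open>3 x^2\<close> and
  \<open>4 x^3\<close> over \<open>sqrt N\<close>; this root and the outer one make up the
  normalization of \<open>Q\<close>.\<close>

lemma Q_sum_gradient:
  "(\<Sum>k\<in>I j. \<Sum>i\<in>I j. \<rho> j k i * (x j k \<omega> ^ p * joint_gradient a b j i \<omega>)) / sqrt (n j)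
     = 3 * real a * (Q 1 p 2 j \<omega> * SU (a - 1) b j \<omega>)
     + 4 * real b * (Q 1 p 3 j \<omega> * SU a (b - 1) j \<omega>)"
proof -
  have "(\<Sum>k\<in>I j. \<Sum>i\<in>I j. \<rho> j k i * (x j k \<omega> ^ p * joint_gradient a b j i \<omega>)) / sqrt (n j)
     = (\<Sum>k\<in>I j. \<Sum>i\<in>I j. \<rho> j k i * (x j k \<omega> ^ p * (joint_gradient a b j i \<omega> / sqrt (n j))))"
    by (simp add: sum_divide_distrib)
  also have "\<dots> = (\<Sum>k\<in>I j. \<Sum>i\<in>I j. 
      3 * real a * (\<rho> j k i ^ 1 * x j k \<omega> ^ p * x j i \<omega> ^ 2 / n j * SU (a - 1) b j \<omega>)
     + 4 * real b * (\<rho> j k i ^ 1 * x j k \<omega> ^ p * x j i \<omega> ^ 3 / n j * SU a (b - 1) j \<omega>))"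
  proof (intro sum.cong refl)
    fix k i assume i: "i \<in> I j"
    have "joint_gradient a b j i \<omega> / sqrt (n j) = (real a * SU (a - 1) b j \<omega> * (3 * x j i \<omega> ^ 2)
      + real b * SU a (b - 1) j \<omega> * (4 * x j i \<omega> ^ 3)) / n j"
      using i by (simp add: joint_gradient_def del: atLeastAtMost_iff)
    then show "\<rho> j k i * (x j k \<omega> ^ p * (joint_gradient a b j i \<omega> / sqrt (n j))) =
      3 * real a * (\<rho> j k i ^ 1 * x j k \<omega> ^ p * x j i \<omega> ^ 2 / n j * SU (a - 1) b j \<omega>)
     + 4 * real b * (\<rho> j k i ^ 1 * x j k \<omega> ^ p * x j i \<omega> ^ 3 / n j * SU a (b - 1) j \<omega>)"
      by (simp only:) (simp add: algebra_simps add_divide_distrib)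
  qed
  also have "\<dots> = 3 * real a * (Q 1 p 2 j \<omega> * SU (a - 1) b j \<omega>)
     + 4 * real b * (Q 1 p 3 j \<omega> * SU a (b - 1) j \<omega>)"
    by (simp only: sum.distrib Q_def sum_distrib_left sum_distrib_right sum_divide_distrib)
  finally show ?thesis .
qed

text \<open>The random matrix that governs the recursion for the moments of \<open>(S, U)\<close>.
  It is not symmetric: the first index names the statistic that is integrated by parts, the second
  the one that is differentiated. Both \<open>T_SU\<close> and \<open>T_US\<close> nevertheless have
  expectation 0.\<close>

definition T_SS :: "nat \<Rightarrow> 'a \<Rightarrow> real" where "T_SS j \<omega> = 3 * Q 1 2 2 j \<omega>"
definition T_SU :: "nat \<Rightarrow> 'a \<Rightarrow> real" where "T_SU j \<omega> = 4 * Q 1 2 3 j \<omega>"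
definition T_US :: "nat \<Rightarrow> 'a \<Rightarrow> real" where "T_US j \<omega> = 3 * (Q 1 3 2 j \<omega> + 3 * Q 1 1 2 j \<omega>)"
definition T_UU :: "nat \<Rightarrow> 'a \<Rightarrow> real" where "T_UU j \<omega> = 4 * (Q 1 3 3 j \<omega> + 3 * Q 1 1 3 j \<omega>)"

lemmas T_defs = T_SS_def T_SU_def T_US_def T_UU_def

lemma T_moments:
  "finite_moments M (T_SS j)" "finite_moments M (T_SU j)" "finite_moments M (T_US j)" "finite_moments M (T_UU j)"
  unfolding T_defs by (intro finite_moments_intros Q_moments)+

lemma joint_parts_S:
  "expectation (\<lambda>\<omega>. SU (Suc a) b j \<omega>)
     = real a * expectation (\<lambda>\<omega>. T_SS j \<omega> * SU (a - 1) b j \<omega>)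
     + real b * expectation (\<lambda>\<omega>. T_SU j \<omega> * SU a (b - 1) j \<omega>)"
proof -
  note gm = row.polynomial_rv_moments(2)[OF joint_polynomial]
  have int: "integrable M (\<lambda>\<omega>. x j k \<omega> ^ 2 * joint_gradient a b j i \<omega>)" if "k \<in> I j" for k i
    by (intro finite_moments_integrable fm_intros gm that)
  have int': "integrable M (\<lambda>\<omega>. T_SS j \<omega> * SU (a - 1) b j \<omega>)"
     "integrable M (\<lambda>\<omega>. T_SU j \<omega> * SU a (b - 1) j \<omega>)"
    by (intro finite_moments_integrable finite_moments_intros T_moments S_moments U_moments)+
  have "expectation (\<lambda>\<omega>. SU (Suc a) b j \<omega>) = expectation (\<lambda>\<omega>. S j \<omega> * SU a b j \<omega>)"
    by (simp add: mult_ac)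
  also have "\<dots> = (\<Sum>k\<in>I j. \<Sum>i\<in>I j. \<rho> j k i * expectation (\<lambda>\<omega>. x j k \<omega> ^ 2 * joint_gradient a b j i \<omega>)) / sqrt (n j)"
    by (rule S_parts[OF joint_polynomial])
  also have "\<dots> = expectation (\<lambda>\<omega>. (\<Sum>k\<in>I j. \<Sum>i\<in>I j. \<rho> j k i * (x j k \<omega> ^ 2 * joint_gradient a b j i \<omega>)) / sqrt (n j))"
    unfolding integral_divide_zero using int by (simp del: atLeastAtMost_iff divide_cancel_right)
  also have "\<dots> = expectation (\<lambda>\<omega>. real a * (T_SS j \<omega> * SU (a - 1) b j \<omega>)
     + real b * (T_SU j \<omega> * SU a (b - 1) j \<omega>))"
    unfolding Q_sum_gradient by (simp add: T_defs mult_ac)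
  also have "\<dots> = real a * expectation (\<lambda>\<omega>. T_SS j \<omega> * SU (a - 1) b j \<omega>)
     + real b * expectation (\<lambda>\<omega>. T_SU j \<omega> * SU a (b - 1) j \<omega>)"
    using int' by simp
  finally show ?thesis .
qed

lemma joint_parts_U:
  "expectation (\<lambda>\<omega>. S j \<omega> ^ a * U j \<omega> ^ Suc b)
     = real a * expectation (\<lambda>\<omega>. T_US j \<omega> * SU (a - 1) b j \<omega>)
     + real b * expectation (\<lambda>\<omega>. T_UU j \<omega> * SU a (b - 1) j \<omega>)"
proof -
  note gm = row.polynomial_rv_moments(2)[OF joint_polynomial]
  have int: "integrable M (\<lambda>\<omega>. (x j k \<omega> ^ 3 + 3 * x j k \<omega>) * joint_gradient a b j i \<omega>)" if "k \<in> I j" for k i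
    by (intro finite_moments_integrable fm_intros gm that)
  have int': "integrable M (\<lambda>\<omega>. T_US j \<omega> * SU (a - 1) b j \<omega>)"
     "integrable M (\<lambda>\<omega>. T_UU j \<omega> * SU a (b - 1) j \<omega>)"
    by (intro finite_moments_integrable finite_moments_intros T_moments S_moments U_moments)+
  have "expectation (\<lambda>\<omega>. S j \<omega> ^ a * U j \<omega> ^ Suc b) = expectation (\<lambda>\<omega>. U j \<omega> * SU a b j \<omega>)"
    by (simp add: mult_ac)
  also have "\<dots> = (\<Sum>k\<in>I j. \<Sum>i\<in>I j. \<rho> j k i * expectation (\<lambda>\<omega>. (x j k \<omega> ^ 3 + 3 * x j k \<omega>) * joint_gradient a b j i \<omega>)) / sqrt (n j)"
    by (rule U_parts[OF joint_polynomial])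
  also have "\<dots> = expectation (\<lambda>\<omega>. (\<Sum>k\<in>I j. \<Sum>i\<in>I j. \<rho> j k i * ((x j k \<omega> ^ 3 + 3 * x j k \<omega>) * joint_gradient a b j i \<omega>)) / sqrt (n j))"
    unfolding integral_divide_zero using int by (simp del: atLeastAtMost_iff divide_cancel_right)
  also have "\<dots> = expectation (\<lambda>\<omega>. (\<Sum>k\<in>I j. \<Sum>i\<in>I j. \<rho> j k i * (x j k \<omega> ^ 3 * joint_gradient a b j i \<omega>)) / sqrt (n j)
        + 3 * ((\<Sum>k\<in>I j. \<Sum>i\<in>I j. \<rho> j k i * (x j k \<omega> ^ 1 * joint_gradient a b j i \<omega>)) / sqrt (n j)))"
    by (intro arg_cong[where f = expectation] ext)
       (simp add: sum_distrib_left sum.distrib distrib_left distrib_right add_divide_distrib mult_ac sum_divide_distrib)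
  also have "\<dots> = expectation (\<lambda>\<omega>. real a * (T_US j \<omega> * SU (a - 1) b j \<omega>)
     + real b * (T_UU j \<omega> * SU a (b - 1) j \<omega>))"
    unfolding Q_sum_gradient by (intro arg_cong[where f = expectation] ext) (simp add: T_defs algebra_simps)
  also have "\<dots> = real a * expectation (\<lambda>\<omega>. T_US j \<omega> * SU (a - 1) b j \<omega>)
     + real b * expectation (\<lambda>\<omega>. T_UU j \<omega> * SU a (b - 1) j \<omega>)"
    using int' by simp
  finally show ?thesis .
qed

text \<open>Young's inequality bounds \<open>(2q+1) E[T Y^(2q)]\<close> by half of
  \<open>E[Y^(2q+2)]\<close> plus a moment of \<open>T\<close>. The half is absorbed, which is
  legitimate because the moment is finite; each even order is thus bounded directly, with no
  induction on the order.\<close>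

lemma bounded_moments_recursion:
  assumes Y: "\<And>j. finite_moments M (Y j)" and T: "bounded_moments M T"
    and rec: "\<And>j q. expectation (\<lambda>\<omega>. Y j \<omega> ^ Suc (Suc (2 * q))) = real (Suc (2 * q)) * expectation (\<lambda>\<omega>. T j \<omega> * Y j \<omega> ^ (2 * q))"
  shows "bounded_moments M Y"
proof (rule bounded_moments_even[OF Y])
  fix p
  show "\<exists>B. \<forall>j. expectation (\<lambda>\<omega>. Y j \<omega> ^ (2 * p)) \<le> B"
  proof (cases p)
    case 0
    then show ?thesis by auto
  next
    case (Suc q)
    have bm: "bounded_moments M (\<lambda>j \<omega>. real (Suc (2 * q)) * T j \<omega>)" by (intro bounded_moments_intros T)
    obtain B where B: "\<And>j. expectation (\<lambda>\<omega>. \<bar>real (Suc (2 * q)) * T j \<omega>\<bar> ^ Suc q) \<le> B"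
      using bounded_momentsE[OF bm, of "Suc q"] by blast
    have "expectation (\<lambda>\<omega>. Y j \<omega> ^ (2 * p)) \<le> 2 * 2 ^ q * B" for j
    proof -
      let ?T = "\<lambda>\<omega>. real (Suc (2 * q)) * T j \<omega>"
      note fm = Y[of j] bounded_moments_finite[OF bm, of j]
      have int: "integrable M (\<lambda>\<omega>. ?T \<omega> * Y j \<omega> ^ (2 * q))" "integrable M (\<lambda>\<omega>. Y j \<omega> ^ (2 * p))"
        by (intro finite_moments_integrable finite_moments_mult finite_moments_power fm)+
      have int3: "integrable M (\<lambda>\<omega>. \<bar>?T \<omega>\<bar> ^ Suc q)"
        using fm(2) unfolding finite_moments_def by blast
      \<comment> \<open>If \<open>|t| <= y^2 / 2\<close>, the first term on the right suffices;
        otherwise \<open>y^2 < 2 |t|\<close> and the second one does.\<close>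
      have young: "t * y ^ (2 * q) \<le> y ^ (2 * p) / 2 + 2 ^ q * \<bar>t\<bar> ^ Suc q" for t y :: real
      proof -
        have "t * y ^ (2 * q) \<le> \<bar>t\<bar> * y ^ (2 * q)" by (intro mult_right_mono zero_le_even_power) auto
        also have "\<dots> \<le> y ^ (2 * p) / 2 + 2 ^ q * \<bar>t\<bar> ^ Suc q"
        proof (cases "\<bar>t\<bar> \<le> y\<^sup>2 / 2")
          case True
          then have "\<bar>t\<bar> * y ^ (2 * q) \<le> y\<^sup>2 / 2 * y ^ (2 * q)" by (intro mult_right_mono zero_le_even_power) auto
          also have "\<dots> = y ^ (2 * p) / 2" by (simp add: Suc power_mult power2_eq_square)
          finally show ?thesis by (simp add: add_increasing2)
        next
          case False
          then have "(y\<^sup>2) ^ q \<le> (2 * \<bar>t\<bar>) ^ q" by (intro power_mono) auto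
          then have "\<bar>t\<bar> * (y\<^sup>2) ^ q \<le> \<bar>t\<bar> * (2 * \<bar>t\<bar>) ^ q" by (intro mult_left_mono) auto
          also have "\<dots> = 2 ^ q * \<bar>t\<bar> ^ Suc q" by (simp add: power_mult_distrib)
          finally have "\<bar>t\<bar> * y ^ (2 * q) \<le> 2 ^ q * \<bar>t\<bar> ^ Suc q" by (simp add: power_mult)
          moreover have "0 \<le> y ^ (2 * p)" by (rule zero_le_even_power) simp
          ultimately show ?thesis by linarith
        qed
        finally show ?thesis .
      qed
      have "expectation (\<lambda>\<omega>. Y j \<omega> ^ (2 * p)) = expectation (\<lambda>\<omega>. ?T \<omega> * Y j \<omega> ^ (2 * q))"
        using rec[of j q] by (simp add: Suc mult.assoc del: of_nat_Suc power_Suc)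
      also have "\<dots> \<le> expectation (\<lambda>\<omega>. Y j \<omega> ^ (2 * p) / 2 + 2 ^ q * \<bar>?T \<omega>\<bar> ^ Suc q)"
        by (intro integral_mono Bochner_Integration.integrable_add integrable_mult_right integrable_divide int int3 young)
      also have "\<dots> = expectation (\<lambda>\<omega>. Y j \<omega> ^ (2 * p)) / 2 + 2 ^ q * expectation (\<lambda>\<omega>. \<bar>?T \<omega>\<bar> ^ Suc q)"
        using int(2) int3 by (subst Bochner_Integration.integral_add) (auto simp del: power_Suc of_nat_Suc)
      also have "2 ^ q * expectation (\<lambda>\<omega>. \<bar>?T \<omega>\<bar> ^ Suc q) \<le> 2 ^ q * B"
        using B[of j] by (intro mult_left_mono) auto
      finally show ?thesis by simp
    qed
    then show ?thesis by blast
  qed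
qed

lemma S_bounded_moments: "bounded_moments M S"
proof (rule bounded_moments_recursion[OF S_moments])
  show "bounded_moments M T_SS" unfolding T_SS_def
    by (intro bounded_moments_intros Q_bounded_moments) simp
  show "expectation (\<lambda>\<omega>. S j \<omega> ^ Suc (Suc (2 * q))) = real (Suc (2 * q)) * expectation (\<lambda>\<omega>. T_SS j \<omega> * S j \<omega> ^ (2 * q))" for j q
    using joint_parts_S[of j "Suc (2 * q)" 0] by simp
qed

lemma U_bounded_moments: "bounded_moments M U"
proof (rule bounded_moments_recursion[OF U_moments])
  show "bounded_moments M T_UU" unfolding T_UU_def
    by (intro bounded_moments_intros Q_bounded_moments) simp_all
  show "expectation (\<lambda>\<omega>. U j \<omega> ^ Suc (Suc (2 * q))) = real (Suc (2 * q)) * expectation (\<lambda>\<omega>. T_UU j \<omega> * U j \<omega> ^ (2 * q))" for j q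
    using joint_parts_U[of j 0 "Suc (2 * q)"] by simp
qed

text \<open>The root in the gradient turns its squared length into averages of \<open>x^4\<close>
  and \<open>x^6\<close>, multiplied by powers of \<open>S\<close> and \<open>U\<close>. All of
  these have bounded moments, so the error in the decorrelation tends to 0 for
  \<open>h = S^a U^b\<close>.\<close>

lemma gradient_square_bounded:
  obtains B where "B \<ge> 0" "\<And>j. square_gradient j (joint_gradient a b j) \<le> B"
proof -
  let ?A = "\<lambda>p j \<omega>. (\<Sum>k\<in>I j. x j k \<omega> ^ p) / n j"
  let ?f = "\<lambda>j \<omega>. real a * SU (a - 1) b j \<omega>"
  let ?g = "\<lambda>j \<omega>. real b * SU a (b - 1) j \<omega>"
  let ?W = "\<lambda>j \<omega>. 18 * ((?f j \<omega>)\<^sup>2 * ?A 4 j \<omega>) + 32 * ((?g j \<omega>)\<^sup>2 * ?A 6 j \<omega>)"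
  have bm: "bounded_moments M ?W"
    by (intro bounded_moments_intros bounded_moments_avg_power S_bounded_moments U_bounded_moments)
  then obtain B where B: "B \<ge> 0" "\<And>j. \<bar>expectation (?W j)\<bar> \<le> B" by (rule bounded_moments_expectation) blast
  have "square_gradient j (joint_gradient a b j) \<le> B" for j
  proof -
    have le: "(\<Sum>i\<in>I j. (joint_gradient a b j i \<omega>)\<^sup>2) \<le> ?W j \<omega>" for \<omega>
    proof -
      \<comment> \<open>By \<open>(u + v)^2 <= 2 u^2 + 2 v^2\<close> with the derivatives
        \<open>3 x^2\<close> and \<open>4 x^3\<close>: \<open>18 = 2 * 3^2\<close> and
        \<open>32 = 2 * 4^2\<close>.\<close>
      have "(\<Sum>i\<in>I j. (joint_gradient a b j i \<omega>)\<^sup>2) \<le> (\<Sum>i\<in>I j. 18 * ((?f j \<omega>)\<^sup>2 * (x j i \<omega> ^ 4 / n j)) + 32 * ((?g j \<omega>)\<^sup>2 * (x j i \<omega> ^ 6 / n j)))"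
      proof (intro sum_mono)
        fix i assume i: "i \<in> I j"
        define u v where "u = ?f j \<omega> * (3 * x j i \<omega> ^ 2)" and "v = ?g j \<omega> * (4 * x j i \<omega> ^ 3)"
        have "(joint_gradient a b j i \<omega>)\<^sup>2 = (u + v)\<^sup>2 / n j"
          using i by (simp add: joint_gradient_def u_def v_def power_divide del: atLeastAtMost_iff)
        also have "\<dots> \<le> (2 * u\<^sup>2 + 2 * v\<^sup>2) / n j"
        proof (intro divide_right_mono)
          have "0 \<le> (u - v)\<^sup>2" by simp
          then show "(u + v)\<^sup>2 \<le> 2 * u\<^sup>2 + 2 * v\<^sup>2" by (simp add: power2_sum power2_diff)
        qed simp
        finally have "(joint_gradient a b j i \<omega>)\<^sup>2 \<le> (2 * u\<^sup>2 + 2 * v\<^sup>2) / n j" .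
        moreover have "u\<^sup>2 = 9 * ((?f j \<omega>)\<^sup>2 * x j i \<omega> ^ 4)" "v\<^sup>2 = 16 * ((?g j \<omega>)\<^sup>2 * x j i \<omega> ^ 6)"
          unfolding u_def v_def by (simp_all add: power_mult_distrib power_mult[symmetric])
        ultimately show "(joint_gradient a b j i \<omega>)\<^sup>2 \<le> 18 * ((?f j \<omega>)\<^sup>2 * (x j i \<omega> ^ 4 / n j)) + 32 * ((?g j \<omega>)\<^sup>2 * (x j i \<omega> ^ 6 / n j))"
          by (simp add: add_divide_distrib)
      qed
      also have "\<dots> = ?W j \<omega>"
        by (simp only: sum.distrib sum_distrib_left[symmetric] sum_divide_distrib[symmetric])
      finally show ?thesis .
    qed
    have "square_gradient j (joint_gradient a b j) \<le> expectation (?W j)"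
      by (intro integral_mono finite_moments_integrable finite_moments_intros
            row.polynomial_rv_moments(2)[OF joint_polynomial] bounded_moments_finite[OF bm] le)
    also have "\<dots> \<le> B" using B(2)[of j] by linarith
    finally show ?thesis .
  qed
  with B(1) show thesis by (rule that)
qed

lemma joint_decorrelation:
  assumes r: "1 \<le> r" and lim: "filterlim n at_top sequentially"
  shows "(\<lambda>j. expectation (\<lambda>\<omega>. Q r p q j \<omega> * SU a b j \<omega>)
     - expectation (Q r p q j) * expectation (SU a b j)) \<longlonglongrightarrow> 0"
proof -
  obtain D where D: "D \<ge> 0" "\<And>j h h'. row.polynomial_rv j h h' \<Longrightarrow>
     \<bar>expectation (\<lambda>\<omega>. Q r p q j \<omega> * h \<omega>) - expectation (Q r p q j) * expectation h\<bar>
       \<le> D / sqrt (sqrt (n j)) * (1 + square_gradient j h')"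
    using Q_decorrelation[OF r] by blast
  obtain B where B: "B \<ge> 0" "\<And>j. square_gradient j (joint_gradient a b j) \<le> B"
    using gradient_square_bounded by blast
  have "filterlim (\<lambda>j. sqrt (sqrt (real (n j)))) at_top sequentially"
    by (intro filterlim_compose[OF sqrt_at_top] filterlim_compose[OF filterlim_real_sequentially lim])
  then have "(\<lambda>j. D * (1 + B) / sqrt (sqrt (n j))) \<longlonglongrightarrow> 0"
    by (rule tendsto_divide_0[OF tendsto_const filterlim_at_top_imp_at_infinity])
  then show ?thesis
  proof (rule Lim_null_comparison[rotated], intro always_eventually allI)
    fix j
    have "\<bar>expectation (\<lambda>\<omega>. Q r p q j \<omega> * SU a b j \<omega>)
     - expectation (Q r p q j) * expectation (SU a b j)\<bar>
      \<le> D / sqrt (sqrt (n j)) * (1 + square_gradient j (joint_gradient a b j))"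
      by (rule D(2)[OF joint_polynomial])
    also have "\<dots> \<le> D / sqrt (sqrt (n j)) * (1 + B)"
      using B(2)[of j] D(1) by (intro mult_left_mono add_left_mono) auto
    finally show "norm (expectation (\<lambda>\<omega>. Q r p q j \<omega> * SU a b j \<omega>)
     - expectation (Q r p q j) * expectation (SU a b j)) \<le> D * (1 + B) / sqrt (sqrt (n j))"
      by simp
  qed
qed

section \<open>Variances of the statistics and the limit of their joint moments\<close>

definition corr_power_sum :: "nat \<Rightarrow> nat \<Rightarrow> real" where
  "corr_power_sum r j = (\<Sum>k\<in>I j. \<Sum>m\<in>I j. \<rho> j k m ^ r) / n j"

lemma expectation_Q:
  "expectation (Q r (Suc p) q j) = real p * expectation (Q r (p - 1) q j) + real q * expectation (Q (Suc r) p (q - 1) j)"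
  using Q_parts[OF row.polynomial_rv.const[of j 1], of r p q] by simp

lemma expectation_Q_00: "expectation (Q r 0 0 j) = corr_power_sum r j"
proof -
  have "Q r 0 0 j = (\<lambda>\<omega>. corr_power_sum r j)" by (auto simp: Q_def corr_power_sum_def)
  then show ?thesis by (simp add: prob_space)
qed

lemma corr_power_sum_1: "corr_power_sum 1 j = 0"
proof -
  have "(\<Sum>k\<in>I j. \<Sum>m\<in>I j. \<rho> j k m) = 0" by (intro sum.neutral ballI zero_sum_\<rho>)
  then show ?thesis by (simp add: corr_power_sum_def)
qed

text \<open>Wick pairings: \<open>E[x_k^2 x_m^2] = 1 + 2 \<rho>^2\<close>,
  \<open>E[x_k^3 x_m^3] = 9 \<rho> + 6 \<rho>^3\<close>, \<open>E[x_k x_m^3] = 3 \<rho>\<close>, and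
  odd degrees vanish. The matrix contributes one more \<open>\<rho>\<close>; in the first case the
  constant 1 thus becomes \<open>corr_power_sum 1\<close>, which is 0.\<close>

lemma expectation_Q_values:
  shows Q122: "expectation (Q 1 2 2 j) = 2 * corr_power_sum 3 j"
    and Q133: "expectation (Q 1 3 3 j) = 9 * corr_power_sum 2 j + 6 * corr_power_sum 4 j"
    and Q113: "expectation (Q 1 1 3 j) = 3 * corr_power_sum 2 j"
    and Q123: "expectation (Q 1 2 3 j) = 0" and Q132: "expectation (Q 1 3 2 j) = 0"
    and Q112: "expectation (Q 1 1 2 j) = 0"
proof -
  have comm: "Q r p q = Q r q p" for r p q by (intro ext) (rule Q_commute)
  note R = expectation_Q expectation_Q_00
  have c1: "corr_power_sum (Suc 0) j = 0" using corr_power_sum_1 by simp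
  have z: "expectation (Q r 0 (Suc 0) j) = 0" for r
    unfolding comm[of r 0] by (simp add: R)
  have z': "expectation (Q r (Suc 0) 0 j) = 0" for r by (simp add: R)
  have e20: "expectation (Q r 0 (Suc (Suc 0)) j) = corr_power_sum r j" for r
    unfolding comm[of r 0] by (simp add: R)
  have e30: "expectation (Q r 0 (Suc (Suc (Suc 0))) j) = 0" for r
    unfolding comm[of r 0] by (simp add: R)
  show "expectation (Q 1 2 2 j) = 2 * corr_power_sum 3 j"
    by (simp add: numeral_2_eq_2 numeral_3_eq_3 R e20 c1)
  show q113: "expectation (Q 1 1 3 j) = 3 * corr_power_sum 2 j"
    by (simp add: numeral_2_eq_2 numeral_3_eq_3 R e20)
  show "expectation (Q 1 3 3 j) = 9 * corr_power_sum 2 j + 6 * corr_power_sum 4 j"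
    by (simp add: eval_nat_numeral R e20)
  show q123: "expectation (Q 1 2 3 j) = 0"
    by (simp add: numeral_2_eq_2 numeral_3_eq_3 R e30 z z')
  show "expectation (Q 1 3 2 j) = 0" using q123 unfolding comm[of 1 3] .
  show "expectation (Q 1 1 2 j) = 0"
    by (simp add: numeral_2_eq_2 R z)
qed

text \<open>\<open>skewness_var\<close> and \<open>kurtosis_var\<close> are the expectations of
  \<open>T_SS\<close> and \<open>T_UU\<close>, hence the exact variances of \<open>S\<close> and
  \<open>U\<close>. With \<open>c_r\<close> for the power sums, the second arises as
  \<open>4 (9 c_2 + 6 c_4 + 9 c_2)\<close>.\<close>

definition skewness_var :: "nat \<Rightarrow> real" where "skewness_var j = 6 * corr_power_sum 3 j"
definition kurtosis_var :: "nat \<Rightarrow> real" where "kurtosis_var j = 72 * corr_power_sum 2 j + 24 * corr_power_sum 4 j"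

lemma kurtosis_var_ge: "kurtosis_var j \<ge> 72"
proof -
  have "real (n j) = (\<Sum>k\<in>I j. (\<rho> j k k)\<^sup>2)" by (simp add: \<rho>_diag del: atLeastAtMost_iff)
  also have "\<dots> \<le> (\<Sum>k\<in>I j. \<Sum>m\<in>I j. (\<rho> j k m)\<^sup>2)"
    by (intro sum_mono member_le_sum) auto
  finally have "corr_power_sum 2 j \<ge> 1" using n_pos[of j] by (simp add: corr_power_sum_def)
  moreover have "corr_power_sum 4 j \<ge> 0"
    unfolding corr_power_sum_def by (intro divide_nonneg_nonneg sum_nonneg) auto
  ultimately show ?thesis by (simp add: kurtosis_var_def)
qed

lemma T_decorrelation:
  assumes lim: "filterlim n at_top sequentially"
  shows "(\<lambda>j. expectation (\<lambda>\<omega>. T_SS j \<omega> * SU a b j \<omega>) - skewness_var j * expectation (SU a b j)) \<longlonglongrightarrow> 0"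
    and "(\<lambda>j. expectation (\<lambda>\<omega>. T_SU j \<omega> * SU a b j \<omega>)) \<longlonglongrightarrow> 0"
    and "(\<lambda>j. expectation (\<lambda>\<omega>. T_US j \<omega> * SU a b j \<omega>)) \<longlonglongrightarrow> 0"
    and "(\<lambda>j. expectation (\<lambda>\<omega>. T_UU j \<omega> * SU a b j \<omega>) - kurtosis_var j * expectation (SU a b j)) \<longlonglongrightarrow> 0"
proof -
  note L = joint_decorrelation[OF _ lim, of 1 _ _ a b]
  have int: "integrable M (\<lambda>\<omega>. Q r p q j \<omega> * SU a b j \<omega>)" for r p q j
    by (intro finite_moments_integrable finite_moments_mult Q_moments joint_moments)
  have E3: "expectation (\<lambda>\<omega>. (c * Q 1 p q j \<omega>) * SU a b j \<omega>) = c * expectation (\<lambda>\<omega>. Q 1 p q j \<omega> * SU a b j \<omega>)" for c p q j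
    by (simp add: mult.assoc)
  have E4: "expectation (\<lambda>\<omega>. (c * (Q 1 p q j \<omega> + 3 * Q 1 p' q' j \<omega>)) * SU a b j \<omega>)
      = c * (expectation (\<lambda>\<omega>. Q 1 p q j \<omega> * SU a b j \<omega>) + 3 * expectation (\<lambda>\<omega>. Q 1 p' q' j \<omega> * SU a b j \<omega>))" for c p q p' q' j
    using int[of 1 p q j] int[of 1 p' q' j] by (simp add: distrib_right mult.assoc)
  show "(\<lambda>j. expectation (\<lambda>\<omega>. T_SS j \<omega> * SU a b j \<omega>) - skewness_var j * expectation (SU a b j)) \<longlonglongrightarrow> 0"
    using tendsto_mult_left[OF L[of 2 2], of 3] unfolding T_defs E3 Q122 skewness_var_def
    by (simp add: right_diff_distrib mult.assoc)
  show "(\<lambda>j. expectation (\<lambda>\<omega>. T_SU j \<omega> * SU a b j \<omega>)) \<longlonglongrightarrow> 0"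
    using tendsto_mult_left[OF L[of 2 3], of 4] unfolding T_defs E3 Q123 by simp
  show "(\<lambda>j. expectation (\<lambda>\<omega>. T_US j \<omega> * SU a b j \<omega>)) \<longlonglongrightarrow> 0"
    using tendsto_mult_left[OF tendsto_add[OF L[of 3 2] tendsto_mult_left[OF L[of 1 2], of 3]], of 3]
    unfolding T_defs E4 Q132 Q112 by simp
  show "(\<lambda>j. expectation (\<lambda>\<omega>. T_UU j \<omega> * SU a b j \<omega>) - kurtosis_var j * expectation (SU a b j)) \<longlonglongrightarrow> 0"
    using tendsto_mult_left[OF tendsto_add[OF L[of 3 3] tendsto_mult_left[OF L[of 1 3], of 3]], of 4]
    unfolding T_defs E4 Q133 Q113 kurtosis_var_def by (simp add: algebra_simps)
qed

text \<open>Strong induction on \<open>a + b\<close>: a factor \<open>S\<close> is integrated by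
  parts if there is one, otherwise a factor \<open>U\<close>. Odd powers of correlations can cancel,
  so the lower bound on \<open>skewness_var\<close> is a hypothesis, whereas
  \<open>kurtosis_var\<close> has one of its own.\<close>

theorem joint_moment_limit:
  assumes lim: "filterlim n at_top sequentially" and c: "c > 0" "\<And>j. c \<le> skewness_var j"
  shows "(\<lambda>j. expectation (\<lambda>\<omega>. (S j \<omega> / sqrt (skewness_var j)) ^ a * (U j \<omega> / sqrt (kurtosis_var j)) ^ b))
           \<longlonglongrightarrow> gauss_moment a * gauss_moment b"
proof -
  define s u where "s j = sqrt (skewness_var j)" and "u j = sqrt (kurtosis_var j)" for j
  have pos: "skewness_var j > 0" "kurtosis_var j > 0" for j
    using less_le_trans[OF c(1) c(2)] kurtosis_var_ge[of j] by auto
  then have s: "s j > 0" "u j > 0" and sq: "skewness_var j = (s j)\<^sup>2" "kurtosis_var j = (u j)\<^sup>2" for j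
    unfolding s_def u_def using less_imp_le[OF pos(1)] less_imp_le[OF pos(2)] by auto
  define m where "m a b j = expectation (SU a b j) / (s j ^ a * u j ^ b)" for a b j
  have m_eq: "expectation (\<lambda>\<omega>. (S j \<omega> / s j) ^ a * (U j \<omega> / u j) ^ b) = m a b j" for a b j
    by (simp add: m_def power_divide)
  \<comment> \<open>An error tending to 0 still does so after division, since both standard
    deviations are bounded below: by \<open>sqrt c\<close> and by 1.\<close>
  have normalize: "(\<lambda>j. e j / (s j ^ a * u j ^ b)) \<longlonglongrightarrow> 0" if "e \<longlonglongrightarrow> 0" for e a b
  proof (rule tendsto_0_le[OF that, of _ "1 / (sqrt c ^ a)"], intro always_eventually allI)
    fix j
    have "1 \<le> u j" using kurtosis_var_ge[of j] by (simp add: u_def)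
    then have "sqrt c ^ a * 1 \<le> s j ^ a * u j ^ b"
      using c by (intro mult_mono power_mono one_le_power) (auto simp: s_def intro!: zero_le_power order_trans[OF less_imp_le c(2)])
    moreover have "0 < sqrt c ^ a" using c by simp
    ultimately have "\<bar>e j\<bar> / (s j ^ a * u j ^ b) \<le> \<bar>e j\<bar> / sqrt c ^ a"
      by (intro divide_left_mono) (use s[of j] in auto)
    then show "norm (e j / (s j ^ a * u j ^ b)) \<le> norm (e j) * (1 / (sqrt c ^ a))"
      using s[of j] by (simp add: abs_mult)
  qed
  note D = T_decorrelation[OF lim]
  have "m a b \<longlonglongrightarrow> gauss_moment a * gauss_moment b" for a b
  proof (induction "a + b" arbitrary: a b rule: less_induct)
    case less
    show ?case
    proof (cases a)
      case (Suc a')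
      define e where "e j = real a' * (expectation (\<lambda>\<omega>. T_SS j \<omega> * SU (a' - 1) b j \<omega>)
           - skewness_var j * expectation (\<lambda>\<omega>. SU (a' - 1) b j \<omega>))
         + real b * expectation (\<lambda>\<omega>. T_SU j \<omega> * SU a' (b - 1) j \<omega>)" for j
      have "e \<longlonglongrightarrow> 0" unfolding e_def
        using tendsto_add[OF tendsto_mult_left[OF D(1), of "real a'" "a' - 1" b] tendsto_mult_left[OF D(2), of "real b" a' "b - 1"]] by simp
      note E0 = normalize[OF this, of a b]
      have m: "m a b j = real a' * m (a' - 1) b j + e j / (s j ^ a * u j ^ b)" for j
      proof -
        have "m a b j = (real a' * skewness_var j * expectation (\<lambda>\<omega>. SU (a' - 1) b j \<omega>) + e j) / (s j ^ a * u j ^ b)"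
          unfolding m_def Suc joint_parts_S e_def by (simp add: algebra_simps)
        \<comment> \<open>Since \<open>a = a' + 1\<close>, the factor \<open>(s j)^2\<close> lowers
          the exponent in the normalization from \<open>a\<close> to \<open>a' - 1\<close>. If
          \<open>a' = 0\<close>, the prefactor makes both sides 0.\<close>
        also have "real a' * skewness_var j * expectation (\<lambda>\<omega>. SU (a' - 1) b j \<omega>) / (s j ^ a * u j ^ b) = real a' * m (a' - 1) b j"
        proof (cases a')
          case (Suc a'')
          then show ?thesis using s[of j] \<open>a = Suc a'\<close> by (simp add: m_def sq power2_eq_square)
        qed simp
        ultimately show ?thesis by (simp only: add_divide_distrib)
      qed
      have m_fun: "m a b = (\<lambda>j. real a' * m (a' - 1) b j + e j / (s j ^ a * u j ^ b))" by (intro ext m)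
      show ?thesis
      proof (cases a')
        case 0
        then show ?thesis unfolding m_fun using E0 Suc by simp
      next
        case (Suc a'')
        have "(\<lambda>j. real a' * m (a' - 1) b j + e j / (s j ^ a * u j ^ b)) \<longlonglongrightarrow> real a' * (gauss_moment (a' - 1) * gauss_moment b) + 0"
          using \<open>a = Suc a'\<close> by (intro tendsto_intros less E0) simp
        then show ?thesis unfolding m_fun using \<open>a = Suc a'\<close> Suc by (simp add: mult.assoc)
      qed
    next
      case a: 0
      show ?thesis
      proof (cases b)
        case b: 0
        have "m 0 0 = (\<lambda>j. 1)" by (auto simp: m_def prob_space)
        then show ?thesis using a b by simp
      next
        case (Suc b')
        define e where "e j = real b' * (expectation (\<lambda>\<omega>. T_UU j \<omega> * SU 0 (b' - 1) j \<omega>)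
             - kurtosis_var j * expectation (\<lambda>\<omega>. SU 0 (b' - 1) j \<omega>))" for j
        have "e \<longlonglongrightarrow> 0" unfolding e_def
          using tendsto_mult_left[OF D(4), of "real b'" 0 "b' - 1"] by simp
        note E0 = normalize[OF this, of 0 b]
        have m: "m 0 b j = real b' * m 0 (b' - 1) j + e j / (s j ^ 0 * u j ^ b)" for j
        proof -
          have "m 0 b j = (real b' * kurtosis_var j * expectation (\<lambda>\<omega>. SU 0 (b' - 1) j \<omega>) + e j) / (s j ^ 0 * u j ^ b)"
            unfolding m_def Suc joint_parts_U e_def by (simp add: algebra_simps)
          also have "real b' * kurtosis_var j * expectation (\<lambda>\<omega>. SU 0 (b' - 1) j \<omega>) / (s j ^ 0 * u j ^ b) = real b' * m 0 (b' - 1) j"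
          proof (cases b')
            case (Suc b'')
            then show ?thesis using s[of j] \<open>b = Suc b'\<close> by (simp add: m_def sq power2_eq_square)
          qed simp
          ultimately show ?thesis by (simp only: add_divide_distrib)
        qed
        have m_fun: "m 0 b = (\<lambda>j. real b' * m 0 (b' - 1) j + e j / (s j ^ 0 * u j ^ b))" by (intro ext m)
        show ?thesis
        proof (cases b')
          case 0
          then show ?thesis unfolding a m_fun using E0 Suc by simp
        next
          case (Suc b'')
          have "(\<lambda>j. real b' * m 0 (b' - 1) j + e j / (s j ^ 0 * u j ^ b)) \<longlonglongrightarrow> real b' * (gauss_moment 0 * gauss_moment (b' - 1)) + 0"
            using \<open>b = Suc b'\<close> a by (intro tendsto_intros less E0) simp
          then show ?thesis unfolding a m_fun using \<open>b = Suc b'\<close> Suc by simp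
        qed
      qed
    qed
  qed
  then show ?thesis unfolding m_eq[symmetric] s_def u_def .
qed

end

section \<open>From moments to weak convergence\<close>

lemma pair_integral_product:
  fixes u v :: "'b \<Rightarrow> 'c::{real_normed_field, banach, second_countable_topology}"
  assumes "pair_sigma_finite M1 M2" and u: "integrable M1 u" and v: "integrable M2 v"
  shows "integrable (M1 \<Otimes>\<^sub>M M2) (\<lambda>z. u (fst z) * v (snd z))"
    and "(\<integral>z. u (fst z) * v (snd z) \<partial>(M1 \<Otimes>\<^sub>M M2)) = (\<integral>x. u x \<partial>M1) * (\<integral>y. v y \<partial>M2)"
proof -
  interpret pair_sigma_finite M1 M2 by fact
  have [measurable]: "u \<in> borel_measurable M1" "v \<in> borel_measurable M2" using u v by auto
  show int: "integrable (M1 \<Otimes>\<^sub>M M2) (\<lambda>z. u (fst z) * v (snd z))"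
    by (rule Fubini_integrable) (use u v in \<open>auto simp: norm_mult\<close>)
  show "(\<integral>z. u (fst z) * v (snd z) \<partial>(M1 \<Otimes>\<^sub>M M2)) = (\<integral>x. u x \<partial>M1) * (\<integral>y. v y \<partial>M2)"
    using integral_fst'[OF int] v u by simp
qed

section \<open>The planar normal law and Gaussian kernels\<close>

abbreviation std_normal_pair :: "(real \<times> real) measure" where
  "std_normal_pair \<equiv> std_normal_distribution \<Otimes>\<^sub>M std_normal_distribution"

lemma pair_prob_space_normal: "pair_prob_space std_normal_distribution std_normal_distribution"
  using real_dist_normal_dist by (simp add: pair_prob_space_def real_distribution_def pair_sigma_finite_def
     prob_space_imp_sigma_finite)

interpretation normal_pair: pair_prob_space std_normal_distribution std_normal_distribution
  by (rule pair_prob_space_normal)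

lemma measurable_fst_snd_borel [measurable]:
  "fst \<in> borel_measurable (borel :: (real \<times> real) measure)" "snd \<in> borel_measurable (borel :: (real \<times> real) measure)"
  unfolding borel_prod[symmetric] by simp_all

lemma std_normal_2d_eq: "std_normal_2d = std_normal_pair"
proof -
  have "std_normal_pair = density (lborel \<Otimes>\<^sub>M lborel) (\<lambda>(x, y). ennreal (std_normal_density x) * ennreal (std_normal_density y))"
    using prob_space_normal_density[of 1 0]
    by (intro pair_measure_density) (auto intro: prob_space_imp_sigma_finite sigma_finite_lborel)
  also have "\<dots> = std_normal_2d"
    unfolding std_normal_2d_def lborel_prod
  proof (rule density_cong)
    show "AE z in lborel. (case z of (x, y) \<Rightarrow> ennreal (std_normal_density x) * ennreal (std_normal_density y))
        = ennreal (exp (- (norm z)\<^sup>2 / 2) / (2 * pi))"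
    proof (intro AE_I2)
      fix z :: "real \<times> real"
      obtain x y where z: "z = (x, y)" by (cases z)
      have "std_normal_density x * std_normal_density y = exp (- (norm z)\<^sup>2 / 2) / (2 * pi)"
        by (simp add: z std_normal_density_def norm_Pair mult_exp_exp add_divide_distrib)
      then show "(case z of (x, y) \<Rightarrow> ennreal (std_normal_density x) * ennreal (std_normal_density y))
        = ennreal (exp (- (norm z)\<^sup>2 / 2) / (2 * pi))"
        by (simp add: z ennreal_mult[symmetric] normal_density_nonneg)
    qed
    show "(\<lambda>(x, y). ennreal (std_normal_density x) * ennreal (std_normal_density y)) \<in> borel_measurable (lborel :: (real \<times> real) measure)"
      unfolding case_prod_beta by measurable
  qed simp
  finally show ?thesis by simp
qed

text \<open>The characteristic function of two independent normals. Read from right to left it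
  represents a Gaussian bump as a mixture of cosines, which is how it is used.\<close>

lemma cos_std_normal_pair:
  "(\<integral>u. cos (fst u * a + snd u * b) \<partial>std_normal_pair) = exp (- (a\<^sup>2 + b\<^sup>2) / 2)"
proof -
  have int: "integrable std_normal_distribution (\<lambda>x. iexp (t * x))" for t
    using real_dist_normal_dist by (intro prob_space.integrable_iexp) (auto simp: real_distribution_def)
  have ch: "(\<integral>x. iexp (t * x) \<partial>std_normal_distribution) = complex_of_real (exp (- t\<^sup>2 / 2))" for t
    using fun_cong[OF char_std_normal_distribution, of t] by (simp add: char_def)
  note P = pair_integral_product[OF normal_pair.pair_sigma_finite_axioms int int, of a b]
  have "cos (fst u * a + snd u * b) = Re (iexp (a * fst u) * iexp (b * snd u))" for u :: "real \<times> real"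
    by (simp add: exp_add[symmetric] cis_conv_exp[symmetric] distrib_left[symmetric] mult_ac cos_add flip: of_real_add of_real_mult)
  then have "(\<integral>u. cos (fst u * a + snd u * b) \<partial>std_normal_pair) = Re (\<integral>u. iexp (a * fst u) * iexp (b * snd u) \<partial>std_normal_pair)"
    by (simp only: integral_Re[OF P(1)])
  also have "\<dots> = exp (- a\<^sup>2 / 2) * exp (- b\<^sup>2 / 2)"
    unfolding P(2) ch by simp
  finally show ?thesis by (simp add: mult_exp_exp add_divide_distrib)
qed

text \<open>The substitution \<open>y = z + h u\<close>, with Jacobian \<open>h^2\<close> in
  dimension two, moves \<open>z\<close> from the argument of \<open>f\<close> into the Gaussian
  kernel. As a function of \<open>z\<close> the smoothed function is then a mixture of bumps, with
  \<open>f\<close> as weight.\<close>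

lemma smoothing_eq:
  fixes f :: "real \<times> real \<Rightarrow> real"
  assumes f: "f \<in> borel_measurable borel" and h: "h > 0"
  shows "(\<integral>u. f (z + h *\<^sub>R u) \<partial>std_normal_pair)
       = (\<integral>y. f y * (exp (- (((fst y - fst z) / h)\<^sup>2 + ((snd y - snd z) / h)\<^sup>2) / 2) / (2 * pi * h\<^sup>2)) \<partial>lborel)"
proof -
  note [measurable] = f
  let ?g = "\<lambda>u::real \<times> real. exp (- (norm u)\<^sup>2 / 2) / (2 * pi)"
  have "(\<integral>u. f (z + h *\<^sub>R u) \<partial>std_normal_pair) = (\<integral>u. ?g u * f (z + h *\<^sub>R u) \<partial>lborel)"
    unfolding std_normal_2d_eq[symmetric] std_normal_2d_def
    by (subst integral_density) auto
  also have "\<dots> = (\<integral>u. h\<^sup>2 * (f (z + h *\<^sub>R u) * (?g u / h\<^sup>2)) \<partial>lborel)"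
    using h by (intro Bochner_Integration.integral_cong) auto
  also have "\<dots> = (\<integral>u. h\<^sup>2 * (f (z + h *\<^sub>R u) * (exp (- (((fst (z + h *\<^sub>R u) - fst z) / h)\<^sup>2 + ((snd (z + h *\<^sub>R u) - snd z) / h)\<^sup>2) / 2) / (2 * pi * h\<^sup>2))) \<partial>lborel)"
    using h by (intro Bochner_Integration.integral_cong) (auto simp: norm_prod_def)
  also have "\<dots> = (\<integral>y. f y * (exp (- (((fst y - fst z) / h)\<^sup>2 + ((snd y - snd z) / h)\<^sup>2) / 2) / (2 * pi * h\<^sup>2)) \<partial>density (distr lborel borel (\<lambda>x. z + h *\<^sub>R x)) (\<lambda>_. \<bar>h\<bar>^DIM(real \<times> real)))"
    using h by (subst integral_density) (simp_all add: integral_distr power2_eq_square[of h])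
  also have "density (distr lborel borel (\<lambda>x. z + h *\<^sub>R x)) (\<lambda>_. \<bar>h\<bar>^DIM(real \<times> real)) = lborel"
    using lborel_affine[of h z] h by simp
  finally show ?thesis .
qed

section \<open>Enlarging the class of convergent test functions\<close>

locale moment_convergence =
  fixes \<mu> :: "nat \<Rightarrow> (real \<times> real) measure"
  assumes prob: "prob_space (\<mu> n)" and sets [measurable_cong, simp]: "sets (\<mu> n) = sets borel"
    and integrable_moments: "integrable (\<mu> n) (\<lambda>z. fst z ^ a * snd z ^ b)"
    and moments: "(\<lambda>n. \<integral>z. fst z ^ a * snd z ^ b \<partial>\<mu> n) \<longlonglongrightarrow>
       (\<integral>x. x ^ a \<partial>std_normal_distribution) * (\<integral>y. y ^ b \<partial>std_normal_distribution)"
begin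

abbreviation "\<nu> \<equiv> std_normal_pair"

lemma sets_\<nu> [measurable_cong, simp]: "sets \<nu> = sets borel"
  unfolding borel_prod[symmetric] by (rule sets_pair_measure_cong) simp_all

definition conv :: "(real \<times> real \<Rightarrow> real) \<Rightarrow> bool" where
  "conv f \<longleftrightarrow> (\<lambda>n. \<integral>z. f z \<partial>\<mu> n) \<longlonglongrightarrow> (\<integral>z. f z \<partial>\<nu>)"

lemma integrable_\<nu>: "integrable \<nu> (\<lambda>z. fst z ^ a * snd z ^ b)"
  and integral_\<nu>: "(\<integral>z. fst z ^ a * snd z ^ b \<partial>\<nu>) = (\<integral>x. x ^ a \<partial>std_normal_distribution) * (\<integral>y. y ^ b \<partial>std_normal_distribution)"
  by (rule pair_integral_product[OF normal_pair.pair_sigma_finite_axioms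
        integrable_std_normal_distribution_moment integrable_std_normal_distribution_moment])+

lemma conv_moments: "conv (\<lambda>z. fst z ^ a * snd z ^ b)"
  unfolding conv_def integral_\<nu> by (rule moments)

lemma linear_power:
  shows "conv (\<lambda>z. (s * fst z + t * snd z) ^ k)"
    and "integrable (\<mu> n) (\<lambda>z. (s * fst z + t * snd z) ^ k)"
    and "integrable \<nu> (\<lambda>z. (s * fst z + t * snd z) ^ k)"
proof -
  have eq: "(s * fst z + t * snd z) ^ k = (\<Sum>i\<le>k. of_nat (k choose i) * s ^ i * t ^ (k - i) * (fst z ^ i * snd z ^ (k - i)))" for z :: "real \<times> real"
    by (simp add: binomial_ring power_mult_distrib mult_ac)
  show "conv (\<lambda>z. (s * fst z + t * snd z) ^ k)"
    unfolding conv_def eq using integrable_moments integrable_\<nu>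
    by (simp, intro tendsto_sum tendsto_mult_left conv_moments[unfolded conv_def])
  show "integrable (\<mu> n) (\<lambda>z. (s * fst z + t * snd z) ^ k)" "integrable \<nu> (\<lambda>z. (s * fst z + t * snd z) ^ k)"
    unfolding eq using integrable_moments integrable_\<nu> by simp_all
qed

lemma power_over_fact_tendsto_0: "(\<lambda>n. c ^ n / fact n) \<longlonglongrightarrow> (0 :: real)"
  using summable_LIMSEQ_zero[OF summable_exp[of c]] by (simp add: divide_inverse mult.commute)

text \<open>This makes the Taylor expansion of the limiting characteristic function converge, hence
  moments determine it. Splitting the power of the sum costs \<open>4^m\<close>; against
  \<open>2^m m!\<close> in the normal moment this leaves \<open>(2 s^2)^m / m!\<close> and its
  analogue for \<open>t\<close>.\<close>

lemma normal_moment_growth: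
  "(\<lambda>m. (\<integral>z. (s * fst z + t * snd z) ^ (2 * m) \<partial>\<nu>) / fact (2 * m)) \<longlonglongrightarrow> 0"
proof (rule Lim_null_comparison)
  have "(\<lambda>m. (2 * s\<^sup>2) ^ m / fact m + (2 * t\<^sup>2) ^ m / fact m) \<longlonglongrightarrow> 0 + 0"
    by (intro tendsto_add power_over_fact_tendsto_0)
  then show "(\<lambda>m. (2 * s\<^sup>2) ^ m / fact m + (2 * t\<^sup>2) ^ m / fact m) \<longlonglongrightarrow> 0" by simp
  show "\<forall>\<^sub>F m in sequentially. norm ((\<integral>z. (s * fst z + t * snd z) ^ (2 * m) \<partial>\<nu>) / fact (2 * m)) \<le> (2 * s\<^sup>2) ^ m / fact m + (2 * t\<^sup>2) ^ m / fact m"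
  proof (intro always_eventually allI)
    fix m
    let ?L = "\<integral>z. (s * fst z + t * snd z) ^ (2 * m) \<partial>\<nu>"
    have pt: "(a + b) ^ (2 * m) \<le> 4 ^ m * a ^ (2 * m) + 4 ^ m * b ^ (2 * m)" for a b :: real
      using power_add_le_convex[of a b "2 * m"] by (simp add: power_even_abs power_mult distrib_left)
    have i1: "integrable \<nu> (\<lambda>z. fst z ^ (2 * m))" "integrable \<nu> (\<lambda>z. snd z ^ (2 * m))"
      using integrable_\<nu>[of "2 * m" 0] integrable_\<nu>[of 0 "2 * m"] by simp_all
    have e1: "(\<integral>z. fst z ^ (2 * m) \<partial>\<nu>) = fact (2 * m) / (2 ^ m * fact m)" "(\<integral>z. snd z ^ (2 * m) \<partial>\<nu>) = fact (2 * m) / (2 ^ m * fact m)"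
      using integral_\<nu>[of "2 * m" 0] integral_\<nu>[of 0 "2 * m"]  std_normal_distribution_even_moments(1)[of 0]
      by (simp_all add: std_normal_distribution_even_moments)
    have "?L \<le> (\<integral>z. 4 ^ m * (s ^ (2 * m) * fst z ^ (2 * m)) + 4 ^ m * (t ^ (2 * m) * snd z ^ (2 * m)) \<partial>\<nu>)"
      by (intro integral_mono linear_power Bochner_Integration.integrable_add integrable_mult_right i1)
         (use pt[of "s * _" "t * _"] in \<open>simp add: power_mult_distrib\<close>)
    also have "\<dots> = 4 ^ m * (s ^ (2 * m) + t ^ (2 * m)) * (fact (2 * m) / (2 ^ m * fact m))"
      using i1 by (simp add: e1 distrib_left distrib_right add_divide_distrib)
    also have "\<dots> = ((2 * s\<^sup>2) ^ m / fact m + (2 * t\<^sup>2) ^ m / fact m) * fact (2 * m)"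
    proof -
      have "(4::real) ^ m = 2 ^ m * 2 ^ m" by (simp add: power_mult_distrib[symmetric])
      moreover have "s ^ (2 * m) = (s\<^sup>2) ^ m" "t ^ (2 * m) = (t\<^sup>2) ^ m" by (simp_all add: power_mult)
      ultimately show ?thesis by (simp add: power_mult_distrib field_simps)
    qed
    finally have "?L / fact (2 * m) \<le> (2 * s\<^sup>2) ^ m / fact m + (2 * t\<^sup>2) ^ m / fact m"
      by (simp add: divide_le_eq)
    moreover have "0 \<le> ?L" by (intro Bochner_Integration.integral_nonneg) auto
    ultimately show "norm (?L / fact (2 * m)) \<le> (2 * s\<^sup>2) ^ m / fact m + (2 * t\<^sup>2) ^ m / fact m" by simp
  qed
qed

text \<open>The one-dimensional Taylor estimate for the law of the linear form, at argument 1. The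
  order is even so that the error is an ordinary moment, whose convergence is known, rather than an
  absolute one.\<close>

lemma char_taylor:
  fixes N :: "(real \<times> real) measure" and s t :: real
  defines "Y \<equiv> \<lambda>z. s * fst z + t * snd z"
  assumes "prob_space N" and sets: "sets N = sets borel"
    and int: "\<And>k. integrable N (\<lambda>z. Y z ^ k)"
  shows "cmod ((\<integral>z. iexp (Y z) \<partial>N) - (\<Sum>k\<le>2 * m. (\<i> ^ k / fact k) * (\<integral>z. Y z ^ k \<partial>N))) \<le> 2 * ((\<integral>z. Y z ^ (2 * m) \<partial>N) / fact (2 * m))"
proof -
  interpret prob_space N by fact
  note [measurable_cong] = sets
  have Y: "Y \<in> borel_measurable N" unfolding Y_def by measurable
  have "char (distr N borel Y) 1 = (\<integral>z. iexp (Y z) \<partial>N)"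
    unfolding char_def using Y by (subst integral_distr) auto
  moreover have "\<bar>y\<bar> ^ (2 * m) = y ^ (2 * m)" for y :: real by (simp add: power_even_abs)
  ultimately show ?thesis
    using char_approx1'[of "2 * m" Y "distr N borel Y" 1, OF int Y refl] by simp
qed

lemma conv_cos: "conv (\<lambda>z. cos (s * fst z + t * snd z + c))"
proof -
  let ?Y = "\<lambda>z::real \<times> real. s * fst z + t * snd z"
  define P where "P N m = (\<Sum>k\<le>2 * m. (\<i> ^ k / fact k) * complex_of_real (\<integral>z. ?Y z ^ k \<partial>N))" for N m
  define b where "b N m = 2 * ((\<integral>z. ?Y z ^ (2 * m) \<partial>N) / fact (2 * m))" for N m
  have P: "(\<lambda>n. P (\<mu> n) m) \<longlonglongrightarrow> P \<nu> m" for m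
    unfolding P_def using linear_power(1)[of s t] by (intro tendsto_intros) (simp add: conv_def)
  have b: "(\<lambda>n. b (\<mu> n) m) \<longlonglongrightarrow> b \<nu> m" for m
    unfolding b_def using linear_power(1)[of s t] by (intro tendsto_intros) (simp_all add: conv_def)
  have b0: "(\<lambda>m. b \<nu> m) \<longlonglongrightarrow> 0"
    unfolding b_def using tendsto_mult_left[OF normal_moment_growth[of s t], of 2] by simp
  have taylor: "cmod ((\<integral>z. iexp (?Y z) \<partial>\<mu> n) - P (\<mu> n) m) \<le> b (\<mu> n) m"
     "cmod ((\<integral>z. iexp (?Y z) \<partial>\<nu>) - P \<nu> m) \<le> b \<nu> m" for n m
    unfolding P_def b_def
    by (intro char_taylor prob sets linear_power, intro char_taylor normal_pair.prob_space_axioms sets_\<nu> linear_power)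
  have ch: "(\<lambda>n. \<integral>z. iexp (?Y z) \<partial>\<mu> n) \<longlonglongrightarrow> (\<integral>z. iexp (?Y z) \<partial>\<nu>)"
  proof (rule tendstoI)
    fix e :: real assume e: "e > 0"
    \<comment> \<open>The order \<open>m\<close> is chosen for the normal law alone. The error term
      of \<open>\<mu> n\<close> at this fixed \<open>m\<close> converges to that of the normal law,
      so no growth bound on the moments of \<open>\<mu> n\<close> enters.\<close>
    from order_tendstoD(2)[OF b0, of "e / 4"] e obtain m where m: "b \<nu> m < e / 4"
      by (auto simp: eventually_sequentially)
    have "\<forall>\<^sub>F n in sequentially. b (\<mu> n) m < e / 4" using order_tendstoD(2)[OF b m] .
    moreover have "\<forall>\<^sub>F n in sequentially. dist (P (\<mu> n) m) (P \<nu> m) < e / 4"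
      using e by (intro tendstoD[OF P]) simp
    ultimately show "\<forall>\<^sub>F n in sequentially. dist (\<integral>z. iexp (?Y z) \<partial>\<mu> n) (\<integral>z. iexp (?Y z) \<partial>\<nu>) < e"
    proof eventually_elim
      case (elim n)
      let ?a = "\<integral>z. iexp (?Y z) \<partial>\<mu> n" and ?b = "\<integral>z. iexp (?Y z) \<partial>\<nu>"
      have "dist ?a ?b \<le> dist ?a (P (\<mu> n) m) + dist (P (\<mu> n) m) (P \<nu> m) + dist ?b (P \<nu> m)"
        by (rule order_trans[OF dist_triangle2[of ?a ?b "P \<nu> m"]]) (simp add: dist_triangle)
      also have "\<dots> < e" using taylor(1)[of n m] taylor(2)[of m] elim m e by (simp add: dist_norm)
      finally show ?case .
    qed
  qed
  have eq: "(\<integral>z. cos (?Y z + c) \<partial>N) = Re (cis c * (\<integral>z. iexp (?Y z) \<partial>N))"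
    if "prob_space N" and sets: "sets N = sets borel" for N
  proof -
    interpret prob_space N by fact
    note [measurable_cong] = sets
    have int: "integrable N (\<lambda>z. iexp (?Y z))" by (rule integrable_const_bound[of _ 1]) auto
    have "cos (?Y z + c) = Re (cis c * iexp (?Y z))" for z
      by (simp only: cis_conv_exp[symmetric] cis_mult) (simp add: add.commute)
    then have "(\<integral>z. cos (?Y z + c) \<partial>N) = (\<integral>z. Re (cis c * iexp (?Y z)) \<partial>N)" by simp
    also have "\<dots> = Re (\<integral>z. cis c * iexp (?Y z) \<partial>N)"
      using int by (intro integral_Re integrable_mult_right)
    finally show ?thesis by simp
  qed
  show ?thesis
    unfolding conv_def eq[OF prob sets] eq[OF normal_pair.prob_space_axioms sets_\<nu>]
    by (intro tendsto_Re tendsto_mult_left ch)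
qed

text \<open>Fubini moves the mixing outside. For each \<open>c\<close> the inner integrals converge,
  and the constant \<open>B\<close> dominates them because the mixing measure is finite.\<close>

lemma conv_mixture:
  assumes \<eta>: "finite_measure \<eta>" and F: "(\<lambda>(c, z). F c z) \<in> borel_measurable (\<eta> \<Otimes>\<^sub>M borel)"
    and B: "\<And>c z. \<bar>F c z\<bar> \<le> B" and conv: "\<And>c. conv (F c)"
  shows "conv (\<lambda>z. \<integral>c. F c z \<partial>\<eta>)"
proof -
  interpret \<eta>: finite_measure \<eta> by fact
  have swap: "(\<integral>z. (\<integral>c. F c z \<partial>\<eta>) \<partial>N) = (\<integral>c. (\<integral>z. F c z \<partial>N) \<partial>\<eta>)"
    and meas: "(\<lambda>c. \<integral>z. F c z \<partial>N) \<in> borel_measurable \<eta>"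
    and bd: "\<bar>\<integral>z. F c z \<partial>N\<bar> \<le> B"
    if N: "prob_space N" and sets: "sets N = sets borel" for N c
  proof -
    interpret N: prob_space N by fact
    interpret P: pair_sigma_finite \<eta> N ..
    interpret PF: finite_measure "\<eta> \<Otimes>\<^sub>M N" by (rule finite_measure_pair_measure) unfold_locales
    have F': "(\<lambda>(c, z). F c z) \<in> borel_measurable (\<eta> \<Otimes>\<^sub>M N)"
      using F by (subst measurable_cong_sets[OF sets_pair_measure_cong[OF refl sets] refl])
    have int: "integrable (\<eta> \<Otimes>\<^sub>M N) (\<lambda>(c, z). F c z)"
      by (rule PF.integrable_const_bound[of _ B]) (use F' B in auto)
    show "(\<integral>z. (\<integral>c. F c z \<partial>\<eta>) \<partial>N) = (\<integral>c. (\<integral>z. F c z \<partial>N) \<partial>\<eta>)"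
      using P.Fubini_integral[OF int] .
    show "(\<lambda>c. \<integral>z. F c z \<partial>N) \<in> borel_measurable \<eta>"
      using F' by (rule N.borel_measurable_lebesgue_integral)
    have "B \<ge> 0" using B[of undefined undefined] by linarith
    \<comment> \<open>If \<open>F c\<close> is not integrable, its integral is 0 by convention, so
      the bound holds in that case too.\<close>
    then show "\<bar>\<integral>z. F c z \<partial>N\<bar> \<le> B"
      using B N.integral_le_const[of "F c" B] N.integral_ge_const[of "F c" "- B"]
      by (cases "integrable N (F c)") (auto simp: abs_le_iff minus_le_iff not_integrable_integral_eq)
  qed
  note M = meas[OF prob sets] meas[OF normal_pair.prob_space_axioms sets_\<nu>]
  show ?thesis
    unfolding conv_def swap[OF prob sets] swap[OF normal_pair.prob_space_axioms sets_\<nu>]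
    by (rule integral_dominated_convergence[where w = "\<lambda>_. B"])
       (use M bd[OF prob sets] conv in \<open>auto simp: conv_def\<close>)
qed

text \<open>For a fixed frequency \<open>u\<close> one has a cosine of an affine function of
  \<open>z\<close>, with a phase depending on the centre \<open>(y1, y2)\<close>; averaging over
  normal \<open>u\<close> produces the bump.\<close>

lemma conv_gaussian:
  assumes "h > 0"
  shows "conv (\<lambda>z. exp (- (((y1 - fst z) / h)\<^sup>2 + ((y2 - snd z) / h)\<^sup>2) / 2))"
proof -
  have "conv (\<lambda>z. \<integral>u. cos (fst u * ((y1 - fst z) / h) + snd u * ((y2 - snd z) / h)) \<partial>std_normal_pair)"
  proof (rule conv_mixture[where B = 1])
    show "finite_measure std_normal_pair" by unfold_locales
    fix u :: "real \<times> real"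
    have "(\<lambda>z. cos (fst u * ((y1 - fst z) / h) + snd u * ((y2 - snd z) / h)))
       = (\<lambda>z. cos ((- fst u / h) * fst z + (- snd u / h) * snd z + (fst u * y1 / h + snd u * y2 / h)))"
      using assms by (intro ext arg_cong[where f = cos]) (simp add: field_simps)
    then show "conv (\<lambda>z. cos (fst u * ((y1 - fst z) / h) + snd u * ((y2 - snd z) / h)))"
      by (simp only: conv_cos)
  qed (auto simp: borel_prod[symmetric])
  then show ?thesis unfolding cos_std_normal_pair .
qed

lemma conv_cmult: "conv f \<Longrightarrow> conv (\<lambda>z. c * f z)"
  unfolding conv_def by (simp add: tendsto_mult_left)

lemma conv_smoothing:
  assumes f: "continuous_on UNIV f" and B: "\<And>z. \<bar>f z\<bar> \<le> B" and supp: "\<And>z. norm z > L \<Longrightarrow> f z = 0" and h: "h > 0"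
  shows "conv (\<lambda>z. \<integral>u. f (z + h *\<^sub>R u) \<partial>std_normal_pair)"
proof -
  let ?g = "\<lambda>y z. exp (- (((fst y - fst z) / h)\<^sup>2 + ((snd y - snd z) / h)\<^sup>2) / 2) :: real"
  have [measurable]: "f \<in> borel_measurable borel" using f by (rule borel_measurable_continuous_onI)
  \<comment> \<open>Lebesgue measure is cut to a ball outside which \<open>f\<close> vanishes,
    because the mixing measure has to be finite.\<close>
  define \<eta> where "\<eta> = restrict_space lborel (cball (0 :: real \<times> real) L)"
  have fin: "finite_measure \<eta>" unfolding \<eta>_def
    using emeasure_lborel_cball_finite[of "0 :: real \<times> real" L]
    by (intro finite_measureI) (auto simp: emeasure_restrict_space space_restrict_space)
  have eq: "(\<integral>u. f (z + h *\<^sub>R u) \<partial>std_normal_pair) = (\<integral>y. f y * ?g y z / (2 * pi * h\<^sup>2) \<partial>\<eta>)" for z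
  proof -
    have "(\<integral>y. f y * ?g y z / (2 * pi * h\<^sup>2) \<partial>\<eta>) = (\<integral>y. indicator (cball 0 L) y *\<^sub>R (f y * ?g y z / (2 * pi * h\<^sup>2)) \<partial>lborel)"
      unfolding \<eta>_def by (subst integral_restrict_space) auto
    also have "\<dots> = (\<integral>y. f y * (?g y z / (2 * pi * h\<^sup>2)) \<partial>lborel)"
      using supp by (intro Bochner_Integration.integral_cong) (auto simp: indicator_def)
    finally show ?thesis using smoothing_eq[of f h z] h by simp
  qed
  have B0: "B \<ge> 0" using B[of 0] by linarith
  show ?thesis
    unfolding eq
  proof (rule conv_mixture[OF fin, where B = "B / (2 * pi * h\<^sup>2)"])
    have [measurable]: "(\<lambda>y. y) \<in> measurable \<eta> borel" unfolding \<eta>_def by (intro measurable_restrict_space1) simp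
    have [measurable]: "(\<lambda>w. fst (fst w) :: real) \<in> borel_measurable (\<eta> \<Otimes>\<^sub>M (borel :: (real \<times> real) measure))"
      "(\<lambda>w. snd (fst w) :: real) \<in> borel_measurable (\<eta> \<Otimes>\<^sub>M (borel :: (real \<times> real) measure))"
      "(\<lambda>w. f (fst w)) \<in> borel_measurable (\<eta> \<Otimes>\<^sub>M (borel :: (real \<times> real) measure))"
      by (rule measurable_compose[OF measurable_fst measurable_compose[OF \<open>(\<lambda>y. y) \<in> measurable \<eta> borel\<close>]]; simp)+
    show "(\<lambda>(y, z). f y * ?g y z / (2 * pi * h\<^sup>2)) \<in> borel_measurable (\<eta> \<Otimes>\<^sub>M borel)"
      unfolding case_prod_beta by measurable
    show "conv (\<lambda>z. f y * ?g y z / (2 * pi * h\<^sup>2))" for y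
      using conv_cmult[OF conv_gaussian[OF h, of "fst y" "snd y"], of "f y / (2 * pi * h\<^sup>2)"] by simp
    fix y z
    have "\<bar>f y * ?g y z\<bar> \<le> B * 1" unfolding abs_mult using B B0 by (intro mult_mono) auto
    then show "\<bar>f y * ?g y z / (2 * pi * h\<^sup>2)\<bar> \<le> B / (2 * pi * h\<^sup>2)"
      using h by (simp add: abs_mult divide_right_mono)
  qed
qed

text \<open>Closeness is asked of the integrals, uniformly in \<open>n\<close>, and not of the
  functions; this covers uniform approximation as well as truncation at a large radius.\<close>

lemma conv_uniform_limit:
  assumes approx: "\<And>e. e > 0 \<Longrightarrow> \<exists>g. conv g \<and> (\<forall>n. \<bar>(\<integral>z. f z \<partial>\<mu> n) - (\<integral>z. g z \<partial>\<mu> n)\<bar> \<le> e) \<and> \<bar>(\<integral>z. f z \<partial>\<nu>) - (\<integral>z. g z \<partial>\<nu>)\<bar> \<le> e"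
  shows "conv f"
  unfolding conv_def
proof (rule tendstoI)
  fix e :: real assume e: "e > 0"
  then obtain g where g: "conv g" "\<And>n. \<bar>(\<integral>z. f z \<partial>\<mu> n) - (\<integral>z. g z \<partial>\<mu> n)\<bar> \<le> e / 4"
      "\<bar>(\<integral>z. f z \<partial>\<nu>) - (\<integral>z. g z \<partial>\<nu>)\<bar> \<le> e / 4"
    using approx[of "e / 4"] by auto
  have "\<forall>\<^sub>F n in sequentially. dist (\<integral>z. g z \<partial>\<mu> n) (\<integral>z. g z \<partial>\<nu>) < e / 4"
    using g(1) e unfolding conv_def by (intro tendstoD) auto
  then show "\<forall>\<^sub>F n in sequentially. dist (\<integral>z. f z \<partial>\<mu> n) (\<integral>z. f z \<partial>\<nu>) < e"
  proof eventually_elim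
    case (elim n)
    then show ?case using g(2)[of n] g(3) unfolding dist_real_def by linarith
  qed
qed

lemma norm_square_eq: "(norm z)\<^sup>2 = fst z ^ 2 + snd z ^ 2" for z :: "real \<times> real"
  by (simp add: norm_prod_def)

lemma integrable_norm_square: "integrable (\<mu> n) (\<lambda>z. (norm z)\<^sup>2)" "integrable \<nu> (\<lambda>z. (norm z)\<^sup>2)"
  unfolding norm_square_eq
  using integrable_moments[of n 2 0] integrable_moments[of n 0 2] integrable_\<nu>[of 2 0] integrable_\<nu>[of 0 2] by simp_all

lemma conv_norm_square: "conv (\<lambda>z. (norm z)\<^sup>2)"
  unfolding norm_square_eq conv_def
  using tendsto_add[OF conv_moments[of 2 0, unfolded conv_def] conv_moments[of 0 2, unfolded conv_def]]
    integrable_moments[of _ 2 0] integrable_moments[of _ 0 2] integrable_\<nu>[of 2 0] integrable_\<nu>[of 0 2] by simp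

lemma integral_diff_le:
  fixes f g W :: "real \<times> real \<Rightarrow> real"
  assumes N: "prob_space N" and sets: "sets N = sets borel"
    and f: "f \<in> borel_measurable borel" "\<And>z. \<bar>f z\<bar> \<le> B"
    and g: "g \<in> borel_measurable borel" "\<And>z. \<bar>g z\<bar> \<le> B"
    and W: "integrable N W" "\<And>z. \<bar>f z - g z\<bar> \<le> W z"
  shows "\<bar>(\<integral>z. f z \<partial>N) - (\<integral>z. g z \<partial>N)\<bar> \<le> (\<integral>z. W z \<partial>N)"
proof -
  interpret prob_space N by fact
  have fg: "f \<in> borel_measurable N" "g \<in> borel_measurable N"
    using f(1) g(1) by (simp_all add: measurable_cong_sets[OF sets refl])
  then have int: "integrable N f" "integrable N g"
    using f(2) g(2) by (auto intro!: integrable_const_bound[of _ B])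
  then have "\<bar>(\<integral>z. f z \<partial>N) - (\<integral>z. g z \<partial>N)\<bar> = \<bar>\<integral>z. f z - g z \<partial>N\<bar>" by simp
  also have "\<dots> \<le> (\<integral>z. \<bar>f z - g z\<bar> \<partial>N)" by (rule integral_abs_bound)
  also have "\<dots> \<le> (\<integral>z. W z \<partial>N)" using int W by (intro integral_mono) auto
  finally show ?thesis .
qed

lemma smoothing_measurable:
  fixes f :: "real \<times> real \<Rightarrow> real"
  assumes "f \<in> borel_measurable borel"
  shows "(\<lambda>z. \<integral>u. f (z + h *\<^sub>R u) \<partial>std_normal_pair) \<in> borel_measurable borel"
proof (rule sigma_finite_measure.borel_measurable_lebesgue_integral)
  note [measurable] = assms
  show "(\<lambda>(z, u). f (z + h *\<^sub>R u)) \<in> borel_measurable (borel \<Otimes>\<^sub>M std_normal_pair)"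
    by measurable
qed (rule normal_pair.sigma_finite_measure_axioms)

lemma smoothing_close:
  fixes f :: "real \<times> real \<Rightarrow> real"
  assumes uc: "uniformly_continuous_on UNIV f" and B: "\<And>z. \<bar>f z\<bar> \<le> B" and e: "e > 0"
  obtains h where "h > 0" "\<And>z. \<bar>(\<integral>u. f (z + h *\<^sub>R u) \<partial>std_normal_pair) - f z\<bar> \<le> e"
proof -
  have meas: "f \<in> borel_measurable borel"
    using uniformly_continuous_imp_continuous[OF uc] by (rule borel_measurable_continuous_onI)
  have B0: "B \<ge> 0" using B[of 0] by linarith
  obtain d where d: "d > 0" "\<And>z z'. dist z' z < d \<Longrightarrow> dist (f z') (f z) < e / 2"
    using uc e unfolding uniformly_continuous_on_def by (metis UNIV_I half_gt_zero)
  \<comment> \<open>The contribution \<open>4 * B * (h / d)^2\<close> of large \<open>u\<close> must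
    be at most \<open>e / 2\<close>; with \<open>B + 1\<close> in place of \<open>B\<close> the
    quotient also makes sense for \<open>B = 0\<close>.\<close>
  define h where "h = d * sqrt (e / (8 * (B + 1)))"
  have h: "h > 0" "h\<^sup>2 / d\<^sup>2 = e / (8 * (B + 1))"
    using d(1) e B0 by (simp_all add: h_def power_mult_distrib)
  have second: "(\<integral>u. (norm u)\<^sup>2 \<partial>\<nu>) = 2"
    unfolding norm_square_eq using integrable_\<nu>[of 2 0] integrable_\<nu>[of 0 2] integral_\<nu>[of 2 0] integral_\<nu>[of 0 2]
      std_normal_distribution_even_moments(1)[of 0] std_normal_distribution_even_moments(1)[of 1]
    by simp
  have "\<bar>(\<integral>u. f (z + h *\<^sub>R u) \<partial>\<nu>) - f z\<bar> \<le> e" for z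
  proof -
    \<comment> \<open>Uniform continuity where \<open>h |u| < d\<close>; elsewhere the trivial bound
      \<open>2 B\<close> is multiplied by \<open>(h |u| / d)^2 >= 1\<close>, the pointwise form of
      Chebyshev's inequality.\<close>
    have pt: "\<bar>f (z + h *\<^sub>R u) - f z\<bar> \<le> e / 2 + 2 * B * (h\<^sup>2 / d\<^sup>2) * (norm u)\<^sup>2" for u
    proof (cases "h * norm u < d")
      case True
      then have "dist (z + h *\<^sub>R u) z < d" using h by (simp add: dist_norm)
      from d(2)[OF this] have "\<bar>f (z + h *\<^sub>R u) - f z\<bar> \<le> e / 2" by (simp add: dist_real_def)
      moreover have "0 \<le> 2 * B * (h\<^sup>2 / d\<^sup>2) * (norm u)\<^sup>2" using B0 by simp
      ultimately show ?thesis by linarith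
    next
      case False
      then have "d\<^sup>2 \<le> (h * norm u)\<^sup>2" using d(1) by (intro power_mono) auto
      then have "1 \<le> h\<^sup>2 / d\<^sup>2 * (norm u)\<^sup>2" using d(1) by (simp add: power_mult_distrib field_simps)
      then have "2 * B * 1 \<le> 2 * B * (h\<^sup>2 / d\<^sup>2 * (norm u)\<^sup>2)" using B0 by (intro mult_left_mono) auto
      moreover have "\<bar>f (z + h *\<^sub>R u) - f z\<bar> \<le> 2 * B" using B[of "z + h *\<^sub>R u"] B[of z] by linarith
      ultimately show ?thesis using e by (simp only: mult.assoc)
    qed
    have "\<bar>(\<integral>u. f (z + h *\<^sub>R u) \<partial>\<nu>) - (\<integral>u. f z \<partial>\<nu>)\<bar> \<le> (\<integral>u. e / 2 + 2 * B * (h\<^sup>2 / d\<^sup>2) * (norm u)\<^sup>2 \<partial>\<nu>)"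
    proof (rule integral_diff_le[where B = B, OF normal_pair.prob_space_axioms sets_\<nu> _ _ _ _ _ pt])
      show "(\<lambda>u. f (z + h *\<^sub>R u)) \<in> borel_measurable borel"
        by (rule measurable_compose[OF _ meas]) simp
      show "integrable \<nu> (\<lambda>u. e / 2 + 2 * B * (h\<^sup>2 / d\<^sup>2) * (norm u)\<^sup>2)"
        by (intro Bochner_Integration.integrable_add integrable_mult_right integrable_norm_square) simp
    qed (use B in auto)
    also have "\<dots> = e / 2 + 4 * B * (h\<^sup>2 / d\<^sup>2)"
      using integrable_norm_square(2) by (subst Bochner_Integration.integral_add) (auto simp: second normal_pair.prob_space)
    also have "\<dots> \<le> e"
    proof -
      have "8 * B * e \<le> 8 * (B + 1) * e" using e by (intro mult_right_mono) auto
      then show ?thesis unfolding h(2) using B0 by (simp add: field_simps)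
    qed
    finally show ?thesis by (simp add: normal_pair.prob_space)
  qed
  with h(1) show thesis by (rule that)
qed

lemma conv_compact_support:
  fixes f :: "real \<times> real \<Rightarrow> real"
  assumes f: "continuous_on UNIV f" and B: "\<And>z. \<bar>f z\<bar> \<le> B" and supp: "\<And>z. norm z > L \<Longrightarrow> f z = 0"
  shows "conv f"
proof (rule conv_uniform_limit)
  have meas: "f \<in> borel_measurable borel" using f by (rule borel_measurable_continuous_onI)
  have uc: "uniformly_continuous_on UNIV f"
    unfolding uniformly_continuous_on_def
  proof (intro allI impI)
    fix e :: real assume e: "e > 0"
    have "uniformly_continuous_on (cball 0 (L + 1)) f"
      using continuous_on_subset[OF f] by (intro compact_uniformly_continuous) auto
    then obtain d where d: "d > 0" "\<And>z z'. z \<in> cball 0 (L + 1) \<Longrightarrow> z' \<in> cball 0 (L + 1) \<Longrightarrow> dist z' z < d \<Longrightarrow> dist (f z') (f z) < e"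
      using e unfolding uniformly_continuous_on_def by metis
    \<comment> \<open>Two points at distance below 1 are either both outside the ball of radius
      \<open>L\<close>, where \<open>f\<close> vanishes, or both in the compact ball of radius
      \<open>L + 1\<close>.\<close>
    have "dist (f z') (f z) < e" if "dist z' z < min d 1" for z z'
    proof (cases "norm z > L \<and> norm z' > L")
      case True
      then show ?thesis using supp e by simp
    next
      case False
      have "\<bar>norm z' - norm z\<bar> < 1"
        using that norm_triangle_ineq3[of z' z] by (simp add: dist_norm)
      with False have "z \<in> cball 0 (L + 1)" "z' \<in> cball 0 (L + 1)" by auto
      then show ?thesis using d(2) that by simp
    qed
    then show "\<exists>d>0. \<forall>z\<in>UNIV. \<forall>z'\<in>UNIV. dist z' z < d \<longrightarrow> dist (f z') (f z) < e"
      using d(1) by (intro exI[of _ "min d 1"]) auto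
  qed
  fix e :: real assume e: "e > 0"
  obtain h where h: "h > 0" and close: "\<And>z. \<bar>(\<integral>u. f (z + h *\<^sub>R u) \<partial>std_normal_pair) - f z\<bar> \<le> e"
    using smoothing_close[OF uc B e] by blast
  let ?g = "\<lambda>z. \<integral>u. f (z + h *\<^sub>R u) \<partial>std_normal_pair"
  have gB: "\<bar>?g z\<bar> \<le> B + e" "\<bar>f z\<bar> \<le> B + e" for z using close[of z] B[of z] e by linarith+
  have le: "\<bar>(\<integral>z. f z \<partial>N) - (\<integral>z. ?g z \<partial>N)\<bar> \<le> e" if "prob_space N" "sets N = sets borel" for N
  proof -
    interpret N: prob_space N by fact
    have "\<bar>(\<integral>z. f z \<partial>N) - (\<integral>z. ?g z \<partial>N)\<bar> \<le> (\<integral>z. e \<partial>N)"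
      using close by (intro integral_diff_le[OF that meas gB(2) smoothing_measurable[OF meas] gB(1)])
        (auto simp: abs_minus_commute)
    then show ?thesis by (simp add: N.prob_space)
  qed
  show "\<exists>g. conv g \<and> (\<forall>n. \<bar>(\<integral>z. f z \<partial>\<mu> n) - (\<integral>z. g z \<partial>\<mu> n)\<bar> \<le> e) \<and> \<bar>(\<integral>z. f z \<partial>\<nu>) - (\<integral>z. g z \<partial>\<nu>)\<bar> \<le> e"
    using conv_smoothing[OF f B supp h] le[OF prob sets] le[OF normal_pair.prob_space_axioms sets_\<nu>] by blast
qed

text \<open>Tightness comes from the second moments: they converge, hence are bounded, and the mass
  beyond radius \<open>L\<close> is at most this bound over \<open>L^2\<close>.\<close>

theorem conv_bounded_continuous:
  assumes f: "continuous_on UNIV f" and B: "\<And>z. \<bar>f z\<bar> \<le> B"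
  shows "conv f"
proof (rule conv_uniform_limit)
  have meas: "f \<in> borel_measurable borel" using f by (rule borel_measurable_continuous_onI)
  have B0: "B \<ge> 0" using B[of 0] by linarith
  have "Bseq (\<lambda>n. \<integral>z. (norm z)\<^sup>2 \<partial>\<mu> n)"
    using conv_norm_square unfolding conv_def by (intro convergent_imp_Bseq convergentI)
  then obtain V0 where V0: "\<And>n. \<bar>\<integral>z. (norm z)\<^sup>2 \<partial>\<mu> n\<bar> \<le> V0" by (auto simp: Bseq_def)
  define V where "V = max V0 (\<integral>z. (norm z)\<^sup>2 \<partial>\<nu>)"
  have V: "(\<integral>z. (norm z)\<^sup>2 \<partial>\<mu> n) \<le> V" "(\<integral>z. (norm z)\<^sup>2 \<partial>\<nu>) \<le> V" for n
    using V0[of n] unfolding V_def by linarith+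
  fix e :: real assume e: "e > 0"
  \<comment> \<open>Chosen so that \<open>B * V / L^2 <= e\<close>; the summand 1 keeps
    \<open>L\<close> positive.\<close>
  define L where "L = sqrt ((B * \<bar>V\<bar> + 1) / e)"
  have L: "L > 0" "L\<^sup>2 = (B * \<bar>V\<bar> + 1) / e" using e B0 by (simp_all add: L_def add_nonneg_pos)
  let ?\<chi> = "\<lambda>z::real \<times> real. max 0 (min 1 (L + 1 - norm z))"
  let ?g = "\<lambda>z. f z * ?\<chi> z"
  have g: "continuous_on UNIV ?g" by (intro continuous_intros f)
  have gB: "\<bar>?g z\<bar> \<le> B" for z
  proof -
    have "\<bar>f z\<bar> * \<bar>?\<chi> z\<bar> \<le> B * 1" using B B0 by (intro mult_mono) auto
    then show ?thesis by (simp add: abs_mult)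
  qed
  have pt: "\<bar>f z - ?g z\<bar> \<le> B / L\<^sup>2 * (norm z)\<^sup>2" for z
  proof (cases "norm z \<le> L")
    case True
    then show ?thesis using B0 by simp
  next
    case False
    have "f z - ?g z = f z * (1 - ?\<chi> z)" by (simp add: algebra_simps)
    then have "\<bar>f z - ?g z\<bar> = \<bar>f z\<bar> * \<bar>1 - ?\<chi> z\<bar>" by (simp add: abs_mult)
    also have "\<dots> \<le> B * 1" using B B0 by (intro mult_mono) auto
    also have "\<dots> \<le> B * ((norm z)\<^sup>2 / L\<^sup>2)"
    proof (intro mult_left_mono B0)
      have "L\<^sup>2 \<le> (norm z)\<^sup>2" using False L by (intro power_mono) auto
      then show "1 \<le> (norm z)\<^sup>2 / L\<^sup>2" using zero_less_power[OF L(1), of 2] by (simp add: le_divide_eq)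
    qed
    finally show ?thesis by simp
  qed
  have small: "B / L\<^sup>2 * v \<le> e" if "v \<le> V" for v
  proof -
    have "B * v \<le> B * \<bar>V\<bar>" using that B0 by (intro mult_left_mono) auto
    then have "B * v \<le> B * \<bar>V\<bar> + 1" by simp
    then have "B * v * e \<le> (B * \<bar>V\<bar> + 1) * e" using e by (intro mult_right_mono) auto
    moreover have "B * \<bar>V\<bar> + 1 > 0" using B0 by (simp add: add_nonneg_pos)
    ultimately show ?thesis unfolding L(2) using e by (simp add: divide_le_eq mult_ac)
  qed
  have le: "\<bar>(\<integral>z. f z \<partial>N) - (\<integral>z. ?g z \<partial>N)\<bar> \<le> e"
    if N: "prob_space N" "sets N = sets borel" and i: "integrable N (\<lambda>z. (norm z)\<^sup>2)" and v: "(\<integral>z. (norm z)\<^sup>2 \<partial>N) \<le> V" for N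
  proof -
    have "\<bar>(\<integral>z. f z \<partial>N) - (\<integral>z. ?g z \<partial>N)\<bar> \<le> (\<integral>z. B / L\<^sup>2 * (norm z)\<^sup>2 \<partial>N)"
      by (rule integral_diff_le[OF N meas B borel_measurable_continuous_onI[OF g] gB _ pt])
         (intro integrable_mult_right i)
    also have "\<dots> \<le> e" using small[OF v] by simp
    finally show ?thesis .
  qed
  have "conv ?g" by (rule conv_compact_support[OF g gB, of "L + 1"]) simp
  then show "\<exists>g. conv g \<and> (\<forall>n. \<bar>(\<integral>z. f z \<partial>\<mu> n) - (\<integral>z. g z \<partial>\<mu> n)\<bar> \<le> e) \<and> \<bar>(\<integral>z. f z \<partial>\<nu>) - (\<integral>z. g z \<partial>\<nu>)\<bar> \<le> e"
    using le[OF prob sets integrable_norm_square(1) V(1)]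
      le[OF normal_pair.prob_space_axioms sets_\<nu> integrable_norm_square(2) V(2)] by blast
qed

end

section \<open>Quadratic forms\<close>

definition quad_form :: "'i set \<Rightarrow> ('i \<Rightarrow> 'i \<Rightarrow> real) \<Rightarrow> ('i \<Rightarrow> real) \<Rightarrow> real" where
  "quad_form I R y = (\<Sum>k\<in>I. \<Sum>m\<in>I. R k m * (y k * y m))"

definition bounded_form :: "'i set \<Rightarrow> real \<Rightarrow> ('i \<Rightarrow> 'i \<Rightarrow> real) \<Rightarrow> bool" where
  "bounded_form I K R \<longleftrightarrow> (\<forall>y. 0 \<le> quad_form I R y \<and> quad_form I R y \<le> K * (\<Sum>k\<in>I. (y k)\<^sup>2))"

text \<open>With \<open>z = R y\<close>, expanding \<open>0 \<le> \<langle>R (z - K y), z - K y\<rangle>\<close> gives \<open>\<parallel>z\<parallel>\<^sup>2 \<le> K \<langle>R y, y\<rangle>\<close>.\<close>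

lemma bounded_form_operator:
  assumes R: "bounded_form I K R" and sym: "\<And>k m. R k m = R m k" and K: "K > 0"
  shows "(\<Sum>k\<in>I. (\<Sum>m\<in>I. R k m * y m)\<^sup>2) \<le> K\<^sup>2 * (\<Sum>m\<in>I. (y m)\<^sup>2)"
proof -
  define z where "z k = (\<Sum>m\<in>I. R k m * y m)" for k
  let ?Z = "\<Sum>k\<in>I. (z k)\<^sup>2"
  have 1: "(\<Sum>k\<in>I. \<Sum>m\<in>I. R k m * (z k * y m)) = ?Z"
  proof (intro sum.cong refl)
    fix k
    have "(\<Sum>m\<in>I. R k m * (z k * y m)) = z k * (\<Sum>m\<in>I. R k m * y m)" by (simp add: sum_distrib_left mult_ac)
    then show "(\<Sum>m\<in>I. R k m * (z k * y m)) = (z k)\<^sup>2" by (simp only: z_def[symmetric] power2_eq_square)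
  qed
  have 2: "(\<Sum>k\<in>I. \<Sum>m\<in>I. R k m * (y k * z m)) = ?Z"
    using 1 by (subst sum.swap) (simp add: sym mult_ac)
  have "quad_form I R (\<lambda>k. z k - K * y k) = (\<Sum>k\<in>I. \<Sum>m\<in>I. R k m * (z k * z m) - K * (R k m * (z k * y m))
       - K * (R k m * (y k * z m)) + K\<^sup>2 * (R k m * (y k * y m)))"
    unfolding quad_form_def by (intro sum.cong refl) (simp add: algebra_simps power2_eq_square)
  also have "\<dots> = quad_form I R z - K * ?Z - K * ?Z + K\<^sup>2 * quad_form I R y"
    by (simp only: sum.distrib sum_subtractf sum_distrib_left[symmetric] 1 2 quad_form_def)
  finally have "0 \<le> quad_form I R z - K * ?Z - K * ?Z + K\<^sup>2 * quad_form I R y"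
    using R unfolding bounded_form_def by metis
  moreover have "quad_form I R z \<le> K * ?Z" "quad_form I R y \<le> K * (\<Sum>m\<in>I. (y m)\<^sup>2)"
    using R unfolding bounded_form_def by blast+
  ultimately have "K * ?Z \<le> K\<^sup>2 * quad_form I R y" by linarith
  also have "\<dots> \<le> K\<^sup>2 * (K * (\<Sum>m\<in>I. (y m)\<^sup>2))"
    using \<open>quad_form I R y \<le> _\<close> by (intro mult_left_mono) auto
  finally have "K * ?Z \<le> K * (K\<^sup>2 * (\<Sum>m\<in>I. (y m)\<^sup>2))" by (simp add: mult_ac)
  then show ?thesis using K by (simp add: z_def)
qed

lemma quad_form_cos:
  "quad_form I (\<lambda>k m. R k m * cos (\<theta> k - \<theta> m)) y
     = quad_form I R (\<lambda>k. y k * cos (\<theta> k)) + quad_form I R (\<lambda>k. y k * sin (\<theta> k))"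
  unfolding quad_form_def sum.distrib[symmetric] by (intro sum.cong refl) (simp add: cos_diff algebra_simps)

lemma quad_form_cos_nonneg: "0 \<le> quad_form I (\<lambda>k m. cos (\<theta> k - \<theta> m)) y"
proof -
  have 1: "quad_form I (\<lambda>k m. 1) z = (\<Sum>k\<in>I. z k)\<^sup>2" for z
    by (simp add: quad_form_def power2_eq_square sum_product)
  show ?thesis using quad_form_cos[of I "\<lambda>k m. 1" \<theta> y] by (simp only: 1 mult_1_left) simp
qed

text \<open>The Schur product theorem, with the constant preserved because the second factor has
  unit diagonal. That factor is an average of modulations; each modulated form splits into the form
  of \<open>R\<close> at \<open>y cos\<close> and at \<open>y sin\<close>, and
  \<open>cos^2 + sin^2 = 1\<close> restores the length of \<open>y\<close>.\<close>

lemma bounded_form_schur: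
  assumes R: "bounded_form I K R" and p: "\<And>l. l \<in> L \<Longrightarrow> p l \<ge> 0" "(\<Sum>l\<in>L. p l) = 1"
  shows "bounded_form I K (\<lambda>k m. R k m * (\<Sum>l\<in>L. p l * cos (\<theta> l k - \<theta> l m)))"
  unfolding bounded_form_def
proof (intro allI)
  fix y
  define q where "q l = quad_form I (\<lambda>k m. R k m * cos (\<theta> l k - \<theta> l m)) y" for l
  have eq: "quad_form I (\<lambda>k m. R k m * (\<Sum>l\<in>L. p l * cos (\<theta> l k - \<theta> l m))) y = (\<Sum>l\<in>L. p l * q l)"
  proof -
    have "quad_form I (\<lambda>k m. R k m * (\<Sum>l\<in>L. p l * cos (\<theta> l k - \<theta> l m))) y
        = (\<Sum>k\<in>I. \<Sum>m\<in>I. \<Sum>l\<in>L. p l * (R k m * cos (\<theta> l k - \<theta> l m) * (y k * y m)))"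
      unfolding quad_form_def by (intro sum.cong refl) (simp add: sum_distrib_left sum_distrib_right mult_ac)
    also have "\<dots> = (\<Sum>l\<in>L. \<Sum>k\<in>I. \<Sum>m\<in>I. p l * (R k m * cos (\<theta> l k - \<theta> l m) * (y k * y m)))"
      by (subst sum.swap[of _ L]) (intro sum.cong refl sum.swap)
    finally show ?thesis by (simp add: q_def quad_form_def sum_distrib_left)
  qed
  have q: "0 \<le> q l" "q l \<le> K * (\<Sum>k\<in>I. (y k)\<^sup>2)" for l
  proof -
    let ?c = "\<lambda>k. y k * cos (\<theta> l k)" and ?s = "\<lambda>k. y k * sin (\<theta> l k)"
    have "0 \<le> quad_form I R ?c" "0 \<le> quad_form I R ?s"
      "quad_form I R ?c \<le> K * (\<Sum>k\<in>I. (?c k)\<^sup>2)" "quad_form I R ?s \<le> K * (\<Sum>k\<in>I. (?s k)\<^sup>2)"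
      using R unfolding bounded_form_def by blast+
    moreover have "K * (\<Sum>k\<in>I. (?c k)\<^sup>2) + K * (\<Sum>k\<in>I. (?s k)\<^sup>2) = K * (\<Sum>k\<in>I. (y k)\<^sup>2)"
      unfolding distrib_left[symmetric] sum.distrib[symmetric]
      by (simp add: power_mult_distrib distrib_left[symmetric])
    ultimately show "0 \<le> q l" "q l \<le> K * (\<Sum>k\<in>I. (y k)\<^sup>2)"
      unfolding q_def quad_form_cos by linarith+
  qed
  have "0 \<le> (\<Sum>l\<in>L. p l * q l)" using p q by (intro sum_nonneg mult_nonneg_nonneg) auto
  moreover have "(\<Sum>l\<in>L. p l * q l) \<le> (\<Sum>l\<in>L. p l * (K * (\<Sum>k\<in>I. (y k)\<^sup>2)))"
    using p q by (intro sum_mono mult_left_mono) auto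
  moreover have "(\<Sum>l\<in>L. p l * (K * (\<Sum>k\<in>I. (y k)\<^sup>2))) = K * (\<Sum>k\<in>I. (y k)\<^sup>2)"
    unfolding sum_distrib_right[symmetric] p(2) by simp
  ultimately show "0 \<le> quad_form I (\<lambda>k m. R k m * (\<Sum>l\<in>L. p l * cos (\<theta> l k - \<theta> l m))) y \<and>
      quad_form I (\<lambda>k m. R k m * (\<Sum>l\<in>L. p l * cos (\<theta> l k - \<theta> l m))) y \<le> K * (\<Sum>k\<in>I. (y k)\<^sup>2)"
    unfolding eq by simp
qed

section \<open>Trigonometric sums\<close>

text \<open>A geometric sum over an \<open>N\<close>-th root of unity \<open>z\<close> different
  from 1, so its numerator contains \<open>z^N - 1 = 0\<close>.\<close>

lemma cis_power_sum_zero: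
  assumes N: "N > 0" and s: "\<not> int N dvd s"
  shows "(\<Sum>i<N. cis (of_int s * tau N) ^ i) = 0"
proof -
  let ?z = "cis (of_int s * tau N)"
  have "?z \<noteq> 1"
  proof
    assume "?z = 1"
    then have "cos (of_int s * tau N) = 1" by (simp add: complex_eq_iff)
    then obtain m :: int where "of_int s * tau N = of_int m * 2 * pi" by (auto simp: cos_one_2pi_int)
    then have "of_int s = (of_int (m * int N) :: real)" using N by (simp add: tau_def field_simps)
    then show False using s by (metis of_int_eq_iff dvd_triv_right)
  qed
  moreover have "?z ^ N = 1"
  proof -
    have "?z ^ N = cis (2 * pi * of_int s)"
      using N unfolding Complex.DeMoivre by (intro arg_cong[where f = cis]) (simp add: tau_def)
    then show ?thesis by (simp add: cis_multiple_2pi)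
  qed
  ultimately show ?thesis by (simp add: sum_gp_strict)
qed

lemma cis_sum_zero:
  assumes N: "N > 0" and s: "\<not> int N dvd s"
  shows "(\<Sum>k=1..N. cis (of_int s * tau N * real k)) = 0"
proof -
  have "(\<Sum>k=1..N. cis (of_int s * tau N * real k)) = (\<Sum>i<N. cis (of_int s * tau N) * cis (of_int s * tau N) ^ i)"
    by (rule sum.reindex_bij_witness[of _ "\<lambda>i. Suc i" "\<lambda>k. k - 1"])
       (auto simp only: Complex.DeMoivre cis_mult, auto simp: algebra_simps of_nat_diff)
  also have "\<dots> = 0" unfolding sum_distrib_left[symmetric] cis_power_sum_zero[OF assms] by simp
  finally show ?thesis .
qed

lemma cis_interval_sum:
  assumes N: "N > 0" and d: "\<not> int N dvd d"
  shows "(\<Sum>l\<in>{M..<M + int N}. cis (of_int (l * d) * tau N)) = 0"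
proof -
  have "(\<Sum>l\<in>{M..<M + int N}. cis (of_int (l * d) * tau N))
      = (\<Sum>i<N. cis (of_int (M * d) * tau N) * cis (of_int d * tau N) ^ i)"
    by (rule sum.reindex_bij_witness[of _ "\<lambda>i. M + int i" "\<lambda>l. nat (l - M)"])
       (auto simp only: Complex.DeMoivre cis_mult, auto simp: algebra_simps of_nat_diff)
  also have "\<dots> = 0" unfolding sum_distrib_left[symmetric] cis_power_sum_zero[OF assms] by simp
  finally show ?thesis .
qed

section \<open>The Fejer kernel and Bessel's inequality\<close>

lemma fejer_nonneg: "fejer N t \<ge> 0"
  by (simp add: fejer_def)

lemma fejer_0: "N > 0 \<Longrightarrow> fejer N 0 = real N / (2 * pi)"
  by (simp add: fejer_def power2_eq_square)

lemma fejer_double_sum: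
  assumes "N > 0"
  shows "(\<Sum>k=1..N. \<Sum>m=1..N. cis (t * (real k - real m))) = of_real (2 * pi * real N * fejer N t)"
proof -
  let ?s = "\<Sum>k=1..N. cis (t * real k)"
  have "(\<Sum>k=1..N. \<Sum>m=1..N. cis (t * (real k - real m))) = (\<Sum>k=1..N. \<Sum>m=1..N. cis (t * real k) * cnj (cis (t * real m)))"
    by (intro sum.cong refl) (simp add: cis_cnj cis_mult algebra_simps)
  also have "\<dots> = ?s * cnj ?s" by (simp add: sum_product)
  also have "\<dots> = of_real ((cmod ?s)\<^sup>2)" by (rule complex_norm_square[symmetric])
  finally show ?thesis using assms by (simp add: fejer_def)
qed

text \<open>Contains all frequencies at which the profile is nonzero at scale \<open>N\<close>. Its
  members are distinct modulo \<open>N\<close>, which gives orthogonality of the characters, and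
  none is 0 modulo \<open>N\<close>, which gives the vanishing row sums.\<close>

definition freq :: "nat \<Rightarrow> int set" where
  "freq N = {l. l \<noteq> 0 \<and> 2 * \<bar>l\<bar> < int N}"

lemma finite_freq [simp]: "finite (freq N)"
  by (rule finite_subset[of _ "{- int N..int N}"]) (auto simp: freq_def)

lemma card_freq_le: "card (freq N) \<le> N"
proof -
  have "freq N \<subseteq> {- (int N div 2)..<- (int N div 2) + int N}" by (auto simp: freq_def)
  then have "card (freq N) \<le> card {- (int N div 2)..<- (int N div 2) + int N}" by (intro card_mono) auto
  then show ?thesis by simp
qed

text \<open>Each term is the squared modulus of a Fourier coefficient of \<open>y\<close>, so
  completing the frequencies to a full period only increases the sum; over a full period the
  characters are orthogonal and equality holds.\<close>

lemma bessel:
  assumes N: "N > 0"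
  shows "(\<Sum>l\<in>freq N. quad_form {1..N} (\<lambda>k m. cos (of_int l * tau N * real k - of_int l * tau N * real m)) y)
    \<le> real N * (\<Sum>k\<in>{1..N}. (y k)\<^sup>2)"
proof -
  let ?J = "{- (int N div 2)..<- (int N div 2) + int N}"
  let ?q = "\<lambda>l. quad_form {1..N} (\<lambda>k m. cos (of_int l * tau N * real k - of_int l * tau N * real m)) y"
  have q0: "0 \<le> ?q l" for l by (rule quad_form_cos_nonneg)
  have "(\<Sum>l\<in>freq N. ?q l) \<le> (\<Sum>l\<in>?J. ?q l)"
    by (rule sum_mono2) (use q0 in \<open>auto simp: freq_def\<close>)
  also have "\<dots> = (\<Sum>k\<in>{1..N}. \<Sum>m\<in>{1..N}. (\<Sum>l\<in>?J. cos (of_int l * tau N * real k - of_int l * tau N * real m)) * (y k * y m))"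
    unfolding quad_form_def sum_distrib_right
    by (subst sum.swap) (intro sum.cong refl sum.swap)
  also have "\<dots> = (\<Sum>k\<in>{1..N}. \<Sum>m\<in>{1..N}. if k = m then real N * (y k)\<^sup>2 else 0)"
  proof (intro sum.cong refl)
    fix k m assume km: "k \<in> {1..N}" "m \<in> {1..N}"
    show "(\<Sum>l\<in>?J. cos (of_int l * tau N * real k - of_int l * tau N * real m)) * (y k * y m) = (if k = m then real N * (y k)\<^sup>2 else 0)"
    proof (cases "k = m")
      case True
      then show ?thesis by (simp add: power2_eq_square)
    next
      case False
      have nd: "\<not> int N dvd (int k - int m)"
      proof
        assume "int N dvd (int k - int m)"
        moreover have "int k - int m \<noteq> 0" "\<bar>int k - int m\<bar> < int N" using False km by auto
        ultimately show False using dvd_imp_le_int[of "int k - int m" "int N"] by linarith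
      qed
      have "(\<Sum>l\<in>?J. cos (of_int l * tau N * real k - of_int l * tau N * real m)) = Re (\<Sum>l\<in>?J. cis (of_int (l * (int k - int m)) * tau N))"
        by (simp add: algebra_simps)
      also have "\<dots> = 0" unfolding cis_interval_sum[OF N nd] by simp
      finally show ?thesis using False by simp
    qed
  qed
  also have "\<dots> = real N * (\<Sum>k\<in>{1..N}. (y k)\<^sup>2)" by (simp add: sum_distrib_left)
  finally show ?thesis .
qed

section \<open>Correlations with a bounded spectral density\<close>

text \<open>\<open>p\<close> is the normalized spectral measure of a real stationary sequence on the
  integers modulo \<open>N\<close>; evenness makes its correlations real.\<close>

locale spectral_weights =
  fixes N :: nat and p :: "int \<Rightarrow> real"
  assumes N_pos: "N > 0" and p_nonneg: "\<And>l. p l \<ge> 0" and p_even: "\<And>l. p (- l) = p l"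
    and p_sum: "(\<Sum>l\<in>freq N. p l) = 1"
begin

definition corr :: "nat \<Rightarrow> nat \<Rightarrow> real" where
  "corr k m = (\<Sum>l\<in>freq N. p l * cos (of_int l * tau N * real k - of_int l * tau N * real m))"

lemma corr_sym: "corr k m = corr m k"
  unfolding corr_def
proof (intro sum.cong refl)
  fix l :: int
  show "p l * cos (of_int l * tau N * real k - of_int l * tau N * real m)
      = p l * cos (of_int l * tau N * real m - of_int l * tau N * real k)"
    by (subst cos_minus[symmetric]) simp
qed

lemma corr_diag: "corr k k = 1"
  by (simp add: corr_def p_sum)

lemma corr_complex: "complex_of_real (corr k m) = (\<Sum>l\<in>freq N. of_real (p l) * cis (of_int l * tau N * (real k - real m)))"
proof -
  let ?z = "\<Sum>l\<in>freq N. of_real (p l) * cis (of_int l * tau N * (real k - real m))"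
  have "cnj ?z = (\<Sum>l\<in>freq N. of_real (p (- l)) * cis (of_int (- l) * tau N * (real k - real m)))"
    by (simp add: p_even cis_cnj)
  also have "\<dots> = ?z"
    by (rule sum.reindex_bij_witness[of _ uminus uminus]) (auto simp: freq_def)
  finally have cz: "cnj ?z = ?z" .
  have "Im (cnj ?z) = - Im ?z" by (rule cnj.sel)
  then have "Im ?z = 0" unfolding cz by linarith
  moreover have "Re ?z = corr k m" by (simp add: corr_def algebra_simps)
  ultimately show ?thesis by (simp add: complex_eq_iff)
qed

lemma corr_zero_sum: "(\<Sum>m\<in>{1..N}. corr k m) = 0"
proof -
  have nd: "\<not> int N dvd - l" if "l \<in> freq N" for l
    using that dvd_imp_le_int[of l "int N"] by (auto simp: freq_def)
  have "complex_of_real (\<Sum>m\<in>{1..N}. corr k m)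
     = (\<Sum>m\<in>{1..N}. \<Sum>l\<in>freq N. of_real (p l) * cis (of_int l * tau N * real k) * cis (of_int (- l) * tau N * real m))"
    unfolding of_real_sum corr_complex by (intro sum.cong refl) (simp add: mult.assoc cis_mult algebra_simps)
  also have "\<dots> = (\<Sum>l\<in>freq N. of_real (p l) * cis (of_int l * tau N * real k) * (\<Sum>m\<in>{1..N}. cis (of_int (- l) * tau N * real m)))"
    by (subst sum.swap) (simp add: sum_distrib_left)
  also have "\<dots> = 0" using cis_sum_zero[OF N_pos nd] by (intro sum.neutral) simp
  finally show ?thesis by (simp only: of_real_eq_0_iff)
qed

text \<open>The bound on \<open>p\<close> says that the spectral density is bounded. For
  \<open>r = 1\<close> the claim is Bessel's inequality; each further factor is a Schur product with
  a correlation matrix, so \<open>K\<close> does not grow with \<open>r\<close>.\<close>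

lemma corr_bounded_form:
  assumes p_le: "\<And>l. l \<in> freq N \<Longrightarrow> p l \<le> K / real N" and r: "1 \<le> r" and K: "K \<ge> 0"
  shows "bounded_form {1..N} K (\<lambda>k m. corr k m ^ r)"
  using r
proof (induction r rule: dec_induct)
  case base
  show ?case unfolding bounded_form_def
  proof (intro allI conjI)
    fix y
    let ?q = "\<lambda>l. quad_form {1..N} (\<lambda>k m. cos (of_int l * tau N * real k - of_int l * tau N * real m)) y"
    have eq: "quad_form {1..N} (\<lambda>k m. corr k m ^ 1) y = (\<Sum>l\<in>freq N. p l * ?q l)"
    proof -
      have "quad_form {1..N} (\<lambda>k m. corr k m ^ 1) y = (\<Sum>k\<in>{1..N}. \<Sum>m\<in>{1..N}. \<Sum>l\<in>freq N. p l * (cos (of_int l * tau N * real k - of_int l * tau N * real m) * (y k * y m)))"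
        unfolding quad_form_def corr_def by (intro sum.cong refl) (simp add: sum_distrib_right sum_distrib_left mult_ac)
      also have "\<dots> = (\<Sum>l\<in>freq N. \<Sum>k\<in>{1..N}. \<Sum>m\<in>{1..N}. p l * (cos (of_int l * tau N * real k - of_int l * tau N * real m) * (y k * y m)))"
        by (subst sum.swap[of _ "freq N"]) (intro sum.cong refl sum.swap)
      finally show ?thesis by (simp add: quad_form_def sum_distrib_left)
    qed
    have q0: "0 \<le> ?q l" for l by (rule quad_form_cos_nonneg)
    show "0 \<le> quad_form {1..N} (\<lambda>k m. corr k m ^ 1) y"
      unfolding eq using p_nonneg q0 by (intro sum_nonneg mult_nonneg_nonneg) auto
    have "quad_form {1..N} (\<lambda>k m. corr k m ^ 1) y \<le> (\<Sum>l\<in>freq N. K / real N * ?q l)"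
      unfolding eq using p_le q0 by (intro sum_mono mult_right_mono) auto
    also have "\<dots> = K / real N * (\<Sum>l\<in>freq N. ?q l)" by (simp only: sum_distrib_left)
    also have "\<dots> \<le> K / real N * (real N * (\<Sum>k\<in>{1..N}. (y k)\<^sup>2))"
      using K by (intro mult_left_mono bessel N_pos) auto
    finally show "quad_form {1..N} (\<lambda>k m. corr k m ^ 1) y \<le> K * (\<Sum>k\<in>{1..N}. (y k)\<^sup>2)" using N_pos by simp
  qed
next
  case (step r)
  have "(\<lambda>k m. corr k m ^ Suc r) = (\<lambda>k m. corr k m ^ r * (\<Sum>l\<in>freq N. p l * cos (of_int l * tau N * real k - of_int l * tau N * real m)))"
    unfolding corr_def[symmetric] by (simp add: mult.commute)
  then show ?case using bounded_form_schur[OF step.IH p_nonneg p_sum, of "\<lambda>l k. of_int l * tau N * real k"] by simp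
qed

lemma corr_operator:
  assumes p_le: "\<And>l. l \<in> freq N \<Longrightarrow> p l \<le> K / real N" and r: "1 \<le> r" and K: "K > 0"
  shows "(\<Sum>k\<in>{1..N}. (\<Sum>m\<in>{1..N}. corr k m ^ r * y m)\<^sup>2) \<le> K\<^sup>2 * (\<Sum>m\<in>{1..N}. (y m)\<^sup>2)"
  by (rule bounded_form_operator[OF corr_bounded_form[OF p_le r less_imp_le[OF K]]]) (simp_all add: corr_sym K)

text \<open>The twist by a frequency \<open>s\<close> is there for the recursion: one factor
  \<open>corr\<close>, expanded into characters, is traded for a shift of \<open>s\<close>. When no
  factor is left, the Fejer kernel appears; at \<open>s = 0\<close> one has the power sum of the
  correlations.\<close>

definition modulated_sum :: "nat \<Rightarrow> int \<Rightarrow> complex" where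
  "modulated_sum r s = (\<Sum>k\<in>{1..N}. \<Sum>m\<in>{1..N}. of_real (corr k m) ^ r * cis (of_int s * tau N * (real k - real m)))"

lemma modulated_sum_0: "modulated_sum 0 s = of_real (2 * pi * real N * fejer N (of_int s * tau N))"
  using fejer_double_sum[OF N_pos] by (simp add: modulated_sum_def)

lemma modulated_sum_Suc: "modulated_sum (Suc r) s = (\<Sum>l\<in>freq N. of_real (p l) * modulated_sum r (s + l))"
proof -
  have "modulated_sum (Suc r) s = (\<Sum>k\<in>{1..N}. \<Sum>m\<in>{1..N}. \<Sum>l\<in>freq N. of_real (p l) * (of_real (corr k m) ^ r * cis (of_int (s + l) * tau N * (real k - real m))))"
    unfolding modulated_sum_def power_Suc
  proof (intro sum.cong refl)
    fix k m
    let ?c = "complex_of_real (corr k m)"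
    have "cis (of_int (s + l) * tau N * (real k - real m)) = cis (of_int l * tau N * (real k - real m)) * cis (of_int s * tau N * (real k - real m))" for l
      by (simp add: cis_mult distrib_right add.commute)
    then have "(\<Sum>l\<in>freq N. of_real (p l) * (?c ^ r * cis (of_int (s + l) * tau N * (real k - real m))))
        = (\<Sum>l\<in>freq N. of_real (p l) * cis (of_int l * tau N * (real k - real m)) * (?c ^ r * cis (of_int s * tau N * (real k - real m))))"
      by (simp only: mult_ac)
    also have "\<dots> = ?c * (?c ^ r * cis (of_int s * tau N * (real k - real m)))"
      by (simp only: sum_distrib_right[symmetric] corr_complex[symmetric])
    finally show "?c * ?c ^ r * cis (of_int s * tau N * (real k - real m)) = (\<Sum>l\<in>freq N. of_real (p l) * (?c ^ r * cis (of_int (s + l) * tau N * (real k - real m))))"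
      by (simp only: mult.assoc)
  qed
  also have "\<dots> = (\<Sum>l\<in>freq N. \<Sum>k\<in>{1..N}. \<Sum>m\<in>{1..N}. of_real (p l) * (of_real (corr k m) ^ r * cis (of_int (s + l) * tau N * (real k - real m))))"
    by (subst sum.swap[of _ "freq N"]) (intro sum.cong refl sum.swap)
  finally show ?thesis by (simp add: modulated_sum_def sum_distrib_left)
qed

text \<open>The bridge between the normalizing constants, which are sums over frequencies, and the
  power sums of correlations that integration by parts produces.\<close>

lemma corr_power_sum:
  "(\<Sum>k\<in>{1..N}. \<Sum>m\<in>{1..N}. corr k m ^ 2)
    = 2 * pi * real N * (\<Sum>l1\<in>freq N. \<Sum>l2\<in>freq N. p l1 * p l2 * fejer N (of_int (l1 + l2) * tau N))" (is ?two)
  "(\<Sum>k\<in>{1..N}. \<Sum>m\<in>{1..N}. corr k m ^ 3)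
    = 2 * pi * real N * (\<Sum>l1\<in>freq N. \<Sum>l2\<in>freq N. \<Sum>l3\<in>freq N. p l1 * p l2 * p l3 * fejer N (of_int (l1 + l2 + l3) * tau N))" (is ?three)
  "(\<Sum>k\<in>{1..N}. \<Sum>m\<in>{1..N}. corr k m ^ 4)
    = 2 * pi * real N * (\<Sum>l1\<in>freq N. \<Sum>l2\<in>freq N. \<Sum>l3\<in>freq N. \<Sum>l4\<in>freq N. p l1 * p l2 * p l3 * p l4 * fejer N (of_int (l1 + l2 + l3 + l4) * tau N))" (is ?four)
proof -
  have M: "complex_of_real (\<Sum>k\<in>{1..N}. \<Sum>m\<in>{1..N}. corr k m ^ r) = modulated_sum r 0" for r
    by (simp add: modulated_sum_def)
  have "complex_of_real (\<Sum>k\<in>{1..N}. \<Sum>m\<in>{1..N}. corr k m ^ 2) = of_real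
    (\<Sum>l1\<in>freq N. p l1 * (\<Sum>l2\<in>freq N. p l2 * (2 * pi * real N * fejer N (of_int (0 + l1 + l2) * tau N))))"
    unfolding M numeral_2_eq_2 modulated_sum_Suc modulated_sum_0 by simp
  then show ?two
    unfolding of_real_eq_iff by (simp only: add_0_left) (simp add: sum_distrib_left mult_ac)
  have "complex_of_real (\<Sum>k\<in>{1..N}. \<Sum>m\<in>{1..N}. corr k m ^ 3) = of_real
    (\<Sum>l1\<in>freq N. p l1 * (\<Sum>l2\<in>freq N. p l2 * (\<Sum>l3\<in>freq N. p l3 * (2 * pi * real N * fejer N (of_int (0 + l1 + l2 + l3) * tau N)))))"
    unfolding M numeral_3_eq_3 modulated_sum_Suc modulated_sum_0 by simp
  then show ?three
    unfolding of_real_eq_iff by (simp only: add_0_left) (simp add: sum_distrib_left mult_ac)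
  have four: "4 = Suc (Suc (Suc (Suc 0)))" by simp
  have "complex_of_real (\<Sum>k\<in>{1..N}. \<Sum>m\<in>{1..N}. corr k m ^ 4) = of_real
    (\<Sum>l1\<in>freq N. p l1 * (\<Sum>l2\<in>freq N. p l2 * (\<Sum>l3\<in>freq N. p l3 * (\<Sum>l4\<in>freq N. p l4 * (2 * pi * real N * fejer N (of_int (0 + l1 + l2 + l3 + l4) * tau N))))))"
    unfolding M four modulated_sum_Suc modulated_sum_0 by simp
  then show ?four
    unfolding of_real_eq_iff by (simp only: add_0_left) (simp add: sum_distrib_left mult_ac)
qed

end

section \<open>The spectral density of the wavelet coefficients\<close>

lemma smooth_continuous: "smooth f \<Longrightarrow> continuous_on UNIV f"
proof -
  assume "smooth f"
  then have "(deriv ^^ 0) f differentiable (at x)" for x unfolding smooth_def by blast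
  then show ?thesis
    by (intro continuous_at_imp_continuous_on ballI differentiable_imp_continuous_within) simp
qed

context
  fixes \<phi> a :: "real \<Rightarrow> real"
  assumes profile: "wavelet_profile \<phi> a"
begin

lemma profile_square: "(a \<xi>)\<^sup>2 = \<phi> (\<xi> / 2) - \<phi> \<xi>"
  and phi_range: "0 \<le> \<phi> \<xi>" "\<phi> \<xi> \<le> 1" and phi_even: "\<phi> (- \<xi>) = \<phi> \<xi>"
  and phi_outside: "\<bar>\<xi>\<bar> > 1 \<Longrightarrow> \<phi> \<xi> = 0" and phi_inside: "\<bar>\<xi>\<bar> \<le> 1/2 \<Longrightarrow> \<phi> \<xi> = 1"
  and phi_continuous: "continuous_on UNIV \<phi>" and profile_continuous: "continuous_on UNIV a"
  using profile smooth_continuous unfolding wavelet_profile_def by auto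

text \<open>The support condition speaks of \<open>|\<xi>| > 1\<close> only; continuity yields the
  endpoint. It matters at the frequencies with \<open>2 |l| = N\<close>, where
  \<open>4 l / N\<close> has modulus exactly 2.\<close>

lemma phi_one: "\<phi> 1 = 0"
proof -
  have "(\<lambda>n. 1 + 1 / real (Suc n)) \<longlonglongrightarrow> 1 + 0"
    by (intro tendsto_intros LIMSEQ_Suc lim_1_over_n)
  then have "(\<lambda>n. \<phi> (1 + 1 / real (Suc n))) \<longlonglongrightarrow> \<phi> 1"
    using phi_continuous by (intro continuous_on_tendsto_compose[of UNIV \<phi>]) auto
  moreover have "\<phi> (1 + 1 / real (Suc n)) = 0" for n by (rule phi_outside) (auto simp: add_pos_pos)
  ultimately show ?thesis by (simp add: LIMSEQ_const_iff)
qed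

lemma profile_zero: assumes "\<bar>\<xi>\<bar> \<le> 1/2 \<or> \<bar>\<xi>\<bar> \<ge> 2" shows "a \<xi> = 0"
proof -
  have "\<phi> x = 0" if "\<bar>x\<bar> \<ge> 1" for x
  proof (cases "\<bar>x\<bar> = 1")
    case True
    then have "x = 1 \<or> x = - 1" by auto
    then show ?thesis using phi_one phi_even[of 1] by auto
  qed (use that phi_outside in auto)
  then have "(a \<xi>)\<^sup>2 = 0" using assms unfolding profile_square by (auto simp: phi_inside)
  then show ?thesis by simp
qed

lemma profile_square_le: "(a \<xi>)\<^sup>2 \<le> 1"
  unfolding profile_square using phi_range[of "\<xi> / 2"] phi_range[of \<xi>] by linarith

text \<open>
  On \<open>[1/2, 1]\<close> one has \<open>a(\<xi>)\<^sup>2 + a(2\<xi>)\<^sup>2 = 1\<close>, so \<open>a\<close> does not vanish at both frequencies of some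
  pair \<open>\<xi>\<close>, \<open>2\<xi>\<close>; such a pair makes the resonance \<open>\<xi> + \<xi> - 2\<xi> = 0\<close> contribute to the skewness.
\<close>

lemma profile_resonance:
  obtains \<xi> \<delta> where "\<xi> > 1/2" "\<delta> > 0" "\<delta> \<le> 1/4"
    "\<And>x. \<bar>x - \<xi>\<bar> < \<delta> \<Longrightarrow> (a x)\<^sup>2 \<ge> 1/4" "\<And>x. \<bar>x - 2 * \<xi>\<bar> < 2 * \<delta> \<Longrightarrow> (a x)\<^sup>2 \<ge> 1/4"
proof -
  \<comment> \<open>At a point with \<open>\<phi> \<xi> = 1/2\<close> both squares equal 1/2: they
    are \<open>1 - \<phi> \<xi>\<close> and \<open>\<phi> \<xi> - 0\<close>.\<close>
  have "\<exists>x\<ge>1/2. x \<le> 1 \<and> \<phi> x = 1/2"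
    using phi_inside[of "1/2"] phi_one continuous_on_subset[OF phi_continuous] by (intro IVT2') auto
  then obtain \<xi> where \<xi>: "1/2 \<le> \<xi>" "\<xi> \<le> 1" "\<phi> \<xi> = 1/2" by blast
  have "\<xi> \<noteq> 1/2"
  proof
    assume eq: "\<xi> = 1/2"
    show False using \<xi>(3) phi_inside[of "1/2"] unfolding eq by simp
  qed
  then have \<xi>': "\<xi> > 1/2" using \<xi>(1) by simp
  have "(a \<xi>)\<^sup>2 = 1/2" "(a (2 * \<xi>))\<^sup>2 = 1/2"
    unfolding profile_square using \<xi> \<xi>' by (simp_all add: phi_inside phi_outside)
  note v = this
  have cont: "isCont (\<lambda>x. (a x)\<^sup>2) y" for y
    using profile_continuous by (simp add: continuous_on_eq_continuous_at continuous_intros)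
  have near: "\<exists>d>0. \<forall>x. \<bar>x - y\<bar> < d \<longrightarrow> (a x)\<^sup>2 \<ge> 1/4" if "(a y)\<^sup>2 = 1/2" for y
  proof -
    obtain d where d: "d > 0" "\<And>x. dist x y < d \<Longrightarrow> dist ((a x)\<^sup>2) ((a y)\<^sup>2) < 1/4"
      using cont[of y] unfolding continuous_at_eps_delta dist_real_def
      by (metis divide_pos_pos zero_less_numeral zero_less_one)
    have "(a x)\<^sup>2 \<ge> 1/4" if "\<bar>x - y\<bar> < d" for x
      using d(2)[of x] that \<open>(a y)\<^sup>2 = 1/2\<close> unfolding dist_real_def by linarith
    then show ?thesis using d(1) by blast
  qed
  obtain d1 where d1: "d1 > 0" "\<And>x. \<bar>x - \<xi>\<bar> < d1 \<Longrightarrow> (a x)\<^sup>2 \<ge> 1/4" using near[OF v(1)] by blast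
  obtain d2 where d2: "d2 > 0" "\<And>x. \<bar>x - 2 * \<xi>\<bar> < d2 \<Longrightarrow> (a x)\<^sup>2 \<ge> 1/4" using near[OF v(2)] by blast
  \<comment> \<open>The second interval has radius \<open>2 * \<delta>\<close>, hence
    \<open>d2 / 2\<close>; the cap 1/4 keeps the frequencies near \<open>\<xi>\<close>
    positive.\<close>
  show thesis
    by (rule that[of \<xi> "min (1/4) (min d1 (d2 / 2))"]) (use \<xi>' d1 d2 in auto)
qed

lemma Ca2_outside: "l \<notin> freq N \<Longrightarrow> Ca2 C a N l = 0"
proof -
  assume "l \<notin> freq N"
  then have "l = 0 \<or> N = 0 \<or> \<bar>4 * real_of_int l / real N\<bar> \<ge> 2"
    by (auto simp: freq_def le_divide_eq)
  then have "a (4 * of_int l / real N) = 0" by (auto intro!: profile_zero)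
  then show ?thesis by (simp add: Ca2_def)
qed

lemma card_int_ball:
  assumes "r \<ge> 2" shows "r / 2 \<le> real (card {l::int. \<bar>of_int l - x\<bar> < r})" and "finite {l::int. \<bar>of_int l - x\<bar> < r}"
proof -
  have "{l::int. \<bar>of_int l - x\<bar> < r} \<subseteq> {\<lfloor>x - r\<rfloor>..\<lceil>x + r\<rceil>}"
    by (auto simp: floor_le_iff le_ceiling_iff)
  then show fin: "finite {l::int. \<bar>of_int l - x\<bar> < r}" by (rule finite_subset) simp
  have "{\<lceil>x\<rceil>..<\<lceil>x\<rceil> + \<lfloor>r\<rfloor>} \<subseteq> {l::int. \<bar>of_int l - x\<bar> < r}"
  proof
    fix l assume "l \<in> {\<lceil>x\<rceil>..<\<lceil>x\<rceil> + \<lfloor>r\<rfloor>}"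
    then have "\<lceil>x\<rceil> \<le> l" "l + 1 \<le> \<lceil>x\<rceil> + \<lfloor>r\<rfloor>" by auto
    then have "x \<le> of_int l" "of_int l + 1 \<le> of_int \<lceil>x\<rceil> + (of_int \<lfloor>r\<rfloor> :: real)" by linarith+
    then show "l \<in> {l::int. \<bar>of_int l - x\<bar> < r}" using assms by (simp add: abs_less_iff) linarith
  qed
  then have "card {\<lceil>x\<rceil>..<\<lceil>x\<rceil> + \<lfloor>r\<rfloor>} \<le> card {l::int. \<bar>of_int l - x\<bar> < r}" using fin by (intro card_mono)
  then have "nat \<lfloor>r\<rfloor> \<le> card {l::int. \<bar>of_int l - x\<bar> < r}" by simp
  then show "r / 2 \<le> real (card {l::int. \<bar>of_int l - x\<bar> < r})" using assms by linarith
qed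

text \<open>Where the profile is nonzero, \<open>|l|\<close> lies between \<open>N/8\<close> and
  \<open>N/2\<close>, so \<open>C l\<close> is comparable to \<open>N powr (- \<alpha>)\<close>.
  This factor cancels in the normalized weights: they are at most of order \<open>1 / N\<close>, and
  of exactly this order where the profile is bounded below.\<close>

lemma spectral_estimates:
  assumes c: "0 < c1" "c1 \<le> c2" and \<alpha>: "\<alpha> > 0" and even: "\<And>l. C (- l) = C l"
    and C: "\<And>l. l \<ge> 1 \<Longrightarrow> c1 * of_int l powr (- \<alpha>) \<le> C l" "\<And>l. l \<ge> 1 \<Longrightarrow> C l \<le> c2 * of_int l powr (- \<alpha>)"
  obtains K c N0 where "K > 0" "c > 0" "N0 > 0"
    "\<And>N. N \<ge> N0 \<Longrightarrow> (\<Sum>l\<in>freq N. Ca2 C a N l) > 0"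
    "\<And>N l. N \<ge> N0 \<Longrightarrow> Ca2 C a N l / (\<Sum>l\<in>freq N. Ca2 C a N l) \<le> K / real N"
    "\<And>N. N \<ge> N0 \<Longrightarrow> c \<le> (\<Sum>l1\<in>freq N. \<Sum>l2\<in>freq N. \<Sum>l3\<in>freq N.
       Ca2 C a N l1 / (\<Sum>l\<in>freq N. Ca2 C a N l) * (Ca2 C a N l2 / (\<Sum>l\<in>freq N. Ca2 C a N l)) * (Ca2 C a N l3 / (\<Sum>l\<in>freq N. Ca2 C a N l))
       * fejer N (of_int (l1 + l2 + l3) * tau N))"
proof -
  obtain \<xi> \<delta> where \<xi>: "\<xi> > 1/2" and \<delta>: "\<delta> > 0" "\<delta> \<le> 1/4"
    and near: "\<And>x. \<bar>x - \<xi>\<bar> < \<delta> \<Longrightarrow> (a x)\<^sup>2 \<ge> 1/4" "\<And>x. \<bar>x - 2 * \<xi>\<bar> < 2 * \<delta> \<Longrightarrow> (a x)\<^sup>2 \<ge> 1/4"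
    using profile_resonance by blast
  \<comment> \<open>The ratio of \<open>c1 / 4 * (N/2) powr (- \<alpha>)\<close>, the least size of
    \<open>Ca2\<close> where the squared profile is at least 1/4, to its largest size
    \<open>c2 * (N/8) powr (- \<alpha>)\<close>.\<close>
  define \<kappa> where "\<kappa> = c1 * 2 powr \<alpha> / (4 * c2 * 8 powr \<alpha>)"
  \<comment> \<open>From \<open>Ca2 <= hi = lo / \<kappa>\<close> and the lower bound
    \<open>N * \<delta> / 8 * lo\<close> for the total weight.\<close>
  define K where "K = 8 / (\<delta> * \<kappa>)"
  \<comment> \<open>At least \<open>(N * \<delta> / 8)^2\<close> pairs, three weights of size
    \<open>\<kappa> / N\<close>, and the value \<open>N / (2 * pi)\<close> of the Fejer kernel at
    0.\<close>
  define c where "c = \<delta>\<^sup>2 * \<kappa> ^ 3 / (128 * pi)"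
  \<comment> \<open>Ensures \<open>N * \<delta> / 4 >= 2\<close>, as the count of integers in an
    interval requires.\<close>
  define N0 where "N0 = nat \<lceil>8 / \<delta>\<rceil>"
  have \<kappa>: "\<kappa> > 0" using c by (simp add: \<kappa>_def)
  have pos: "K > 0" "c > 0" "N0 > 0" using \<kappa> \<delta> by (simp_all add: K_def c_def N0_def)
  have main: "V > 0 \<and> (\<forall>l. p l \<le> K / N) \<and> c \<le> (\<Sum>l1\<in>freq N. \<Sum>l2\<in>freq N. \<Sum>l3\<in>freq N. p l1 * p l2 * p l3 * fejer N (of_int (l1 + l2 + l3) * tau N))"
    if N: "N \<ge> N0" and V_def: "V = (\<Sum>l\<in>freq N. Ca2 C a N l)" and p_def: "p = (\<lambda>l. Ca2 C a N l / V)" for N V p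
  proof -
    have N8: "real N \<ge> 8 / \<delta>" using N unfolding N0_def by linarith
    have Npos: "N > 0" using N pos(3) by simp
    then have Nr: "real N > 0" by simp
    define lo where "lo = c1 / 4 * (2 powr \<alpha> * real N powr - \<alpha>)"
    define hi where "hi = c2 * (8 powr \<alpha> * real N powr - \<alpha>)"
    have lohi: "lo > 0" "hi > 0" "lo = \<kappa> * hi"
      using c Nr by (simp_all add: lo_def hi_def \<kappa>_def field_simps)
    have pw: "(real N / 2) powr - \<alpha> = 2 powr \<alpha> * real N powr - \<alpha>" "(real N / 8) powr - \<alpha> = 8 powr \<alpha> * real N powr - \<alpha>"
      using Nr by (simp_all add: powr_divide powr_minus field_simps)
    have sym: "Ca2 C a N (- l) = Ca2 C a N l" for l
      using wavelet_profile_even[OF profile, of "4 * of_int l / real N"] by (simp add: Ca2_def even)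
    have upper_pos: "Ca2 C a N l \<le> hi" "0 \<le> Ca2 C a N l" if "l \<ge> 1" for l
    proof -
      have C0: "0 \<le> C l" using C(1)[OF that] c by (meson less_imp_le mult_nonneg_nonneg order_trans powr_ge_zero)
      then show "0 \<le> Ca2 C a N l" by (simp add: Ca2_def)
      show "Ca2 C a N l \<le> hi"
      proof (cases "4 * of_int l / real N \<le> 1/2")
        case True
        then have "a (4 * of_int l / real N) = 0" using that Nr by (intro profile_zero) simp
        then show ?thesis using lohi by (simp add: Ca2_def)
      next
        case False
        then have "real N / 8 \<le> of_int l" using Nr by (simp add: field_simps)
        then have "of_int l powr - \<alpha> \<le> (real N / 8) powr - \<alpha>" using \<alpha> Nr by (intro powr_mono2') auto
        then have "C l \<le> hi" using C(2)[OF that] c unfolding hi_def pw(2)[symmetric]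
          by (meson less_imp_le mult_left_mono order_trans)
        then have "C l * (a (4 * of_int l / real N))\<^sup>2 \<le> hi * 1"
          using C0 lohi profile_square_le by (intro mult_mono) auto
        then show ?thesis by (simp add: Ca2_def)
      qed
    qed
    have Ca2: "Ca2 C a N l \<le> hi" "0 \<le> Ca2 C a N l" for l
    proof -
      consider "l \<ge> 1" | "- l \<ge> 1" | "l = 0" by linarith
      then have "Ca2 C a N l \<le> hi \<and> 0 \<le> Ca2 C a N l"
      proof cases
        case 3
        then show ?thesis using lohi Ca2_outside[of l N C] by (simp add: freq_def)
      qed (use upper_pos[of l] upper_pos[of "- l"] sym[of l] in auto)
      then show "Ca2 C a N l \<le> hi" "0 \<le> Ca2 C a N l" by auto
    qed
    have lower: "lo \<le> Ca2 C a N l" if "(a (4 * of_int l / real N))\<^sup>2 \<ge> 1/4" "l > 0" for l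
    proof -
      have "l \<in> freq N" using that(1) Ca2_outside[of l N "\<lambda>_. 1"] by (cases "l \<in> freq N") (auto simp: Ca2_def)
      then have "of_int l \<le> real N / 2" by (auto simp: freq_def)
      then have "(real N / 2) powr - \<alpha> \<le> of_int l powr - \<alpha>" using \<alpha> that(2) by (intro powr_mono2') auto
      then have "c1 * (real N / 2) powr - \<alpha> \<le> c1 * of_int l powr - \<alpha>" using c by (intro mult_left_mono) auto
      also have "\<dots> \<le> C l" using that by (intro C) simp
      finally have C_lower: "c1 * (real N / 2) powr - \<alpha> \<le> C l" .
      moreover have "0 \<le> c1 * (real N / 2) powr - \<alpha>" using c by simp
      ultimately have "0 \<le> C l" by (rule order_trans[rotated])
      with C_lower have "(c1 * (real N / 2) powr - \<alpha>) * (1/4) \<le> C l * (a (4 * of_int l / real N))\<^sup>2"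
        using that c by (intro mult_mono) auto
      then show ?thesis unfolding lo_def pw(1)[symmetric] by (simp add: Ca2_def)
    qed
    \<comment> \<open>The \<open>l\<close> with \<open>4 * l / N\<close> within
      \<open>\<delta>\<close> of the resonant point \<open>\<xi>\<close>. Sums of two of them lie,
      after the same scaling, within \<open>2 * \<delta>\<close> of \<open>2 * \<xi>\<close>, so all
      three members of the triple \<open>l1\<close>, \<open>l2\<close>, \<open>- (l1 + l2)\<close>
      carry weight of full size.\<close>
    define B where "B = {l::int. \<bar>of_int l - real N * \<xi> / 4\<bar> < real N * \<delta> / 4}"
    have r2: "real N * \<delta> / 4 \<ge> 2" using N8 \<delta> by (simp add: field_simps)
    have cardB: "real N * \<delta> / 8 \<le> card B" and finB: "finite B"
      using card_int_ball[OF r2, of "real N * \<xi> / 4"] unfolding B_def by simp_all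
    have scale: "\<bar>4 * of_int l / real N - y\<bar> < d \<longleftrightarrow> \<bar>of_int l - real N * y / 4\<bar> < real N * d / 4" for l y d
    proof -
      have "4 * of_int l / real N - y = 4 / real N * (of_int l - real N * y / 4)" using Nr by (simp add: field_simps)
      moreover have "\<bar>4 / real N\<bar> = 4 / real N" by simp
      ultimately have "\<bar>4 * of_int l / real N - y\<bar> = 4 / real N * \<bar>of_int l - real N * y / 4\<bar>" by (simp only: abs_mult)
      then show ?thesis using Nr by (simp add: field_simps)
    qed
    have B_pos: "l > 0" if "l \<in> B" for l
    proof -
      have "\<bar>4 * of_int l / real N - \<xi>\<bar> < \<delta>" using that by (simp add: scale B_def)
      then have "4 * of_int l / real N > 0" using \<xi> \<delta> by linarith
      then show ?thesis using Nr by (simp add: zero_less_divide_iff)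
    qed
    have B_lower: "lo \<le> Ca2 C a N l" if "l \<in> B" for l
      by (rule lower[OF near(1) B_pos[OF that]]) (use that in \<open>simp add: scale B_def\<close>)
    have B_freq: "l \<in> freq N" if "l \<in> B" for l
      using B_lower[OF that] lohi(1) Ca2_outside[of l N C] by force
    have BB_lower: "lo \<le> Ca2 C a N (- (l1 + l2))" if "l1 \<in> B" "l2 \<in> B" for l1 l2
      unfolding sym
    proof (rule lower[OF near(2)])
      have "\<bar>of_int (l1 + l2) - real N * (2 * \<xi>) / 4\<bar> < real N * (2 * \<delta>) / 4"
      proof -
        have "real N * (2 * \<xi>) / 4 = real N * \<xi> / 4 + real N * \<xi> / 4"
          "real N * (2 * \<delta>) / 4 = real N * \<delta> / 4 + real N * \<delta> / 4" by simp_all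
        then show ?thesis using that unfolding B_def mem_Collect_eq of_int_add by linarith
      qed
      then show "\<bar>4 * of_int (l1 + l2) / real N - 2 * \<xi>\<bar> < 2 * \<delta>" unfolding scale .
      show "l1 + l2 > 0" by (intro add_pos_pos B_pos that)
    qed
    have BB_freq: "- (l1 + l2) \<in> freq N" if "l1 \<in> B" "l2 \<in> B" for l1 l2
      using BB_lower[OF that] lohi(1) Ca2_outside[of "- (l1 + l2)" N C] by force
    have V_lower: "real N * \<delta> / 8 * lo \<le> V"
    proof -
      have "real N * \<delta> / 8 * lo \<le> real (card B) * lo" using cardB lohi by (intro mult_right_mono) auto
      also have "\<dots> = (\<Sum>l\<in>B. lo)" by simp
      also have "\<dots> \<le> (\<Sum>l\<in>B. Ca2 C a N l)" using B_lower by (intro sum_mono)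
      also have "\<dots> \<le> V" unfolding V_def using B_freq Ca2 by (intro sum_mono2) auto
      finally show ?thesis .
    qed
    moreover have "0 < real N * \<delta> / 8 * lo" using Nr \<delta> lohi by simp
    ultimately have V: "V > 0" by linarith
    have V_upper: "V \<le> real N * hi"
    proof -
      have "V \<le> (\<Sum>l\<in>freq N. hi)" unfolding V_def using Ca2 by (intro sum_mono)
      also have "\<dots> \<le> real N * hi" using card_freq_le[of N] lohi by (simp add: mult_right_mono)
      finally show ?thesis .
    qed
    have p0: "p l \<ge> 0" for l using Ca2 V by (simp add: p_def)
    have "p l \<le> K / N" for l
    proof -
      have "Ca2 C a N l \<le> hi" by (rule Ca2)
      also have "hi = K / N * (real N * \<delta> / 8 * lo)"
        unfolding K_def lohi(3) using \<kappa> \<delta> Nr by (simp add: field_simps)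
      also have "\<dots> \<le> K / N * V" using pos V_lower by (intro mult_left_mono) auto
      finally show ?thesis using V by (simp add: p_def divide_le_eq)
    qed
    moreover have "c \<le> (\<Sum>l1\<in>freq N. \<Sum>l2\<in>freq N. \<Sum>l3\<in>freq N. p l1 * p l2 * p l3 * fejer N (of_int (l1 + l2 + l3) * tau N))"
    proof -
      have p_lower: "\<kappa> / N \<le> p l" if "lo \<le> Ca2 C a N l" for l
      proof -
        have "\<kappa> / N * V \<le> \<kappa> / N * (real N * hi)" using V_upper \<kappa> by (intro mult_left_mono) auto
        also have "\<dots> = lo" using Nr lohi(3) by simp
        finally show ?thesis using that V by (simp add: p_def le_divide_eq)
      qed
      let ?t = "\<lambda>l1 l2 l3. p l1 * p l2 * p l3 * fejer N (of_int (l1 + l2 + l3) * tau N)"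
      have t0: "0 \<le> ?t l1 l2 l3" for l1 l2 l3 by (intro mult_nonneg_nonneg p0 fejer_nonneg)
      have t_lower: "(\<kappa> / N) ^ 3 * (N / (2 * pi)) \<le> ?t l1 l2 (- (l1 + l2))" if "l1 \<in> B" "l2 \<in> B" for l1 l2
      proof -
        have "\<kappa> / N * (\<kappa> / N) * (\<kappa> / N) \<le> p l1 * p l2 * p (- (l1 + l2))"
          using \<kappa> p0 by (intro mult_mono p_lower B_lower BB_lower that mult_nonneg_nonneg) auto
        then have "\<kappa> / N * (\<kappa> / N) * (\<kappa> / N) * (N / (2 * pi)) \<le> p l1 * p l2 * p (- (l1 + l2)) * (N / (2 * pi))"
          by (intro mult_right_mono) auto
        then show ?thesis using fejer_0[OF Npos] by (simp add: power3_eq_cube)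
      qed
      have "c = (real N * \<delta> / 8) * ((real N * \<delta> / 8) * ((\<kappa> / N) ^ 3 * (N / (2 * pi))))"
        unfolding c_def using Nr by (simp add: field_simps power2_eq_square power3_eq_cube)
      also have "\<dots> \<le> card B * (card B * ((\<kappa> / N) ^ 3 * (N / (2 * pi))))"
        using cardB \<kappa> \<delta> Nr by (intro mult_mono mult_right_mono) auto
      also have "\<dots> = (\<Sum>l1\<in>B. \<Sum>l2\<in>B. (\<kappa> / N) ^ 3 * (N / (2 * pi)))" by simp
      also have "\<dots> \<le> (\<Sum>l1\<in>B. \<Sum>l2\<in>B. ?t l1 l2 (- (l1 + l2)))" by (intro sum_mono t_lower)
      also have "\<dots> \<le> (\<Sum>l1\<in>B. \<Sum>l2\<in>B. \<Sum>l3\<in>freq N. ?t l1 l2 l3)"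
        by (intro sum_mono member_le_sum BB_freq t0) auto
      also have "\<dots> \<le> (\<Sum>l1\<in>freq N. \<Sum>l2\<in>freq N. \<Sum>l3\<in>freq N. ?t l1 l2 l3)"
        by (intro order_trans[OF sum_mono[OF sum_mono2] sum_mono2] sum_nonneg t0) (use B_freq in auto)
      finally show ?thesis .
    qed
    ultimately show ?thesis using V by blast
  qed
  show thesis
    by (rule that[OF pos]) (use main[OF _ refl refl] in auto)
qed

end

section \<open>Wavelet coefficients of the random field\<close>

lemma cis_integral:
  "(\<integral>\<theta>. indicator {- pi..pi} \<theta> *\<^sub>R cis (of_int l * \<theta>) \<partial>lborel) = (if l = 0 then 2 * pi else 0)"
proof (cases "l = 0")
  case True
  then show ?thesis by (simp add: scaleR_conv_of_real)
next
  case False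
  have "(\<integral>\<theta>. indicator {- pi..pi} \<theta> *\<^sub>R cis (of_int l * \<theta>) \<partial>lborel)
      = cis (of_int l * pi) / (\<i> * of_int l) - cis (of_int l * (- pi)) / (\<i> * of_int l)"
  proof (rule integral_FTC_atLeastAtMost[of "- pi" pi "\<lambda>\<theta>. cis (of_int l * \<theta>) / (\<i> * of_int l)"])
    show "((\<lambda>\<theta>. cis (of_int l * \<theta>) / (\<i> * of_int l)) has_vector_derivative cis (of_int l * x)) (at x within {- pi..pi})" for x
      unfolding has_vector_derivative_def using False
      by (auto intro!: derivative_eq_intros simp: scaleR_conv_of_real mult_ac)
  qed (auto intro!: continuous_intros)
  also have "cis (of_int l * pi) = cis (of_int l * (- pi))"
    by (simp add: complex_eq_iff) (auto simp: sin_zero_iff_int2)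
  finally show ?thesis using False by simp
qed

lemma measurable_cnj [measurable]: "cnj \<in> borel_measurable borel"
  by (intro borel_measurable_continuous_onI continuous_intros)

section \<open>Mean-square control of the Fourier series\<close>

locale random_torus_field = prob_space M for M :: "'a measure" +
  fixes X :: "real \<Rightarrow> 'a \<Rightarrow> real" and w :: "int \<Rightarrow> 'a \<Rightarrow> complex" and C :: "int \<Rightarrow> real"
  assumes field: "torus_field M X w C"
begin

lemma X_joint: "(\<lambda>(t, \<omega>). X t \<omega>) \<in> borel_measurable (borel \<Otimes>\<^sub>M M)"
  and w_measurable [measurable]: "w l \<in> borel_measurable M"
  and w_conj: "AE \<omega> in M. w (- l) \<omega> = cnj (w l \<omega>)"
  and w_square: "integrable M (\<lambda>\<omega>. (cmod (w l \<omega>))\<^sup>2)" "expectation (\<lambda>\<omega>. (cmod (w l \<omega>))\<^sup>2) = C l"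
  and w_centered: "(\<integral>\<omega>. w l \<omega> \<partial>M) = 0"
  and w_orthogonal: "l \<noteq> l' \<Longrightarrow> (\<integral>\<omega>. w l \<omega> * cnj (w l' \<omega>) \<partial>M) = 0"
  and C_summable: "C summable_on UNIV"
  and series: "(\<lambda>n. \<integral>\<^sup>+\<omega>. ennreal ((cmod (complex_of_real (X t \<omega>) -
              (\<Sum>l\<in>{- int n..int n}. w l \<omega> * cis (of_int l * t))))\<^sup>2) \<partial>M) \<longlonglongrightarrow> 0"
  using field unfolding torus_field_def by blast+

lemma C_nonneg: "C l \<ge> 0"
  unfolding w_square(2)[symmetric] by (intro Bochner_Integration.integral_nonneg) simp

lemma C_even: "C (- l) = C l"
  unfolding w_square(2)[symmetric] by (rule integral_cong_AE) (use w_conj[of l] in auto)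

lemma w_integrable: "integrable M (w l)"
proof (rule Bochner_Integration.integrable_bound[where f = "\<lambda>\<omega>. 1 + (cmod (w l \<omega>))\<^sup>2"])
  have "x \<le> 1 + x\<^sup>2" if "x \<ge> 0" for x :: real
    using zero_le_power2[of "x - 1"] that unfolding power2_diff by simp
  then show "AE \<omega> in M. norm (w l \<omega>) \<le> norm (1 + (cmod (w l \<omega>))\<^sup>2)" by simp
qed (use w_square in auto)

lemma w_product_integrable: "integrable M (\<lambda>\<omega>. w l \<omega> * cnj (w l' \<omega>))"
proof (rule Bochner_Integration.integrable_bound[where f = "\<lambda>\<omega>. (cmod (w l \<omega>))\<^sup>2 + (cmod (w l' \<omega>))\<^sup>2"])
  have "x * y \<le> x\<^sup>2 + y\<^sup>2" for x y :: real
    using power_mult_le_sum[of x y 1] abs_ge_self[of "x * y"] by simp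
  then show "AE \<omega> in M. norm (w l \<omega> * cnj (w l' \<omega>)) \<le> norm ((cmod (w l \<omega>))\<^sup>2 + (cmod (w l' \<omega>))\<^sup>2)"
    by (simp add: norm_mult)
qed (use w_square in auto)

lemma w_covariance: "(\<integral>\<omega>. w l \<omega> * cnj (w l' \<omega>) \<partial>M) = (if l = l' then of_real (C l) else 0)"
proof (cases "l = l'")
  case True
  have "(\<integral>\<omega>. w l \<omega> * cnj (w l \<omega>) \<partial>M) = (\<integral>\<omega>. complex_of_real ((cmod (w l \<omega>))\<^sup>2) \<partial>M)"
    by (simp only: complex_norm_square)
  also have "\<dots> = of_real (C l)" unfolding integral_complex_of_real w_square(2) ..
  finally show ?thesis using True by simp
qed (simp add: w_orthogonal)

lemma linear_covariance:
  assumes "finite A"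
  shows "integrable M (\<lambda>\<omega>. (\<Sum>l\<in>A. u l * w l \<omega>) * cnj (\<Sum>l\<in>A. v l * w l \<omega>))"
    and "(\<integral>\<omega>. (\<Sum>l\<in>A. u l * w l \<omega>) * cnj (\<Sum>l\<in>A. v l * w l \<omega>) \<partial>M) = (\<Sum>l\<in>A. u l * cnj (v l) * of_real (C l))"
proof -
  have eq: "(\<Sum>l\<in>A. u l * w l \<omega>) * cnj (\<Sum>l\<in>A. v l * w l \<omega>)
     = (\<Sum>l\<in>A. \<Sum>l'\<in>A. u l * cnj (v l') * (w l \<omega> * cnj (w l' \<omega>)))" for \<omega>
    by (simp add: sum_product mult_ac)
  show "integrable M (\<lambda>\<omega>. (\<Sum>l\<in>A. u l * w l \<omega>) * cnj (\<Sum>l\<in>A. v l * w l \<omega>))"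
    unfolding eq by (intro Bochner_Integration.integrable_sum integrable_mult_right w_product_integrable)
  have "(\<integral>\<omega>. (\<Sum>l\<in>A. u l * w l \<omega>) * cnj (\<Sum>l\<in>A. v l * w l \<omega>) \<partial>M)
     = (\<Sum>l\<in>A. \<Sum>l'\<in>A. u l * cnj (v l') * (if l = l' then of_real (C l) else 0))"
    unfolding eq w_covariance[symmetric] using w_product_integrable by simp
  also have "\<dots> = (\<Sum>l\<in>A. \<Sum>l'\<in>A. if l = l' then u l * cnj (v l) * of_real (C l) else 0)"
    by (intro sum.cong refl) auto
  also have "\<dots> = (\<Sum>l\<in>A. u l * cnj (v l) * of_real (C l))" using assms by simp
  finally show "(\<integral>\<omega>. (\<Sum>l\<in>A. u l * w l \<omega>) * cnj (\<Sum>l\<in>A. v l * w l \<omega>) \<partial>M) = (\<Sum>l\<in>A. u l * cnj (v l) * of_real (C l))" .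
qed

definition partial :: "nat \<Rightarrow> real \<Rightarrow> 'a \<Rightarrow> complex" where
  "partial n t \<omega> = (\<Sum>l\<in>{- int n..int n}. w l \<omega> * cis (of_int l * t))"

definition tail :: "nat \<Rightarrow> real" where
  "tail n = infsum C UNIV - (\<Sum>l\<in>{- int n..int n}. C l)"

lemma tail_nonneg: "tail n \<ge> 0"
  unfolding tail_def using finite_sum_le_infsum[OF C_summable, of "{- int n..int n}"] C_nonneg by simp

lemma tail_tendsto: "tail \<longlonglongrightarrow> 0"
proof -
  have "filterlim (\<lambda>n. {- int n..int n}) (finite_subsets_at_top UNIV) sequentially"
    unfolding filterlim_finite_subsets_at_top
  proof (intro allI impI)
    fix F :: "int set" assume F: "finite F \<and> F \<subseteq> UNIV"
    define b where "b = Max (insert 0 (abs ` F))"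
    have b: "\<bar>l\<bar> \<le> b" if "l \<in> F" for l unfolding b_def using F that by (intro Max_ge) auto
    have "\<forall>\<^sub>F n in sequentially. nat b \<le> n" by (rule eventually_ge_at_top)
    then show "\<forall>\<^sub>F n in sequentially. finite {- int n..int n} \<and> F \<subseteq> {- int n..int n} \<and> {- int n..int n} \<subseteq> UNIV"
    proof eventually_elim
      case (elim n)
      have "l \<in> {- int n..int n}" if "l \<in> F" for l using b[OF that] elim by auto
      then show ?case by auto
    qed
  qed
  moreover have "(sum C \<longlongrightarrow> infsum C UNIV) (finite_subsets_at_top UNIV)"
    using has_sum_infsum[OF C_summable] unfolding has_sum_def .
  ultimately have "(\<lambda>n. \<Sum>l\<in>{- int n..int n}. C l) \<longlonglongrightarrow> infsum C UNIV"
    by (rule filterlim_compose[rotated])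
  from tendsto_diff[OF tendsto_const this, of "infsum C UNIV"] show ?thesis by (simp add: tail_def[abs_def])
qed

lemma partial_diff:
  assumes "n \<le> m"
  shows "(\<integral>\<^sup>+\<omega>. ennreal ((cmod (partial m t \<omega> - partial n t \<omega>))\<^sup>2) \<partial>M) \<le> ennreal (tail n)"
proof -
  let ?A = "{- int m..int m} - {- int n..int n}"
  have sub: "{- int n..int n} \<subseteq> {- int m..int m}" using assms by auto
  have eq: "partial m t \<omega> - partial n t \<omega> = (\<Sum>l\<in>?A. cis (of_int l * t) * w l \<omega>)" for \<omega>
    unfolding partial_def by (subst sum_diff[OF _ sub]) (auto simp: mult.commute)
  note L = linear_covariance[of ?A "\<lambda>l. cis (of_int l * t)" "\<lambda>l. cis (of_int l * t)"]
  have sq: "complex_of_real ((cmod (partial m t \<omega> - partial n t \<omega>))\<^sup>2) = (\<Sum>l\<in>?A. cis (of_int l * t) * w l \<omega>) * cnj (\<Sum>l\<in>?A. cis (of_int l * t) * w l \<omega>)" for \<omega>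
    unfolding eq by (rule complex_norm_square)
  have int: "integrable M (\<lambda>\<omega>. (cmod (partial m t \<omega> - partial n t \<omega>))\<^sup>2)"
    using L(1) unfolding sq[symmetric] by (simp only: complex_of_real_integrable_eq finite_Diff finite_atLeastAtMost_int)
  have "complex_of_real (expectation (\<lambda>\<omega>. (cmod (partial m t \<omega> - partial n t \<omega>))\<^sup>2)) = (\<Sum>l\<in>?A. of_real (C l))"
    unfolding integral_complex_of_real[symmetric] sq by (subst L(2)) (auto simp: cis_cnj cis_mult)
  then have E: "expectation (\<lambda>\<omega>. (cmod (partial m t \<omega> - partial n t \<omega>))\<^sup>2) = (\<Sum>l\<in>?A. C l)"
    by (simp only: of_real_sum[symmetric] of_real_eq_iff)
  have "(\<Sum>l\<in>?A. C l) = (\<Sum>l\<in>{- int m..int m}. C l) - (\<Sum>l\<in>{- int n..int n}. C l)"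
    by (rule sum_diff[OF _ sub]) simp
  also have "\<dots> \<le> tail n"
    unfolding tail_def using finite_sum_le_infsum[OF C_summable, of "{- int m..int m}"] C_nonneg by simp
  finally have "expectation (\<lambda>\<omega>. (cmod (partial m t \<omega> - partial n t \<omega>))\<^sup>2) \<le> tail n" unfolding E .
  then show ?thesis by (subst nn_integral_eq_integral[OF int]) (auto intro: ennreal_leI)
qed

lemma X_measurable [measurable]: "X t \<in> borel_measurable M"
  using measurable_Pair2[OF X_joint, of t] by simp

lemma partial_measurable [measurable]: "partial n t \<in> borel_measurable M"
  unfolding partial_def by measurable

text \<open>The point is uniformity in \<open>t\<close>, while convergence of the series is given
  for each \<open>t\<close> separately. The squared distance of \<open>partial n\<close> from any
  later partial sum is at most \<open>tail n\<close> in mean by orthogonality; letting the later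
  index grow leaves a bound free of \<open>t\<close>, fit for integration over the circle.\<close>

lemma mean_square_error:
  "(\<integral>\<^sup>+\<omega>. ennreal ((cmod (of_real (X t \<omega>) - partial n t \<omega>))\<^sup>2) \<partial>M) \<le> ennreal (2 * tail n)"
proof -
  let ?e = "\<lambda>n. \<integral>\<^sup>+\<omega>. ennreal ((cmod (of_real (X t \<omega>) - partial n t \<omega>))\<^sup>2) \<partial>M"
  have le: "?e n \<le> 2 * ?e m + 2 * ennreal (tail n)" if "n \<le> m" for m
  proof -
    have "(cmod (x - z))\<^sup>2 \<le> 2 * (cmod (x - y))\<^sup>2 + 2 * (cmod (y - z))\<^sup>2" for x y z :: complex
    proof -
      have "(cmod (x - z))\<^sup>2 \<le> (cmod (x - y) + cmod (y - z))\<^sup>2"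
        using norm_triangle_ineq[of "x - y" "y - z"] by (intro power_mono) auto
      also have "\<dots> \<le> 2 * (cmod (x - y))\<^sup>2 + 2 * (cmod (y - z))\<^sup>2"
        using zero_le_power2[of "cmod (x - y) - cmod (y - z)"] unfolding power2_diff power2_sum by simp
      finally show ?thesis .
    qed
    then have "?e n \<le> (\<integral>\<^sup>+\<omega>. 2 * ennreal ((cmod (of_real (X t \<omega>) - partial m t \<omega>))\<^sup>2) + 2 * ennreal ((cmod (partial m t \<omega> - partial n t \<omega>))\<^sup>2) \<partial>M)"
      by (intro nn_integral_mono) (simp add: ennreal_plus[symmetric] ennreal_mult'[symmetric] ennreal_numeral[symmetric] del: ennreal_plus ennreal_numeral)
    also have "\<dots> = 2 * ?e m + 2 * (\<integral>\<^sup>+\<omega>. ennreal ((cmod (partial m t \<omega> - partial n t \<omega>))\<^sup>2) \<partial>M)"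
      by (subst nn_integral_add) (auto simp: nn_integral_cmult)
    also have "\<dots> \<le> 2 * ?e m + 2 * ennreal (tail n)"
      by (intro add_left_mono mult_left_mono partial_diff that) auto
    finally show ?thesis .
  qed
  have "(\<lambda>m. 2 * ?e m + 2 * ennreal (tail n)) \<longlonglongrightarrow> 2 * 0 + 2 * ennreal (tail n)"
    using series[of t] unfolding partial_def by (intro tendsto_add tendsto_const ennreal_tendsto_cmult) auto
  then have "?e n \<le> 2 * 0 + 2 * ennreal (tail n)"
    by (rule LIMSEQ_le_const) (use le in auto)
  also have "\<dots> = ennreal (2 * tail n)" using tail_nonneg by (simp add: ennreal_mult)
  finally show ?thesis .
qed

lemma partial_joint: "(\<lambda>(t, \<omega>). partial n t \<omega>) \<in> borel_measurable (borel \<Otimes>\<^sub>M M)"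
proof -
  have [measurable]: "cis \<in> borel_measurable borel" by (intro borel_measurable_continuous_onI continuous_intros)
  show ?thesis unfolding partial_def by measurable
qed

end

section \<open>Wavelet coefficients as finite sums of Fourier coefficients\<close>

locale torus_wavelet = random_torus_field M X w C for M :: "'a measure" and X w C +
  fixes \<phi> a :: "real \<Rightarrow> real"
  assumes profile: "wavelet_profile \<phi> a"
begin

text \<open>The phase has a plus sign: the integral over the circle pairs frequency \<open>m\<close>
  of the wavelet with \<open>w (- m)\<close>, and evenness of the profile allows the change
  \<open>l = - m\<close>.\<close>

definition coef :: "nat \<Rightarrow> int \<Rightarrow> int \<Rightarrow> complex" where
  "coef N k l = of_real (a (4 * of_int l / real N) / sqrt (real N)) * cis (of_int (l * k) * tau N)"

definition wavelet_sum :: "nat \<Rightarrow> int \<Rightarrow> 'a \<Rightarrow> complex" where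
  "wavelet_sum N k \<omega> = (\<Sum>l\<in>freq N. coef N k l * w l \<omega>)"

lemma a_outside: "l \<notin> freq N \<Longrightarrow> a (4 * of_int l / real N) = 0"
  using Ca2_outside[OF profile, of l N "\<lambda>_. 1"] by (simp add: Ca2_def)

lemma psi_sum:
  "complex_of_real (psi a N t) = (\<Sum>l\<in>freq N. of_real (a (4 * of_int l / real N) / sqrt (real N)) * cis (of_int l * t))"
proof -
  have "(\<Sum>\<^sub>\<infinity>l::int. complex_of_real (a (4 * of_int l / real N)) * cis (of_int l * t))
     = (\<Sum>\<^sub>\<infinity>l\<in>freq N. complex_of_real (a (4 * of_int l / real N)) * cis (of_int l * t))"
    by (rule infsum_cong_neutral) (auto simp: a_outside)
  then show ?thesis unfolding psi_complex[OF profile] by (simp add: sum_distrib_left sum_divide_distrib)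
qed

lemma psi_bounded:
  obtains B where "B > 0" "\<And>t. \<bar>psi a N t\<bar> \<le> B"
proof -
  let ?B = "\<Sum>l\<in>freq N. \<bar>a (4 * of_int l / real N) / sqrt (real N)\<bar>"
  have "\<bar>psi a N t\<bar> \<le> ?B" for t
  proof -
    have "\<bar>psi a N t\<bar> = cmod (complex_of_real (psi a N t))" by simp
    also have "\<dots> \<le> ?B" unfolding psi_sum by (rule sum_norm_le) (simp add: norm_mult norm_divide)
    finally show ?thesis .
  qed
  moreover have "?B \<ge> 0" by (intro sum_nonneg) simp
  ultimately show thesis by (intro that[of "?B + 1"]) (auto intro: add_increasing2 simp: add_nonneg_pos)
qed

lemma psi_measurable [measurable]: "psi a N \<in> borel_measurable borel"
proof -
  have eq: "psi a N = (\<lambda>t. Re (\<Sum>l\<in>freq N. of_real (a (4 * of_int l / real N) / sqrt (real N)) * cis (of_int l * t)))"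
    unfolding psi_sum[symmetric] by simp
  show ?thesis
    unfolding eq by (intro borel_measurable_continuous_onI continuous_intros)
qed

text \<open>By orthogonality only \<open>l = - m\<close> contributes. The condition
  \<open>N \<le> n\<close> places all frequencies of the wavelet inside the partial sum, so the
  value does not depend on \<open>n\<close>.\<close>

lemma partial_coefficient:
  assumes n: "N \<le> n"
  shows "(\<integral>\<theta>. indicator {- pi..pi} \<theta> *\<^sub>R (partial n \<theta> \<omega> * of_real (psi a N (\<theta> - of_int k * tau N))) \<partial>lborel) = 2 * pi * wavelet_sum N k \<omega>"
proof -
  let ?A = "{- int n..int n}"
  let ?b = "\<lambda>m. complex_of_real (a (4 * of_int m / real N) / sqrt (real N))"
  define e where "e l \<theta> = indicator {- pi..pi} \<theta> *\<^sub>R cis (of_int l * \<theta>)" for l \<theta>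
  have int: "integrable lborel (e l)" for l
    unfolding e_def set_integrable_def[symmetric] by (intro borel_integrable_atLeastAtMost' continuous_intros)
  have "indicator {- pi..pi} \<theta> *\<^sub>R (partial n \<theta> \<omega> * of_real (psi a N (\<theta> - of_int k * tau N)))
     = (\<Sum>l\<in>?A. \<Sum>m\<in>freq N. w l \<omega> * ?b m * cis (- (of_int (m * k) * tau N)) * e (l + m) \<theta>)" for \<theta>
  proof -
    have "cis (of_int l * \<theta>) * cis (of_int m * (\<theta> - of_int k * tau N)) = cis (- (of_int (m * k) * tau N)) * cis (of_int (l + m) * \<theta>)" for l m
      by (simp add: cis_mult algebra_simps)
    then have "partial n \<theta> \<omega> * of_real (psi a N (\<theta> - of_int k * tau N)) = (\<Sum>l\<in>?A. \<Sum>m\<in>freq N. w l \<omega> * ?b m * (cis (- (of_int (m * k) * tau N)) * cis (of_int (l + m) * \<theta>)))"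
      unfolding partial_def psi_sum sum_product by (intro sum.cong refl) (simp add: mult_ac)
    then show ?thesis by (simp only: e_def scaleR_sum_right mult_scaleR_right mult.assoc)
  qed
  then have "(\<integral>\<theta>. indicator {- pi..pi} \<theta> *\<^sub>R (partial n \<theta> \<omega> * of_real (psi a N (\<theta> - of_int k * tau N))) \<partial>lborel)
     = (\<Sum>l\<in>?A. \<Sum>m\<in>freq N. w l \<omega> * ?b m * cis (- (of_int (m * k) * tau N)) * (if l + m = 0 then 2 * pi else 0))"
    unfolding cis_integral[symmetric] e_def[symmetric] using int by simp
  also have "\<dots> = (\<Sum>m\<in>freq N. \<Sum>l\<in>?A. if l = - m then 2 * pi * (w (- m) \<omega> * ?b m * cis (- (of_int (m * k) * tau N))) else 0)"
    by (subst sum.swap) (intro sum.cong refl, auto simp: add_eq_0_iff2)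
  also have "\<dots> = (\<Sum>m\<in>freq N. 2 * pi * (w (- m) \<omega> * ?b m * cis (- (of_int (m * k) * tau N))))"
    using n by (intro sum.cong refl) (auto simp: freq_def)
  also have "\<dots> = (\<Sum>l\<in>freq N. 2 * pi * (coef N k l * w l \<omega>))"
    by (rule sum.reindex_bij_witness[of _ uminus uminus])
       (auto simp: freq_def coef_def mult_ac wavelet_profile_even[OF profile])
  finally show ?thesis by (simp add: wavelet_sum_def sum_distrib_left)
qed

lemma beta_measurable: "beta X a N k \<in> borel_measurable M"
proof -
  have to: "(\<lambda>(\<omega>, t). (t, \<omega>)) \<in> measurable (M \<Otimes>\<^sub>M lborel) (borel \<Otimes>\<^sub>M M)" by measurable
  have [measurable]: "(\<lambda>(\<omega>, t). X t \<omega>) \<in> borel_measurable (M \<Otimes>\<^sub>M lborel)"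
    using measurable_compose[OF to X_joint] by (simp add: case_prod_beta')
  show ?thesis
    unfolding beta_def[abs_def] set_lebesgue_integral_def
    by (intro borel_measurable_times borel_measurable_const lborel.borel_measurable_lebesgue_integral) measurable
qed

text \<open>Convergence is in mean square and not along paths, so the difference is estimated in
  mean by a constant times the integral of \<open>|X - partial n|\<close> over the circle. Fubini
  and the uniform mean-square bound make this small for large \<open>n\<close>, while the difference
  itself is independent of \<open>n\<close>; hence it vanishes almost surely.\<close>

theorem beta_eq:
  assumes N: "N > 0"
  shows "AE \<omega> in M. complex_of_real (beta X a N k \<omega>) = wavelet_sum N k \<omega>"
proof -
  obtain B where B: "B > 0" "\<And>t. \<bar>psi a N t\<bar> \<le> B" using psi_bounded by blast
  define L where "L = restrict_space lborel {- pi..pi}"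
  have L_id [measurable]: "(\<lambda>t. t) \<in> measurable L borel" unfolding L_def by (intro measurable_restrict_space1) simp
  have em: "emeasure L (space L) = ennreal (2 * pi)" unfolding L_def
    by (simp add: space_restrict_space emeasure_restrict_space)
  interpret L: finite_measure L by (rule finite_measureI) (simp add: em)
  interpret P: pair_sigma_finite M L by unfold_locales
  let ?\<psi> = "\<lambda>\<theta>. psi a N (\<theta> - of_int k * tau N)"
  have to: "(\<lambda>(\<omega>, t). (t, \<omega>)) \<in> measurable (M \<Otimes>\<^sub>M L) (borel \<Otimes>\<^sub>M M)" by measurable
  have jX [measurable]: "(\<lambda>(\<omega>, t). X t \<omega>) \<in> borel_measurable (M \<Otimes>\<^sub>M L)"
    and jP [measurable]: "(\<lambda>(\<omega>, t). partial n t \<omega>) \<in> borel_measurable (M \<Otimes>\<^sub>M L)" for n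
    using measurable_compose[OF to X_joint] measurable_compose[OF to partial_joint] by (simp_all add: case_prod_beta')
  have beta_int: "complex_of_real (beta X a N k \<omega>) = 1 / (2 * pi) * (\<integral>\<theta>. complex_of_real (X \<theta> \<omega> * ?\<psi> \<theta>) \<partial>L)" for \<omega>
    unfolding beta_def set_lebesgue_integral_def L_def integral_complex_of_real
    by (simp add: integral_restrict_space)
  have sum_int: "wavelet_sum N k \<omega> = 1 / (2 * pi) * (\<integral>\<theta>. partial n \<theta> \<omega> * of_real (?\<psi> \<theta>) \<partial>L)" if "N \<le> n" for n \<omega>
    using partial_coefficient[OF that, of \<omega> k] unfolding L_def by (simp add: integral_restrict_space)
  let ?D = "\<lambda>n \<omega>. \<integral>\<^sup>+\<theta>. ennreal (cmod (of_real (X \<theta> \<omega>) - partial n \<theta> \<omega>)) \<partial>L"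
  let ?d = "\<lambda>\<omega>. ennreal (cmod (of_real (beta X a N k \<omega>) - wavelet_sum N k \<omega>))"
  have X_path: "(\<lambda>\<theta>. X \<theta> \<omega>) \<in> borel_measurable L" and P_path: "(\<lambda>\<theta>. partial n \<theta> \<omega>) \<in> borel_measurable L"
    if "\<omega> \<in> space M" for \<omega> n
    using measurable_compose[OF measurable_Pair1'[OF that] jX] measurable_compose[OF measurable_Pair1'[OF that] jP]
    by simp_all
  \<comment> \<open>If the error integral is infinite, the bound is trivial whatever value the path
    integral takes. Otherwise the path is integrable against the wavelet, because the partial sum
    is, and the integrals may be subtracted.\<close>
  have path: "?d \<omega> \<le> ennreal (B / (2 * pi)) * ?D n \<omega>" if \<omega>: "\<omega> \<in> space M" and n: "N \<le> n" for \<omega> n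
  proof (cases "?D n \<omega> = \<infinity>")
    case True
    then show ?thesis using B(1) by (simp add: ennreal_mult_top)
  next
    case False
    note [measurable] = X_path[OF \<omega>] P_path[OF \<omega>]
    have Y: "integrable L (\<lambda>\<theta>. of_real (X \<theta> \<omega>) - partial n \<theta> \<omega>)"
      by (rule integrableI_bounded) (use False in \<open>auto simp: less_top[symmetric]\<close>)
    have Yp: "integrable L (\<lambda>\<theta>. (of_real (X \<theta> \<omega>) - partial n \<theta> \<omega>) * of_real (?\<psi> \<theta>))"
    proof (rule Bochner_Integration.integrable_bound[OF integrable_mult_left[OF integrable_norm[OF Y], of B]])
      show "AE \<theta> in L. norm ((of_real (X \<theta> \<omega>) - partial n \<theta> \<omega>) * of_real (?\<psi> \<theta>)) \<le> norm (norm (of_real (X \<theta> \<omega>) - partial n \<theta> \<omega>) * B)"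
        using B by (intro AE_I2) (auto simp: norm_mult intro!: mult_left_mono order_trans[OF B(2)])
    qed measurable
    have "partial n \<theta> \<omega> = (\<Sum>l\<in>{- int n..int n}. w l \<omega> * cis (of_int l * \<theta>))" for \<theta> by (rule partial_def)
    then have pb: "cmod (partial n \<theta> \<omega>) \<le> (\<Sum>l\<in>{- int n..int n}. cmod (w l \<omega>))" for \<theta>
      by (auto intro!: sum_norm_le simp: norm_mult)
    have Pp: "integrable L (\<lambda>\<theta>. partial n \<theta> \<omega> * of_real (?\<psi> \<theta>))"
      by (rule L.integrable_const_bound[of _ "(\<Sum>l\<in>{- int n..int n}. cmod (w l \<omega>)) * B"])
         (auto simp: norm_mult intro!: mult_mono pb B sum_nonneg)
    have Xp: "integrable L (\<lambda>\<theta>. complex_of_real (X \<theta> \<omega> * ?\<psi> \<theta>))"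
      using Bochner_Integration.integrable_add[OF Yp Pp] by (simp add: algebra_simps)
    have "of_real (beta X a N k \<omega>) - wavelet_sum N k \<omega> = 1 / (2 * pi) * (\<integral>\<theta>. (of_real (X \<theta> \<omega>) - partial n \<theta> \<omega>) * of_real (?\<psi> \<theta>) \<partial>L)"
      unfolding beta_int sum_int[OF n] right_diff_distrib[symmetric] Bochner_Integration.integral_diff[OF Xp Pp, symmetric]
      by (simp add: left_diff_distrib)
    then have "cmod (of_real (beta X a N k \<omega>) - wavelet_sum N k \<omega>) = 1 / (2 * pi) * cmod (\<integral>\<theta>. (of_real (X \<theta> \<omega>) - partial n \<theta> \<omega>) * of_real (?\<psi> \<theta>) \<partial>L)"
      by (simp add: norm_mult norm_divide)
    also have "\<dots> \<le> 1 / (2 * pi) * (\<integral>\<theta>. cmod (of_real (X \<theta> \<omega>) - partial n \<theta> \<omega>) * B \<partial>L)"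
    proof (intro mult_left_mono)
      show "cmod (\<integral>\<theta>. (of_real (X \<theta> \<omega>) - partial n \<theta> \<omega>) * of_real (?\<psi> \<theta>) \<partial>L) \<le> (\<integral>\<theta>. cmod (of_real (X \<theta> \<omega>) - partial n \<theta> \<omega>) * B \<partial>L)"
        by (rule order_trans[OF integral_norm_bound integral_mono[OF integrable_norm[OF Yp] integrable_mult_left[OF integrable_norm[OF Y]]]])
           (auto simp: norm_mult intro!: mult_left_mono B)
    qed simp
    also have "\<dots> = B / (2 * pi) * (\<integral>\<theta>. cmod (of_real (X \<theta> \<omega>) - partial n \<theta> \<omega>) \<partial>L)" by simp
    finally have "?d \<omega> \<le> ennreal (B / (2 * pi) * (\<integral>\<theta>. cmod (of_real (X \<theta> \<omega>) - partial n \<theta> \<omega>) \<partial>L))"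
      by (rule ennreal_leI)
    also have "\<dots> = ennreal (B / (2 * pi)) * ?D n \<omega>"
      using B(1) by (subst nn_integral_eq_integral[OF integrable_norm[OF Y]]) (auto simp: ennreal_mult'[symmetric])
    finally show ?thesis .
  qed
  \<comment> \<open>\<open>y <= s + y^2 / s\<close> replaces the square root of Cauchy-Schwarz; the
    free parameter \<open>s\<close> is sent to 0 after \<open>n\<close> has gone to
    infinity.\<close>
  have ED: "(\<integral>\<^sup>+\<omega>. ?D n \<omega> \<partial>M) \<le> ennreal (2 * pi * (s + 2 * tail n / s))" if s: "s > 0" for n s
  proof -
    have "(\<integral>\<^sup>+\<omega>. ?D n \<omega> \<partial>M) = (\<integral>\<^sup>+\<theta>. (\<integral>\<^sup>+\<omega>. ennreal (cmod (of_real (X \<theta> \<omega>) - partial n \<theta> \<omega>)) \<partial>M) \<partial>L)"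
      by (rule P.Fubini'[symmetric]) measurable
    also have "\<dots> \<le> (\<integral>\<^sup>+\<theta>. ennreal (s + 2 * tail n / s) \<partial>L)"
    proof (rule nn_integral_mono)
      fix \<theta>
      have "y \<le> s + 1 / s * y\<^sup>2" if "y \<ge> 0" for y :: real
      proof -
        have "2 * (s * y) \<le> s\<^sup>2 + y\<^sup>2" using zero_le_power2[of "s - y"] unfolding power2_diff by simp
        moreover have "0 \<le> s * y" using s that by simp
        ultimately have "s * y \<le> s * (s + 1 / s * y\<^sup>2)" using s by (simp add: power2_eq_square distrib_left)
        then show ?thesis using s by (simp only: mult_le_cancel_left_pos)
      qed
      then have "(\<integral>\<^sup>+\<omega>. ennreal (cmod (of_real (X \<theta> \<omega>) - partial n \<theta> \<omega>)) \<partial>M)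
          \<le> (\<integral>\<^sup>+\<omega>. ennreal s + ennreal (1 / s) * ennreal ((cmod (of_real (X \<theta> \<omega>) - partial n \<theta> \<omega>))\<^sup>2) \<partial>M)"
        using s by (intro nn_integral_mono) (simp add: ennreal_plus[symmetric] ennreal_mult'[symmetric] del: ennreal_plus)
      also have "\<dots> = ennreal s + ennreal (1 / s) * (\<integral>\<^sup>+\<omega>. ennreal ((cmod (of_real (X \<theta> \<omega>) - partial n \<theta> \<omega>))\<^sup>2) \<partial>M)"
        by (subst nn_integral_add) (auto simp: nn_integral_cmult emeasure_space_1)
      also have "\<dots> \<le> ennreal s + ennreal (1 / s) * ennreal (2 * tail n)"
        by (intro add_left_mono mult_left_mono mean_square_error) auto
      also have "\<dots> = ennreal (s + 2 * tail n / s)"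
        using s tail_nonneg[of n] by (simp add: ennreal_plus[symmetric] ennreal_mult'[symmetric] del: ennreal_plus)
      finally show "(\<integral>\<^sup>+\<omega>. ennreal (cmod (of_real (X \<theta> \<omega>) - partial n \<theta> \<omega>)) \<partial>M) \<le> ennreal (s + 2 * tail n / s)" .
    qed
    also have "\<dots> = ennreal (2 * pi * (s + 2 * tail n / s))"
      using s tail_nonneg[of n] by (simp add: em ennreal_mult'[symmetric] mult.commute del: ennreal_plus)
    finally show ?thesis .
  qed
  have bound: "(\<integral>\<^sup>+\<omega>. ?d \<omega> \<partial>M) \<le> ennreal (B * (s + 2 * tail n / s))" if "N \<le> n" "s > 0" for n s
  proof -
    have "(\<integral>\<^sup>+\<omega>. ?d \<omega> \<partial>M) \<le> (\<integral>\<^sup>+\<omega>. ennreal (B / (2 * pi)) * ?D n \<omega> \<partial>M)"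
      using path that by (intro nn_integral_mono) auto
    also have "\<dots> = ennreal (B / (2 * pi)) * (\<integral>\<^sup>+\<omega>. ?D n \<omega> \<partial>M)"
      by (rule nn_integral_cmult) measurable
    also have "\<dots> \<le> ennreal (B / (2 * pi)) * ennreal (2 * pi * (s + 2 * tail n / s))"
      by (intro mult_left_mono ED that) auto
    also have "\<dots> = ennreal (B * (s + 2 * tail n / s))"
      using B(1) by (simp add: ennreal_mult'[symmetric])
    finally show ?thesis .
  qed
  have small: "(\<integral>\<^sup>+\<omega>. ?d \<omega> \<partial>M) \<le> ennreal (B * s)" if "s > 0" for s
  proof (rule LIMSEQ_le_const)
    have "(\<lambda>n. B * (s + 2 * tail n / s)) \<longlonglongrightarrow> B * (s + 2 * 0 / s)"
      by (intro tendsto_intros tail_tendsto) (use that in simp)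
    then show "(\<lambda>n. ennreal (B * (s + 2 * tail n / s))) \<longlonglongrightarrow> ennreal (B * s)"
      by (intro tendsto_ennrealI) simp
  qed (use bound that in auto)
  have "(\<integral>\<^sup>+\<omega>. ?d \<omega> \<partial>M) \<le> ennreal 0"
  proof (rule LIMSEQ_le_const)
    have "(\<lambda>n. B * (1 / real (Suc n))) \<longlonglongrightarrow> B * 0" by (intro tendsto_intros LIMSEQ_Suc lim_1_over_n)
    then show "(\<lambda>n. ennreal (B * (1 / real (Suc n)))) \<longlonglongrightarrow> ennreal 0" by (intro tendsto_ennrealI) simp
  qed (use small[of "1 / real (Suc _)"] in auto)
  then have zero: "(\<integral>\<^sup>+\<omega>. ?d \<omega> \<partial>M) = 0" by simp
  note [measurable] = beta_measurable[of N k]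
  have "AE \<omega> in M. ?d \<omega> = 0"
    using zero by (subst nn_integral_0_iff_AE[symmetric]) (auto simp: wavelet_sum_def)
  then show ?thesis by eventually_elim simp
qed

end

section \<open>Normalized Gaussian coefficients and their variances\<close>

lemma std_normal_moment: "(\<integral>x. x ^ n \<partial>std_normal_distribution) = gauss_moment n"
proof (cases "even n")
  case True
  then obtain k where "n = 2 * k" by (elim evenE)
  then show ?thesis by (simp only: std_normal_distribution_even_moments gauss_moment_even)
next
  case False
  then obtain k where "n = 2 * k + 1" by (elim oddE)
  then show ?thesis using integral_std_normal_distribution_moment_odd[OF False] by (simp only: gauss_moment_odd)
qed

lemma infsum_pairs:
  fixes f :: "int \<Rightarrow> int \<Rightarrow> real"
  assumes "finite A" "\<And>l1 l2. l1 \<notin> A \<or> l2 \<notin> A \<Longrightarrow> f l1 l2 = 0"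
  shows "(\<Sum>\<^sub>\<infinity>(l1, l2). f l1 l2) = (\<Sum>l1\<in>A. \<Sum>l2\<in>A. f l1 l2)"
proof -
  have "(\<Sum>\<^sub>\<infinity>(l1, l2). f l1 l2) = (\<Sum>\<^sub>\<infinity>(l1, l2)\<in>A \<times> A. f l1 l2)"
    by (rule infsum_cong_neutral) (use assms(2) in auto)
  then show ?thesis using assms(1) by (simp add: sum.cartesian_product)
qed

lemma infsum_triples:
  fixes f :: "int \<Rightarrow> int \<Rightarrow> int \<Rightarrow> real"
  assumes "finite A" "\<And>l1 l2 l3. l1 \<notin> A \<or> l2 \<notin> A \<or> l3 \<notin> A \<Longrightarrow> f l1 l2 l3 = 0"
  shows "(\<Sum>\<^sub>\<infinity>(l1, l2, l3). f l1 l2 l3) = (\<Sum>l1\<in>A. \<Sum>l2\<in>A. \<Sum>l3\<in>A. f l1 l2 l3)"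
proof -
  have "(\<Sum>\<^sub>\<infinity>(l1, l2, l3). f l1 l2 l3) = (\<Sum>\<^sub>\<infinity>(l1, l2, l3)\<in>A \<times> A \<times> A. f l1 l2 l3)"
    by (rule infsum_cong_neutral) (use assms(2) in auto)
  then show ?thesis using assms(1) by (simp add: sum.cartesian_product)
qed

lemma infsum_quadruples:
  fixes f :: "int \<Rightarrow> int \<Rightarrow> int \<Rightarrow> int \<Rightarrow> real"
  assumes "finite A" "\<And>l1 l2 l3 l4. l1 \<notin> A \<or> l2 \<notin> A \<or> l3 \<notin> A \<or> l4 \<notin> A \<Longrightarrow> f l1 l2 l3 l4 = 0"
  shows "(\<Sum>\<^sub>\<infinity>(l1, l2, l3, l4). f l1 l2 l3 l4) = (\<Sum>l1\<in>A. \<Sum>l2\<in>A. \<Sum>l3\<in>A. \<Sum>l4\<in>A. f l1 l2 l3 l4)"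
proof -
  have "(\<Sum>\<^sub>\<infinity>(l1, l2, l3, l4). f l1 l2 l3 l4) = (\<Sum>\<^sub>\<infinity>(l1, l2, l3, l4)\<in>A \<times> A \<times> A \<times> A. f l1 l2 l3 l4)"
    by (rule infsum_cong_neutral) (use assms(2) in auto)
  then show ?thesis using assms(1) by (simp add: sum.cartesian_product)
qed

locale gaussian_wavelet = torus_wavelet +
  assumes gaussian: "jointly_gaussian M w"
begin

text \<open>The relation \<open>w (- l) = cnj (w l)\<close> holds almost surely, so
  \<open>wavelet_sum\<close> may fail to be real on a null set. Its real part is everywhere a real
  linear combination of the coordinates of the \<open>w l\<close>, to which joint Gaussianity
  applies directly.\<close>

definition coefficient :: "nat \<Rightarrow> int \<Rightarrow> 'a \<Rightarrow> real" where
  "coefficient N k \<omega> = Re (wavelet_sum N k \<omega>)"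

definition energy :: "nat \<Rightarrow> real" where
  "energy N = (\<Sum>l\<in>freq N. Ca2 C a N l)"

lemma coefficient_inner: "coefficient N k \<omega> = (\<Sum>l\<in>freq N. cnj (coef N k l) \<bullet> w l \<omega>)"
  by (simp add: coefficient_def wavelet_sum_def inner_complex_def)

lemma coefficient_AE:
  assumes "N > 0"
  shows "AE \<omega> in M. wavelet_sum N k \<omega> = of_real (coefficient N k \<omega>)"
    and "AE \<omega> in M. beta X a N k \<omega> = coefficient N k \<omega>"
proof -
  from beta_eq[OF assms, of k] show "AE \<omega> in M. wavelet_sum N k \<omega> = of_real (coefficient N k \<omega>)"
    by eventually_elim (metis Re_complex_of_real coefficient_def)
  from beta_eq[OF assms, of k] show "AE \<omega> in M. beta X a N k \<omega> = coefficient N k \<omega>"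
    by eventually_elim (metis Re_complex_of_real coefficient_def)
qed

lemma coefficient_combination_gaussian:
  "gaussian_rv M (\<lambda>\<omega>. \<Sum>k\<in>I. c k * coefficient N (\<kappa> k) \<omega>)"
proof -
  have "(\<Sum>k\<in>I. c k * coefficient N (\<kappa> k) \<omega>) = (\<Sum>l\<in>freq N. (\<Sum>k\<in>I. c k *\<^sub>R cnj (coef N (\<kappa> k) l)) \<bullet> w l \<omega>)" for \<omega>
    unfolding coefficient_inner sum_distrib_left inner_sum_left
    by (subst sum.swap) simp
  then show ?thesis using gaussian unfolding jointly_gaussian_def by simp
qed

lemma coefficient_centered: "expectation (coefficient N k) = 0"
  unfolding coefficient_inner[abs_def] using w_integrable w_centered by simp

lemma coefficient_moments: "finite_moments M (coefficient N k)"
  using gaussian_rv_moments(1)[of "coefficient N k"] coefficient_combination_gaussian[of "\<lambda>_. 1" N "\<lambda>_. k" "{0::nat}"] coefficient_centered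
  by simp

text \<open>Orthogonality concerns the products \<open>w l * cnj (w l')\<close>, so one of the two
  factors is replaced by its conjugate; this is free because both sums are real almost
  surely.\<close>

lemma coefficient_covariance:
  assumes "N > 0"
  shows "expectation (\<lambda>\<omega>. coefficient N k \<omega> * coefficient N m \<omega>)
    = (\<Sum>l\<in>freq N. Ca2 C a N l * cos (of_int l * tau N * of_int k - of_int l * tau N * of_int m)) / N"
proof -
  have "complex_of_real (expectation (\<lambda>\<omega>. coefficient N k \<omega> * coefficient N m \<omega>)) = (\<integral>\<omega>. complex_of_real (coefficient N k \<omega> * coefficient N m \<omega>) \<partial>M)"
    by (rule integral_complex_of_real[symmetric])
  also have "\<dots> = (\<integral>\<omega>. wavelet_sum N k \<omega> * cnj (wavelet_sum N m \<omega>) \<partial>M)"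
  proof (rule integral_cong_AE)
    show "AE \<omega> in M. complex_of_real (coefficient N k \<omega> * coefficient N m \<omega>) = wavelet_sum N k \<omega> * cnj (wavelet_sum N m \<omega>)"
      using coefficient_AE(1)[OF assms, of k] coefficient_AE(1)[OF assms, of m] by eventually_elim simp
  qed (simp_all add: wavelet_sum_def coefficient_def)
  also have "\<dots> = (\<Sum>l\<in>freq N. coef N k l * cnj (coef N m l) * of_real (C l))"
    unfolding wavelet_sum_def by (rule linear_covariance) simp
  also have "\<dots> = (\<Sum>l\<in>freq N. of_real (Ca2 C a N l / N) * cis (of_int l * tau N * of_int k - of_int l * tau N * of_int m))"
  proof (intro sum.cong refl)
    fix l
    let ?b = "a (4 * of_int l / real N) / sqrt (real N)"
    have "coef N k l * cnj (coef N m l) = of_real (?b * ?b) * (cis (of_int (l * k) * tau N) * cnj (cis (of_int (l * m) * tau N)))"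
      by (simp only: coef_def complex_cnj_mult complex_cnj_complex_of_real of_real_mult mult_ac)
    also have "cis (of_int (l * k) * tau N) * cnj (cis (of_int (l * m) * tau N)) = cis (of_int l * tau N * of_int k - of_int l * tau N * of_int m)"
      by (simp add: cis_cnj cis_mult mult_ac)
    also have "?b * ?b = (a (4 * of_int l / real N))\<^sup>2 / N" by (simp add: power2_eq_square)
    finally show "coef N k l * cnj (coef N m l) * of_real (C l) = of_real (Ca2 C a N l / N) * cis (of_int l * tau N * of_int k - of_int l * tau N * of_int m)"
      by (simp add: Ca2_def mult_ac)
  qed
  finally have "expectation (\<lambda>\<omega>. coefficient N k \<omega> * coefficient N m \<omega>)
     = Re (\<Sum>l\<in>freq N. of_real (Ca2 C a N l / N) * cis (of_int l * tau N * of_int k - of_int l * tau N * of_int m))"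
    by (metis Re_complex_of_real)
  then show ?thesis by (simp add: sum_divide_distrib)
qed

lemma sigma_beta_eq:
  assumes "N > 0" shows "sigma_beta M X a N = sqrt (energy N / N)"
proof -
  have "(\<integral>\<omega>. (beta X a N 0 \<omega>)\<^sup>2 \<partial>M) = expectation (\<lambda>\<omega>. coefficient N 0 \<omega> * coefficient N 0 \<omega>)"
  proof (rule integral_cong_AE)
    show "(\<lambda>\<omega>. (beta X a N 0 \<omega>)\<^sup>2) \<in> borel_measurable M"
      using beta_measurable[of N 0] by measurable
    show "(\<lambda>\<omega>. coefficient N 0 \<omega> * coefficient N 0 \<omega>) \<in> borel_measurable M"
      using coefficient_moments[of N 0] by measurable
    show "AE \<omega> in M. (beta X a N 0 \<omega>)\<^sup>2 = coefficient N 0 \<omega> * coefficient N 0 \<omega>"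
      using coefficient_AE(2)[OF assms, of 0] by eventually_elim (simp add: power2_eq_square)
  qed
  then show ?thesis unfolding sigma_beta_def coefficient_covariance[OF assms] by (simp add: energy_def)
qed

lemma beta_hat_AE:
  assumes "N > 0"
  shows "AE \<omega> in M. \<forall>k. beta_hat M X a N k \<omega> = coefficient N k \<omega> / sigma_beta M X a N"
  unfolding AE_all_countable beta_hat_def using coefficient_AE(2)[OF assms] by simp

lemma beta_hat_moments:
  assumes "N > 0" shows "finite_moments M (beta_hat M X a N k)"
proof -
  have fm: "finite_moments M (\<lambda>\<omega>. coefficient N k \<omega> / sigma_beta M X a N)"
    unfolding divide_inverse by (intro finite_moments_mult coefficient_moments finite_moments_const)
  have meas: "beta_hat M X a N k \<in> borel_measurable M"
    unfolding beta_hat_def[abs_def] using beta_measurable[of N k] by measurable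
  moreover have "integrable M (\<lambda>\<omega>. \<bar>beta_hat M X a N k \<omega>\<bar> ^ p)" for p
  proof (rule integrable_cong_AE_imp)
    show "integrable M (\<lambda>\<omega>. \<bar>coefficient N k \<omega> / sigma_beta M X a N\<bar> ^ p)"
      using fm unfolding finite_moments_def by blast
    show "AE \<omega> in M. \<bar>coefficient N k \<omega> / sigma_beta M X a N\<bar> ^ p = \<bar>beta_hat M X a N k \<omega>\<bar> ^ p"
      using beta_hat_AE[OF assms] by eventually_elim simp
  qed (use meas in measurable)
  ultimately show ?thesis by (simp add: finite_moments_def)
qed

lemma statistics_moments:
  assumes "N > 0" shows "finite_moments M (S_stat M X a N)" "finite_moments M (U_stat M X a N)"
  unfolding S_stat_def[abs_def] U_stat_def[abs_def]
  by (intro finite_moments_intros beta_hat_moments assms)+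

definition row :: "nat \<Rightarrow> nat \<Rightarrow> 'a \<Rightarrow> real" where
  "row N k \<omega> = coefficient N (int k) \<omega> / sigma_beta M X a N"

lemma row_gaussian_family: "gaussian_family M {1..N} (row N)"
proof (unfold_locales)
  show "gaussian_rv M (\<lambda>\<omega>. \<Sum>i\<in>{1..N}. c i * row N i \<omega>)" for c
    using coefficient_combination_gaussian[of "\<lambda>k. c k / sigma_beta M X a N" N int "{1..N}"] by (simp add: row_def)
  show "expectation (row N i) = 0" for i
    unfolding row_def[abs_def] using coefficient_centered by simp
qed simp

end

text \<open>Positive energy turns the values of \<open>Ca2\<close> into probability weights, and the
  correlations of a row become those of the spectral setting. The condition is supplied by the
  spectral estimates for all large \<open>N\<close>.\<close>

locale normalizable_row = gaussian_wavelet +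
  fixes N :: nat
  assumes N: "N > 0" and energy_pos: "energy N > 0"
begin

sublocale weights: spectral_weights N "\<lambda>l. Ca2 C a N l / energy N"
proof
  show "0 \<le> Ca2 C a N l / energy N" for l using energy_pos C_nonneg by (simp add: Ca2_def)
  show "Ca2 C a N (- l) / energy N = Ca2 C a N l / energy N" for l
    using wavelet_profile_even[OF profile, of "4 * of_int l / real N"] by (simp add: Ca2_def C_even)
  show "(\<Sum>l\<in>freq N. Ca2 C a N l / energy N) = 1"
    using energy_pos by (simp add: sum_divide_distrib[symmetric] energy_def)
qed (rule N)

lemma sigma_beta_square: "(sigma_beta M X a N)\<^sup>2 = energy N / N" "sigma_beta M X a N > 0"
  unfolding sigma_beta_eq[OF N] using energy_pos N by simp_all

lemma row_covariance: "expectation (\<lambda>\<omega>. row N k \<omega> * row N m \<omega>) = weights.corr k m"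
proof -
  have "expectation (\<lambda>\<omega>. row N k \<omega> * row N m \<omega>) = expectation (\<lambda>\<omega>. coefficient N (int k) \<omega> * coefficient N (int m) \<omega>) / (sigma_beta M X a N)\<^sup>2"
    unfolding row_def by (simp add: power2_eq_square)
  also have "\<dots> = weights.corr k m"
    unfolding coefficient_covariance[OF N] sigma_beta_square weights.corr_def using N energy_pos
    by (simp add: sum_divide_distrib sum_distrib_right)
  finally show ?thesis .
qed

text \<open>Since the variance of a coefficient is \<open>energy N / N\<close>, the powers of
  \<open>N\<close> cancel and only normalized weights remain; \<open>12 * pi\<close> is 6 times the
  factor \<open>2 * pi\<close> of the Fejer identity.\<close>

lemma var_S_eq: "var_S M X C a N = 6 * ((\<Sum>k\<in>{1..N}. \<Sum>m\<in>{1..N}. weights.corr k m ^ 3) / N)"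
proof -
  let ?F = "\<lambda>l1 l2 l3. fejer N (of_int (l1 + l2 + l3) * tau N)"
  have "var_S M X C a N = 12 * pi / (sigma_beta M X a N ^ 6 * real N ^ 3)
      * (\<Sum>l1\<in>freq N. \<Sum>l2\<in>freq N. \<Sum>l3\<in>freq N. Ca2 C a N l1 * Ca2 C a N l2 * Ca2 C a N l3 * ?F l1 l2 l3)"
    unfolding var_S_def using Ca2_outside[OF profile, of _ N C] by (subst infsum_triples[of "freq N"]) auto
  also have "sigma_beta M X a N ^ 6 * real N ^ 3 = energy N ^ 3"
  proof -
    have "sigma_beta M X a N ^ 6 = ((sigma_beta M X a N)\<^sup>2) ^ 3" by (simp add: power_mult[symmetric])
    then show ?thesis using N by (simp add: sigma_beta_square power_divide)
  qed
  also have "12 * pi / energy N ^ 3 * (\<Sum>l1\<in>freq N. \<Sum>l2\<in>freq N. \<Sum>l3\<in>freq N. Ca2 C a N l1 * Ca2 C a N l2 * Ca2 C a N l3 * ?F l1 l2 l3)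
     = 6 * (2 * pi * (\<Sum>l1\<in>freq N. \<Sum>l2\<in>freq N. \<Sum>l3\<in>freq N. Ca2 C a N l1 / energy N * (Ca2 C a N l2 / energy N) * (Ca2 C a N l3 / energy N) * ?F l1 l2 l3))"
    unfolding sum_distrib_left by (intro sum.cong refl) (simp add: power3_eq_cube)
  finally show ?thesis unfolding weights.corr_power_sum using N by simp
qed

lemma var_U_eq: "var_1U M X C a N + var_2U M X C a N
   = 72 * ((\<Sum>k\<in>{1..N}. \<Sum>m\<in>{1..N}. weights.corr k m ^ 2) / N) + 24 * ((\<Sum>k\<in>{1..N}. \<Sum>m\<in>{1..N}. weights.corr k m ^ 4) / N)"
proof -
  let ?F2 = "\<lambda>l1 l2. fejer N (of_int (l1 + l2) * tau N)"
  let ?F4 = "\<lambda>l1 l2 l3 l4. fejer N (of_int (l1 + l2 + l3 + l4) * tau N)"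
  have "sigma_beta M X a N ^ 4 = ((sigma_beta M X a N)\<^sup>2) ^ 2" "sigma_beta M X a N ^ 8 = ((sigma_beta M X a N)\<^sup>2) ^ 4"
    by (simp_all add: power_mult[symmetric])
  then have s: "sigma_beta M X a N ^ 4 = energy N ^ 2 / real N ^ 2" "sigma_beta M X a N ^ 8 = energy N ^ 4 / real N ^ 4"
    by (simp_all add: sigma_beta_square power_divide)
  have "var_1U M X C a N = 72 / (sigma_beta M X a N) ^ 4 * (2 * pi / real N ^ 2)
      * (\<Sum>l1\<in>freq N. \<Sum>l2\<in>freq N. Ca2 C a N l1 * Ca2 C a N l2 * ?F2 l1 l2)"
    unfolding var_1U_def using Ca2_outside[OF profile, of _ N C] by (subst infsum_pairs[of "freq N"]) auto
  also have "72 / (sigma_beta M X a N) ^ 4 * (2 * pi / real N ^ 2) = 72 * (2 * pi) / energy N ^ 2"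
    unfolding s using N energy_pos by simp
  also have "72 * (2 * pi) / energy N ^ 2 * (\<Sum>l1\<in>freq N. \<Sum>l2\<in>freq N. Ca2 C a N l1 * Ca2 C a N l2 * ?F2 l1 l2)
     = 72 * (2 * pi * (\<Sum>l1\<in>freq N. \<Sum>l2\<in>freq N. Ca2 C a N l1 / energy N * (Ca2 C a N l2 / energy N) * ?F2 l1 l2))"
    unfolding sum_distrib_left by (intro sum.cong refl) (simp add: power2_eq_square)
  finally have 1: "var_1U M X C a N = \<dots>" .
  have "var_2U M X C a N = 24 / (sigma_beta M X a N) ^ 8 * (2 * pi / real N ^ 4)
      * (\<Sum>l1\<in>freq N. \<Sum>l2\<in>freq N. \<Sum>l3\<in>freq N. \<Sum>l4\<in>freq N. Ca2 C a N l1 * Ca2 C a N l2 * Ca2 C a N l3 * Ca2 C a N l4 * ?F4 l1 l2 l3 l4)"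
    unfolding var_2U_def using Ca2_outside[OF profile, of _ N C] by (subst infsum_quadruples[of "freq N"]) auto
  also have "24 / (sigma_beta M X a N) ^ 8 * (2 * pi / real N ^ 4) = 24 * (2 * pi) / energy N ^ 4"
    unfolding s using N energy_pos by simp
  also have "24 * (2 * pi) / energy N ^ 4 * (\<Sum>l1\<in>freq N. \<Sum>l2\<in>freq N. \<Sum>l3\<in>freq N. \<Sum>l4\<in>freq N. Ca2 C a N l1 * Ca2 C a N l2 * Ca2 C a N l3 * Ca2 C a N l4 * ?F4 l1 l2 l3 l4)
     = 24 * (2 * pi * (\<Sum>l1\<in>freq N. \<Sum>l2\<in>freq N. \<Sum>l3\<in>freq N. \<Sum>l4\<in>freq N. Ca2 C a N l1 / energy N * (Ca2 C a N l2 / energy N) * (Ca2 C a N l3 / energy N) * (Ca2 C a N l4 / energy N) * ?F4 l1 l2 l3 l4))"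
    unfolding sum_distrib_left by (intro sum.cong refl) (simp add: power4_eq_xxxx)
  finally have 2: "var_2U M X C a N = \<dots>" .
  show ?thesis unfolding 1 2 weights.corr_power_sum using N by simp
qed

end

section \<open>The limit theorem\<close>

context gaussian_wavelet begin

lemma assumption_A1_bounds:
  assumes "assumption_A1 C"
  obtains c1 c2 \<alpha> where "0 < c1" "c1 \<le> c2" "\<alpha> > 0"
    "\<And>l. l \<ge> 1 \<Longrightarrow> c1 * of_int l powr (- \<alpha>) \<le> C l" "\<And>l. l \<ge> 1 \<Longrightarrow> C l \<le> c2 * of_int l powr (- \<alpha>)"
proof -
  from assms obtain c1 c2 \<alpha> and g :: "nat \<Rightarrow> real" where A: "0 < c1" "c1 \<le> c2" "\<alpha> > 1" "range g \<subseteq> {c1..c2}"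
    and C: "\<And>l. l \<ge> 1 \<Longrightarrow> C (int l) = g l * real l powr (- \<alpha>)"
    unfolding assumption_A1_def by metis
  have "c1 * of_int l powr (- \<alpha>) \<le> C l \<and> C l \<le> c2 * of_int l powr (- \<alpha>)" if "l \<ge> 1" for l
  proof -
    have "C l = g (nat l) * of_int l powr (- \<alpha>)" using C[of "nat l"] that by simp
    moreover have "c1 \<le> g (nat l)" "g (nat l) \<le> c2" using A(4) by (auto simp: image_subset_iff)
    ultimately show ?thesis by (simp add: mult_right_mono)
  qed
  then show thesis using A by (intro that[of c1 c2 \<alpha>]) auto
qed

lemma moment_limit:
  assumes A1: "assumption_A1 C"
  shows "(\<lambda>j. expectation (\<lambda>\<omega>. (S_stat M X a (2 ^ (j + 2)) \<omega> / sigma_S M X C a (2 ^ (j + 2))) ^ p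
      * (U_stat M X a (2 ^ (j + 2)) \<omega> / sigma_U M X C a (2 ^ (j + 2))) ^ q)) \<longlonglongrightarrow> gauss_moment p * gauss_moment q"
    (is "(\<lambda>j. expectation (?f j)) \<longlonglongrightarrow> _")
proof -
  obtain c1 c2 \<alpha> where b: "0 < c1" "c1 \<le> c2" "\<alpha> > 0"
    "\<And>l. l \<ge> 1 \<Longrightarrow> c1 * of_int l powr (- \<alpha>) \<le> C l" "\<And>l. l \<ge> 1 \<Longrightarrow> C l \<le> c2 * of_int l powr (- \<alpha>)"
    using assumption_A1_bounds[OF A1] by blast
  obtain K c N0 where K: "K > 0" "c > 0" "N0 > 0"
    and pos: "\<And>N. N \<ge> N0 \<Longrightarrow> energy N > 0"
    and upper: "\<And>N l. N \<ge> N0 \<Longrightarrow> Ca2 C a N l / energy N \<le> K / real N"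
    and lower: "\<And>N. N \<ge> N0 \<Longrightarrow> c \<le> (\<Sum>l1\<in>freq N. \<Sum>l2\<in>freq N. \<Sum>l3\<in>freq N.
       Ca2 C a N l1 / energy N * (Ca2 C a N l2 / energy N) * (Ca2 C a N l3 / energy N) * fejer N (of_int (l1 + l2 + l3) * tau N))"
    using spectral_estimates[OF profile b(1-3) C_even b(4,5)] unfolding energy_def by blast
  \<comment> \<open>The rows start past \<open>N0\<close>, because the locale for arrays asks its
    bounds of every row. The shift of \<open>j\<close> is undone at the end and does not affect the
    limit.\<close>
  define n where "n j = (2 ^ (j + N0 + 2) :: nat)" for j
  have n_ge: "n j \<ge> N0" for j
  proof -
    have "N0 < 2 ^ N0" by (rule less_exp)
    also have "(2 :: nat) ^ N0 \<le> n j" unfolding n_def by (intro power_increasing) auto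
    finally show ?thesis by simp
  qed
  have n0: "n j > 0" for j using n_ge[of j] K by simp
  interpret R: normalizable_row M X w C \<phi> a "n j" for j
    by unfold_locales (use n0 pos[OF n_ge] in auto)
  \<comment> \<open>\<open>K\<close> bounds the quadratic forms of the entrywise powers, so its
    square bounds the squared operator norms.\<close>
  interpret A: gaussian_array M n "\<lambda>j. row (n j)" "K\<^sup>2"
  proof (intro gaussian_array.intro gaussian_array_axioms.intro)
    show "prob_space M" by unfold_locales
    show "n j > 0" for j by (rule n0)
    show "gaussian_family M {1..n j} (row (n j))" for j by (rule row_gaussian_family)
    show "expectation (\<lambda>\<omega>. row (n j) k \<omega> * row (n j) k \<omega>) = 1" for k j
      unfolding R.row_covariance by (rule R.weights.corr_diag)
    show "(\<Sum>k\<in>{1..n j}. (\<Sum>m\<in>{1..n j}. expectation (\<lambda>\<omega>. row (n j) k \<omega> * row (n j) m \<omega>) ^ r * y m)\<^sup>2) \<le> K\<^sup>2 * (\<Sum>m\<in>{1..n j}. (y m)\<^sup>2)"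
      if "1 \<le> r" for r j y
      unfolding R.row_covariance by (rule R.weights.corr_operator[OF upper[OF n_ge] that K(1)])
    show "(\<Sum>m\<in>{1..n j}. expectation (\<lambda>\<omega>. row (n j) k \<omega> * row (n j) m \<omega>)) = 0" for k j
      unfolding R.row_covariance by (rule R.weights.corr_zero_sum)
  qed
  have \<rho>: "A.\<rho> j k m = R.weights.corr j k m" for j k m
    unfolding A.row.\<rho>_def R.row_covariance ..
  have S_var: "A.skewness_var j = var_S M X C a (n j)" and U_var: "A.kurtosis_var j = var_1U M X C a (n j) + var_2U M X C a (n j)" for j
    unfolding A.skewness_var_def A.kurtosis_var_def A.corr_power_sum_def \<rho> R.var_S_eq R.var_U_eq by simp_all
  \<comment> \<open>\<open>c\<close> bounds the contribution of the resonant triples from below, and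
    \<open>12 * pi\<close> is 6 times the factor \<open>2 * pi\<close> of the Fejer
    identity.\<close>
  have S_lower: "12 * pi * c \<le> A.skewness_var j" for j
    unfolding S_var R.var_S_eq R.weights.corr_power_sum(2) using lower[OF n_ge, of j] n0[of j] by simp
  have "filterlim (\<lambda>j. 2 ^ j :: nat) at_top sequentially"
    by (rule filterlim_at_top_mono[OF filterlim_ident]) (auto intro!: always_eventually less_imp_le less_exp)
  then have n_lim: "filterlim n at_top sequentially"
    unfolding n_def add.assoc by (rule filterlim_compose) (rule filterlim_add_const_nat_at_top)
  have lim: "(\<lambda>j. expectation (\<lambda>\<omega>. (A.S j \<omega> / sqrt (A.skewness_var j)) ^ p * (A.U j \<omega> / sqrt (A.kurtosis_var j)) ^ q)) \<longlonglongrightarrow> gauss_moment p * gauss_moment q"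
    by (rule A.joint_moment_limit[OF n_lim _ S_lower]) (use K in simp)
  \<comment> \<open>The wavelet coefficients agree with their finite sums almost surely and for all
    \<open>k\<close> at once, so the expectations coincide.\<close>
  have eq: "expectation (?f (j + N0)) = expectation (\<lambda>\<omega>. (A.S j \<omega> / sqrt (A.skewness_var j)) ^ p * (A.U j \<omega> / sqrt (A.kurtosis_var j)) ^ q)" for j
  proof (rule integral_cong_AE)
    have nj: "(2 :: nat) ^ (j + N0 + 2) = n j" by (simp add: n_def)
    note fm = statistics_moments[OF n0, of j] A.S_moments[of j] A.U_moments[of j]
    show "?f (j + N0) \<in> borel_measurable M" unfolding nj using fm by measurable
    show "(\<lambda>\<omega>. (A.S j \<omega> / sqrt (A.skewness_var j)) ^ p * (A.U j \<omega> / sqrt (A.kurtosis_var j)) ^ q) \<in> borel_measurable M"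
      using fm by measurable
    show "AE \<omega> in M. ?f (j + N0) \<omega> = (A.S j \<omega> / sqrt (A.skewness_var j)) ^ p * (A.U j \<omega> / sqrt (A.kurtosis_var j)) ^ q"
      using beta_hat_AE[OF n0, of j]
    proof eventually_elim
      case (elim \<omega>)
      then have "S_stat M X a (n j) \<omega> = A.S j \<omega>" "U_stat M X a (n j) \<omega> = A.U j \<omega>"
        unfolding S_stat_def U_stat_def A.S_def A.U_def by (simp_all add: row_def)
      then show ?case unfolding nj sigma_S_def sigma_U_def S_var U_var by simp
    qed
  qed
  show ?thesis by (rule LIMSEQ_offset[of _ N0]) (simp only: eq lim)
qed

end

theorem theorem5p1:
  fixes M :: "'a measure"
    and X :: "real \<Rightarrow> 'a \<Rightarrow> real"
    and w :: "int \<Rightarrow> 'a \<Rightarrow> complex"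
    and C :: "int \<Rightarrow> real"
    and \<phi> a :: "real \<Rightarrow> real"
  assumes "prob_space M"
    and "torus_field M X w C"
    and "assumption_A1 C"
    and "jointly_gaussian M w"
    and "wavelet_profile \<phi> a"
  defines "S \<equiv> \<lambda>j \<omega>. S_stat M X a (2 ^ (j + 2)) \<omega> / sigma_S M X C a (2 ^ (j + 2))"
    and "U \<equiv> \<lambda>j \<omega>. U_stat M X a (2 ^ (j + 2)) \<omega> / sigma_U M X C a (2 ^ (j + 2))"
  shows "(\<forall>p1 p2 :: nat.
            (\<forall>j. integrable M (\<lambda>\<omega>. S j \<omega> ^ p1 * U j \<omega> ^ p2)) \<and>
            (\<lambda>j. \<integral>\<omega>. S j \<omega> ^ p1 * U j \<omega> ^ p2 \<partial>M) \<longlonglongrightarrow>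
              (if even p1 \<and> even p2 then real (dfact (p1 - 1)) * real (dfact (p2 - 1)) else 0))
       \<and> weak_convergence (\<lambda>j. distr M borel (\<lambda>\<omega>. (S j \<omega>, U j \<omega>))) std_normal_2d"
proof -
  interpret prob_space M by fact
  interpret gaussian_wavelet M X w C \<phi> a
    by unfold_locales (fact assms)+
  have fm: "finite_moments M (S j)" "finite_moments M (U j)" for j
    unfolding S_def U_def divide_inverse
    by (intro finite_moments_mult finite_moments_const statistics_moments; simp)+
  have int: "integrable M (\<lambda>\<omega>. S j \<omega> ^ p1 * U j \<omega> ^ p2)" for j p1 p2
    by (intro finite_moments_integrable finite_moments_intros fm)
  have lim: "(\<lambda>j. \<integral>\<omega>. S j \<omega> ^ p1 * U j \<omega> ^ p2 \<partial>M) \<longlonglongrightarrow> gauss_moment p1 * gauss_moment p2" for p1 p2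
    unfolding S_def U_def by (rule moment_limit[OF assms(3)])
  have meas: "(\<lambda>\<omega>. (S j \<omega>, U j \<omega>)) \<in> borel_measurable M" for j
    using fm[of j] by measurable
  interpret D: moment_convergence "\<lambda>j. distr M borel (\<lambda>\<omega>. (S j \<omega>, U j \<omega>))"
  proof (rule moment_convergence.intro)
    show "prob_space (distr M borel (\<lambda>\<omega>. (S j \<omega>, U j \<omega>)))" for j by (rule prob_space_distr[OF meas])
    show "integrable (distr M borel (\<lambda>\<omega>. (S j \<omega>, U j \<omega>))) (\<lambda>z. fst z ^ p * snd z ^ q)" for j p q
      using int[of j p q] by (subst integrable_distr_eq[OF meas]) auto
    have "(\<integral>z. fst z ^ p * snd z ^ q \<partial>distr M borel (\<lambda>\<omega>. (S j \<omega>, U j \<omega>))) = (\<integral>\<omega>. S j \<omega> ^ p * U j \<omega> ^ q \<partial>M)" for j p q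
      by (subst integral_distr[OF meas]) auto
    then show "(\<lambda>j. \<integral>z. fst z ^ p * snd z ^ q \<partial>distr M borel (\<lambda>\<omega>. (S j \<omega>, U j \<omega>))) \<longlonglongrightarrow>
       (\<integral>x. x ^ p \<partial>std_normal_distribution) * (\<integral>y. y ^ q \<partial>std_normal_distribution)" for p q
      using lim[of p q] by (simp add: std_normal_moment)
  qed simp
  have "weak_convergence (\<lambda>j. distr M borel (\<lambda>\<omega>. (S j \<omega>, U j \<omega>))) std_normal_2d"
    unfolding weak_convergence_def std_normal_2d_eq
  proof (intro allI impI)
    fix f :: "real \<times> real \<Rightarrow> real" assume f: "continuous_on UNIV f \<and> bounded (range f)"
    then obtain B where "\<And>z. \<bar>f z\<bar> \<le> B" by (auto simp: bounded_iff)
    then show "(\<lambda>j. \<integral>z. f z \<partial>distr M borel (\<lambda>\<omega>. (S j \<omega>, U j \<omega>))) \<longlonglongrightarrow> (\<integral>z. f z \<partial>std_normal_pair)"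
      using D.conv_bounded_continuous[of f B] f unfolding D.conv_def by blast
  qed
  moreover have "(if even p1 \<and> even p2 then real (dfact (p1 - 1)) * real (dfact (p2 - 1)) else 0) = gauss_moment p1 * gauss_moment p2" for p1 p2
    by (simp add: gauss_moment_eq_dfact)
  ultimately show ?thesis using int lim by simp
qed

end
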